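(* Let $R$ be a ring which is a free $Z(R)$-module and such that for every $\mathfrak{p}\in \mathrm{ZL}(R)$ the ring $k(\mathfrak{p})\otimes_{Z(R)}R/R\mathfrak{p}$ is a simple artinian ring. Then: 1. The ring $R$ is a PLM-ring with $\mathrm{PL}(R)=\mathrm{Max}(Z(R))$. 2. For every $\mathfrak{m}\in\mathrm{Max}(Z(R))$, $\mathrm{Prim}(R,\mathfrak{m})=\{R\mathfrak{m}\}$. 3. $\mathrm{Prim}(R)=\mathrm{Max}(R)=\{R\mathfrak{m}\mid \mathfrak{m}\in\mathrm{Max}(Z(R))\}$. 4. $\widehat{R}=\{U(\mathfrak{m})\mid \mathfrak{m}\in \mathrm{Max}(Z(R))\}$, where $U(\mathfrak{m})$ is a unique (up to isomorphism) simple module of the simple artinian ring $k(\mathfrak{m})\otimes_{Z(R)}R/R\mathfrak{m}$. 5. The map $\widehat{R}\to\mathrm{Prim}(R)$, $U(\mathfrak{m})\mapsto \mathrm{ann}_R(U(\mathfrak{m}))=R\mathfrak{m}$, is a bijection with inverse $R\mathfrak{m}\mapsto U(\mathfrak{m})$. 6. For every maximal ideal $\mathfrak{m}\in\mathrm{Max}(Z(R))$, $\mathrm{End}_R(U(\mathfrak{m}))\simeq D(\mathfrak{m})$, where $R/R\mathfrak{m}\simeq M_{n(\mathfrak{m})}(D(\mathfrak{m}))$ for some natural number $n(\mathfrak{m})$ and a division ring $D(\mathfrak{m})$ (endomorphisms are written on the right).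
   Context: Rings are unital and modules are left modules. $Z(R)$ is the centre of $R$; $\mathrm{Spec}(R)$, $\mathrm{Max}(R)$, $\mathrm{Prim}(R)$ are the sets of prime ideals, maximal (two-sided) ideals and primitive ideals (annihilators of simple left modules) of $R$; $\widehat{R}$ is the set of isomorphism classes of simple left $R$-modules. $\mathrm{ZL}(R)=\{P\cap Z(R)\mid P\in\mathrm{Spec}(R)\}$ and $\mathrm{PL}(R)=\{P\cap Z(R)\mid P\in\mathrm{Prim}(R)\}$, both subsets of $\mathrm{Spec}(Z(R))$. For $\mathfrak{p}\in\mathrm{PL}(R)$, $\mathrm{Prim}(R,\mathfrak{p})=\{P\in\mathrm{Prim}(R)\mid P\cap Z(R)=\mathfrak{p}\}$. $R$ is a PLM-ring if $\mathrm{PL}(R)\subseteq\mathrm{Max}(Z(R))$. For $\mathfrak{p}\in\mathrm{Spec}(Z(R))$, $k(\mathfrak{p})$ is the field of fractions of $Z(R)/\mathfrak{p}$. *)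

theory Defs
  imports "HOL-Algebra.Algebra"
begin

section \<open>Left modules over an arbitrary ring\<close>

text \<open>The locale \<^locale>\<open>module\<close> requires a commutative base ring. Its record type is reused
  here; the fields \<^const>\<open>monoid.mult\<close> and \<^const>\<open>one\<close> of a module record are irrelevant.\<close>

locale left_module = R?: ring R + M?: abelian_group M
  for R :: "('a, 'k) ring_scheme" (structure) and M :: "('a, 'm, 'l) module_scheme" (structure) +
  assumes smult_closed [simp, intro]:
      "\<lbrakk>a \<in> carrier R; x \<in> carrier M\<rbrakk> \<Longrightarrow> a \<odot>\<^bsub>M\<^esub> x \<in> carrier M"
    and smult_l_distr:
      "\<lbrakk>a \<in> carrier R; b \<in> carrier R; x \<in> carrier M\<rbrakk> \<Longrightarrow>
        (a \<oplus> b) \<odot>\<^bsub>M\<^esub> x = a \<odot>\<^bsub>M\<^esub> x \<oplus>\<^bsub>M\<^esub> b \<odot>\<^bsub>M\<^esub> x"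
    and smult_r_distr:
      "\<lbrakk>a \<in> carrier R; x \<in> carrier M; y \<in> carrier M\<rbrakk> \<Longrightarrow>
        a \<odot>\<^bsub>M\<^esub> (x \<oplus>\<^bsub>M\<^esub> y) = a \<odot>\<^bsub>M\<^esub> x \<oplus>\<^bsub>M\<^esub> a \<odot>\<^bsub>M\<^esub> y"
    and smult_assoc1:
      "\<lbrakk>a \<in> carrier R; b \<in> carrier R; x \<in> carrier M\<rbrakk> \<Longrightarrow>
        (a \<otimes> b) \<odot>\<^bsub>M\<^esub> x = a \<odot>\<^bsub>M\<^esub> (b \<odot>\<^bsub>M\<^esub> x)"
    and smult_one [simp]:
      "x \<in> carrier M \<Longrightarrow> \<one> \<odot>\<^bsub>M\<^esub> x = x"

text \<open>\<open>regular_module R\<close> is also used as a module over subrings of \<open>R\<close>.\<close>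

definition regular_module :: "('a, 'k) ring_scheme \<Rightarrow> ('a, 'a) module" where
  "regular_module R =
    \<lparr>carrier = carrier R, monoid.mult = monoid.mult R, one = \<one>\<^bsub>R\<^esub>,
     ring.zero = \<zero>\<^bsub>R\<^esub>, add = add R, smult = monoid.mult R\<rparr>"

definition restrict_scalars :: "('a \<Rightarrow> 'b) \<Rightarrow> ('b, 'm) module \<Rightarrow> ('a, 'm) module" where
  "restrict_scalars f M =
    \<lparr>carrier = carrier M, monoid.mult = monoid.mult M, one = \<one>\<^bsub>M\<^esub>, ring.zero = \<zero>\<^bsub>M\<^esub>, add = add M,
     smult = (\<lambda>a x. f a \<odot>\<^bsub>M\<^esub> x)\<rparr>"

definition free_left_module :: "('a, 'k) ring_scheme \<Rightarrow> ('a, 'm) module \<Rightarrow> bool" where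
  "free_left_module K M \<longleftrightarrow> left_module K M \<and>
    (\<exists>B \<subseteq> carrier M. \<forall>x \<in> carrier M.
      \<exists>!c. c \<in> (B \<rightarrow>\<^sub>E carrier K) \<and> finite {b \<in> B. c b \<noteq> \<zero>\<^bsub>K\<^esub>} \<and>
           x = (\<Oplus>\<^bsub>M\<^esub>b \<in> {b \<in> B. c b \<noteq> \<zero>\<^bsub>K\<^esub>}. c b \<odot>\<^bsub>M\<^esub> b))"

definition simple_left_module :: "('a, 'k) ring_scheme \<Rightarrow> ('a, 'm) module \<Rightarrow> bool" where
  "simple_left_module R M \<longleftrightarrow> left_module R M \<and> carrier M \<noteq> {\<zero>\<^bsub>M\<^esub>} \<and>
    (\<forall>N. submodule N R M \<longrightarrow> N = {\<zero>\<^bsub>M\<^esub>} \<or> N = carrier M)"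

definition left_module_hom ::
    "('a, 'k) ring_scheme \<Rightarrow> ('a, 'm) module \<Rightarrow> ('a, 'n) module \<Rightarrow> ('m \<Rightarrow> 'n) set" where
  "left_module_hom R M N = {f \<in> carrier M \<rightarrow> carrier N.
    (\<forall>x \<in> carrier M. \<forall>y \<in> carrier M. f (x \<oplus>\<^bsub>M\<^esub> y) = f x \<oplus>\<^bsub>N\<^esub> f y) \<and>
    (\<forall>a \<in> carrier R. \<forall>x \<in> carrier M. f (a \<odot>\<^bsub>M\<^esub> x) = a \<odot>\<^bsub>N\<^esub> f x)}"

definition left_module_iso ::
    "('a, 'k) ring_scheme \<Rightarrow> ('a, 'm) module \<Rightarrow> ('a, 'n) module \<Rightarrow> bool" where
  "left_module_iso R M N \<longleftrightarrow> (\<exists>f \<in> left_module_hom R M N. bij_betw f (carrier M) (carrier N))"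

definition annihilator :: "('a, 'k) ring_scheme \<Rightarrow> ('a, 'm) module \<Rightarrow> 'a set" where
  "annihilator R M = {a \<in> carrier R. \<forall>x \<in> carrier M. a \<odot>\<^bsub>M\<^esub> x = \<zero>\<^bsub>M\<^esub>}"

text \<open>Endomorphisms are written on the right, so the product \<open>f \<otimes> g\<close> is ``first \<open>f\<close>, then \<open>g\<close>''.
  Homomorphisms are made extensional so that each endomorphism is represented once.\<close>

definition endomorphism_ring ::
    "('a, 'k) ring_scheme \<Rightarrow> ('a, 'm) module \<Rightarrow> ('m \<Rightarrow> 'm) ring" where
  "endomorphism_ring R M =
    \<lparr>carrier = left_module_hom R M M \<inter> extensional (carrier M),
     monoid.mult = (\<lambda>f g. \<lambda>x \<in> carrier M. g (f x)),
     one = (\<lambda>x \<in> carrier M. x),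
     ring.zero = (\<lambda>x \<in> carrier M. \<zero>\<^bsub>M\<^esub>),
     add = (\<lambda>f g. \<lambda>x \<in> carrier M. f x \<oplus>\<^bsub>M\<^esub> g x)\<rparr>"


section \<open>The isomorphism classes of simple modules\<close>

text \<open>The classes are taken among modules whose carrier is a set of subsets of \<open>R\<close>. This loses
  nothing: see \<open>simple_left_module_representative\<close> below.\<close>

definition simple_module_class ::
    "('a, 'k) ring_scheme \<Rightarrow> ('a, 'm) module \<Rightarrow> ('a, 'a set) module set" where
  "simple_module_class R M = {N. simple_left_module R N \<and> left_module_iso R M N}"

definition simple_module_classes :: "('a, 'k) ring_scheme \<Rightarrow> ('a, 'a set) module set set" where
  "simple_module_classes R =
    {M. simple_left_module R M} //
    {(M, N). simple_left_module R M \<and> simple_left_module R N \<and> left_module_iso R M N}"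

text \<open>Isomorphic modules have the same annihilator, so the image below is a singleton.\<close>

definition class_annihilator :: "('a, 'k) ring_scheme \<Rightarrow> ('a, 'm) module set \<Rightarrow> 'a set" where
  "class_annihilator R C = the_elem (annihilator R ` C)"


section \<open>Centre, prime, maximal and primitive ideals\<close>

definition centre :: "('a, 'k) ring_scheme \<Rightarrow> 'a set" where
  "centre R = {z \<in> carrier R. \<forall>x \<in> carrier R. z \<otimes>\<^bsub>R\<^esub> x = x \<otimes>\<^bsub>R\<^esub> z}"

definition centre_ring :: "('a, 'k) ring_scheme \<Rightarrow> ('a, 'k) ring_scheme" where
  "centre_ring R = R\<lparr>carrier := centre R\<rparr>"

text \<open>\<^locale>\<open>primeideal\<close> is restricted to commutative rings, hence the following.\<close>

definition Spec :: "('a, 'k) ring_scheme \<Rightarrow> 'a set set" where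
  "Spec R = {P. ideal P R \<and> P \<noteq> carrier R \<and>
    (\<forall>I J. ideal I R \<and> ideal J R \<and> I \<cdot>\<^bsub>R\<^esub> J \<subseteq> P \<longrightarrow> I \<subseteq> P \<or> J \<subseteq> P)}"

definition MaxSpec :: "('a, 'k) ring_scheme \<Rightarrow> 'a set set" where
  "MaxSpec R = {P. maximalideal P R}"

definition Prim :: "('a, 'k) ring_scheme \<Rightarrow> 'a set set" where
  "Prim R = {annihilator R M | M :: ('a, 'a set) module. simple_left_module R M}"

definition ZL :: "('a, 'k) ring_scheme \<Rightarrow> 'a set set" where
  "ZL R = {P \<inter> centre R | P. P \<in> Spec R}"

definition PL :: "('a, 'k) ring_scheme \<Rightarrow> 'a set set" where
  "PL R = {P \<inter> centre R | P. P \<in> Prim R}"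

definition Prim_over :: "('a, 'k) ring_scheme \<Rightarrow> 'a set \<Rightarrow> 'a set set" where
  "Prim_over R p = {P \<in> Prim R. P \<inter> centre R = p}"

definition PLM_ring :: "('a, 'k) ring_scheme \<Rightarrow> bool" where
  "PLM_ring R \<longleftrightarrow> ring R \<and> PL R \<subseteq> MaxSpec (centre_ring R)"

text \<open>\<open>I \<cdot> J\<close> is the set of finite sums of products; hence this is the set \<open>Rp\<close>.\<close>

definition extended_ideal :: "('a, 'k) ring_scheme \<Rightarrow> 'a set \<Rightarrow> 'a set" where
  "extended_ideal R p = carrier R \<cdot>\<^bsub>R\<^esub> p"


section \<open>Simple artinian rings, division rings, matrix rings\<close>

definition simple_ring :: "('a, 'k) ring_scheme \<Rightarrow> bool" where
  "simple_ring A \<longleftrightarrow> ring A \<and> carrier A \<noteq> {\<zero>\<^bsub>A\<^esub>} \<and>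
    (\<forall>I. ideal I A \<longrightarrow> I = {\<zero>\<^bsub>A\<^esub>} \<or> I = carrier A)"

text \<open>Modules being left modules, ``artinian'' is the descending chain condition on left ideals.
  For simple rings it is equivalent to the one on right ideals.\<close>

definition artinian_ring :: "('a, 'k) ring_scheme \<Rightarrow> bool" where
  "artinian_ring A \<longleftrightarrow> ring A \<and>
    (\<forall>I :: nat \<Rightarrow> 'a set.
      (\<forall>n. submodule (I n) A (regular_module A)) \<and> (\<forall>n. I (Suc n) \<subseteq> I n) \<longrightarrow>
      (\<exists>N. \<forall>n \<ge> N. I n = I N))"

definition simple_artinian_ring :: "('a, 'k) ring_scheme \<Rightarrow> bool" where
  "simple_artinian_ring A \<longleftrightarrow> simple_ring A \<and> artinian_ring A"

definition division_ring :: "('a, 'k) ring_scheme \<Rightarrow> bool" where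
  "division_ring D \<longleftrightarrow> ring D \<and> \<one>\<^bsub>D\<^esub> \<noteq> \<zero>\<^bsub>D\<^esub> \<and> Units D = carrier D - {\<zero>\<^bsub>D\<^esub>}"

definition matrix_ring :: "nat \<Rightarrow> ('a, 'k) ring_scheme \<Rightarrow> (nat \<times> nat \<Rightarrow> 'a) ring" where
  "matrix_ring n D =
    \<lparr>carrier = {..<n} \<times> {..<n} \<rightarrow>\<^sub>E carrier D,
     monoid.mult = (\<lambda>A B. \<lambda>(i, j) \<in> {..<n} \<times> {..<n}. \<Oplus>\<^bsub>D\<^esub>k \<in> {..<n}. A (i, k) \<otimes>\<^bsub>D\<^esub> B (k, j)),
     one = (\<lambda>(i, j) \<in> {..<n} \<times> {..<n}. if i = j then \<one>\<^bsub>D\<^esub> else \<zero>\<^bsub>D\<^esub>),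
     ring.zero = (\<lambda>(i, j) \<in> {..<n} \<times> {..<n}. \<zero>\<^bsub>D\<^esub>),
     add = (\<lambda>A B. \<lambda>(i, j) \<in> {..<n} \<times> {..<n}. A (i, j) \<oplus>\<^bsub>D\<^esub> B (i, j))\<rparr>"


section \<open>The field of fractions of a domain\<close>

definition fraction_pairs :: "('a, 'k) ring_scheme \<Rightarrow> ('a \<times> 'a) set" where
  "fraction_pairs D = carrier D \<times> (carrier D - {\<zero>\<^bsub>D\<^esub>})"

definition fraction_rel :: "('a, 'k) ring_scheme \<Rightarrow> (('a \<times> 'a) \<times> ('a \<times> 'a)) set" where
  "fraction_rel D = {((a, b), (c, d)). (a, b) \<in> fraction_pairs D \<and> (c, d) \<in> fraction_pairs D \<and>
     a \<otimes>\<^bsub>D\<^esub> d = c \<otimes>\<^bsub>D\<^esub> b}"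

definition fraction :: "('a, 'k) ring_scheme \<Rightarrow> 'a \<Rightarrow> 'a \<Rightarrow> ('a \<times> 'a) set" where
  "fraction D a b = fraction_rel D `` {(a, b)}"

definition field_of_fractions :: "('a, 'k) ring_scheme \<Rightarrow> ('a \<times> 'a) set ring" where
  "field_of_fractions D =
    \<lparr>carrier = fraction_pairs D // fraction_rel D,
     monoid.mult = (\<lambda>F G. \<Union>x \<in> F. \<Union>y \<in> G.
       fraction D (fst x \<otimes>\<^bsub>D\<^esub> fst y) (snd x \<otimes>\<^bsub>D\<^esub> snd y)),
     one = fraction D \<one>\<^bsub>D\<^esub> \<one>\<^bsub>D\<^esub>,
     ring.zero = fraction D \<zero>\<^bsub>D\<^esub> \<one>\<^bsub>D\<^esub>,
     add = (\<lambda>F G. \<Union>x \<in> F. \<Union>y \<in> G.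
       fraction D (fst x \<otimes>\<^bsub>D\<^esub> snd y \<oplus>\<^bsub>D\<^esub> fst y \<otimes>\<^bsub>D\<^esub> snd x) (snd x \<otimes>\<^bsub>D\<^esub> snd y))\<rparr>"


section \<open>Tensor products of algebras\<close>

text \<open>The free abelian group on \<open>A \<times> B\<close>, with the multiplication that extends
  \<open>(a, b)(a', b') = (aa', bb')\<close> biadditively.\<close>

definition formal_tensor_ring ::
    "('a, 'k) ring_scheme \<Rightarrow> ('b, 'l) ring_scheme \<Rightarrow> ('a \<times> 'b \<Rightarrow>\<^sub>0 int) ring" where
  "formal_tensor_ring A B =
    \<lparr>carrier = carrier (free_Abelian_group (carrier A \<times> carrier B)),
     monoid.mult = (\<lambda>x y. frag_extend (\<lambda>(a, b). frag_extend (\<lambda>(a', b').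
        frag_of (a \<otimes>\<^bsub>A\<^esub> a', b \<otimes>\<^bsub>B\<^esub> b')) y) x),
     one = frag_of (\<one>\<^bsub>A\<^esub>, \<one>\<^bsub>B\<^esub>),
     ring.zero = 0,
     add = (+)\<rparr>"

text \<open>\<open>A\<close> and \<open>B\<close> are algebras over \<open>K\<close> via \<open>f :: K \<rightarrow> A\<close> and \<open>g :: K \<rightarrow> B\<close> with central images.\<close>

definition tensor_relators ::
    "('c, 'j) ring_scheme \<Rightarrow> ('c \<Rightarrow> 'a) \<Rightarrow> ('a, 'k) ring_scheme \<Rightarrow> ('c \<Rightarrow> 'b) \<Rightarrow>
     ('b, 'l) ring_scheme \<Rightarrow> ('a \<times> 'b \<Rightarrow>\<^sub>0 int) set" where
  "tensor_relators K f A g B =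
    {frag_of (a \<oplus>\<^bsub>A\<^esub> a', b) - frag_of (a, b) - frag_of (a', b) | a a' b.
       a \<in> carrier A \<and> a' \<in> carrier A \<and> b \<in> carrier B} \<union>
    {frag_of (a, b \<oplus>\<^bsub>B\<^esub> b') - frag_of (a, b) - frag_of (a, b') | a b b'.
       a \<in> carrier A \<and> b \<in> carrier B \<and> b' \<in> carrier B} \<union>
    {frag_of (a \<otimes>\<^bsub>A\<^esub> f z, b) - frag_of (a, g z \<otimes>\<^bsub>B\<^esub> b) | a z b.
       a \<in> carrier A \<and> z \<in> carrier K \<and> b \<in> carrier B}"

definition tensor_kernel ::
    "('c, 'j) ring_scheme \<Rightarrow> ('c \<Rightarrow> 'a) \<Rightarrow> ('a, 'k) ring_scheme \<Rightarrow> ('c \<Rightarrow> 'b) \<Rightarrow>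
     ('b, 'l) ring_scheme \<Rightarrow> ('a \<times> 'b \<Rightarrow>\<^sub>0 int) set" where
  "tensor_kernel K f A g B =
    generate (free_Abelian_group (carrier A \<times> carrier B)) (tensor_relators K f A g B)"

definition tensor_ring ::
    "('c, 'j) ring_scheme \<Rightarrow> ('c \<Rightarrow> 'a) \<Rightarrow> ('a, 'k) ring_scheme \<Rightarrow> ('c \<Rightarrow> 'b) \<Rightarrow>
     ('b, 'l) ring_scheme \<Rightarrow> ('a \<times> 'b \<Rightarrow>\<^sub>0 int) set ring" where
  "tensor_ring K f A g B = formal_tensor_ring A B Quot tensor_kernel K f A g B"

definition pure_tensor ::
    "('c, 'j) ring_scheme \<Rightarrow> ('c \<Rightarrow> 'a) \<Rightarrow> ('a, 'k) ring_scheme \<Rightarrow> ('c \<Rightarrow> 'b) \<Rightarrow>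
     ('b, 'l) ring_scheme \<Rightarrow> 'a \<Rightarrow> 'b \<Rightarrow> ('a \<times> 'b \<Rightarrow>\<^sub>0 int) set" where
  "pure_tensor K f A g B a b =
    tensor_kernel K f A g B +>\<^bsub>formal_tensor_ring A B\<^esub> frag_of (a, b)"


section \<open>The ring \<open>k(p) \<otimes> R/Rp\<close> over the centre and its simple module\<close>

definition residue_domain :: "('a, 'k) ring_scheme \<Rightarrow> 'a set \<Rightarrow> 'a set ring" where
  "residue_domain R p = centre_ring R Quot p"

definition residue_field :: "('a, 'k) ring_scheme \<Rightarrow> 'a set \<Rightarrow> ('a set \<times> 'a set) set ring" where
  "residue_field R p = field_of_fractions (residue_domain R p)"

definition to_residue_field :: "('a, 'k) ring_scheme \<Rightarrow> 'a set \<Rightarrow> 'a \<Rightarrow> ('a set \<times> 'a set) set" where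
  "to_residue_field R p z =
    fraction (residue_domain R p) (p +>\<^bsub>centre_ring R\<^esub> z) \<one>\<^bsub>residue_domain R p\<^esub>"

definition to_quotient :: "('a, 'k) ring_scheme \<Rightarrow> 'a set \<Rightarrow> 'a \<Rightarrow> 'a set" where
  "to_quotient R p r = extended_ideal R p +>\<^bsub>R\<^esub> r"

type_synonym 'a fibre = "((('a set \<times> 'a set) set \<times> 'a set) \<Rightarrow>\<^sub>0 int) set"

definition fibre_ring :: "('a, 'k) ring_scheme \<Rightarrow> 'a set \<Rightarrow> 'a fibre ring" where
  "fibre_ring R p =
    tensor_ring (centre_ring R) (to_residue_field R p) (residue_field R p)
      (to_quotient R p) (R Quot extended_ideal R p)"

definition to_fibre_ring :: "('a, 'k) ring_scheme \<Rightarrow> 'a set \<Rightarrow> 'a \<Rightarrow> 'a fibre" where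
  "to_fibre_ring R p r =
    pure_tensor (centre_ring R) (to_residue_field R p) (residue_field R p)
      (to_quotient R p) (R Quot extended_ideal R p) \<one>\<^bsub>residue_field R p\<^esub> (to_quotient R p r)"

text \<open>A simple module of \<open>k(m) \<otimes> R/Rm\<close>, and the same module viewed over \<open>R\<close>.\<close>

definition fibre_simple_module ::
    "('a, 'k) ring_scheme \<Rightarrow> 'a set \<Rightarrow> ('a fibre, 'a fibre set) module" where
  "fibre_simple_module R m = (SOME M. simple_left_module (fibre_ring R m) M)"

definition U_mod :: "('a, 'k) ring_scheme \<Rightarrow> 'a set \<Rightarrow> ('a, 'a fibre set) module" where
  "U_mod R m = restrict_scalars (to_fibre_ring R m) (fibre_simple_module R m)"


section \<open>Every simple module is isomorphic to one on a set of subsets of the ring\<close>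

lemma left_module_transport:
  fixes M :: "('a, 'm) module" and g :: "'m \<Rightarrow> 'n"
  assumes M: "left_module R M" and g: "inj_on g (carrier M)"
  defines "h \<equiv> inv_into (carrier M) g"
  defines "N \<equiv> \<lparr>carrier = g ` carrier M, monoid.mult = undefined, one = undefined,
    ring.zero = g \<zero>\<^bsub>M\<^esub>, add = (\<lambda>a b. g (h a \<oplus>\<^bsub>M\<^esub> h b)), smult = (\<lambda>r a. g (r \<odot>\<^bsub>M\<^esub> h a))\<rparr>"
  shows "left_module R N" and "g \<in> left_module_hom R M N" and "bij_betw g (carrier M) (carrier N)"
proof -
  interpret left_module R M by fact
  have hg [simp]: "h (g y) = y" if "y \<in> carrier M" for y
    using that g by (simp add: h_def)
  have [simp]: "carrier N = g ` carrier M" "\<zero>\<^bsub>N\<^esub> = g \<zero>\<^bsub>M\<^esub>"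
    "a \<oplus>\<^bsub>N\<^esub> b = g (h a \<oplus>\<^bsub>M\<^esub> h b)" "r \<odot>\<^bsub>N\<^esub> a = g (r \<odot>\<^bsub>M\<^esub> h a)" for a b r
    by (simp_all add: N_def)
  have "abelian_group N"
  proof (rule abelian_groupI)
    fix a assume "a \<in> carrier N"
    then obtain y where "y \<in> carrier M" "a = g y" by auto
    then show "\<exists>b\<in>carrier N. b \<oplus>\<^bsub>N\<^esub> a = \<zero>\<^bsub>N\<^esub>"
      by (intro bexI[of _ "g (\<ominus>\<^bsub>M\<^esub> y)"]) (auto simp: M.l_neg)
  qed (auto simp: M.add.m_ac)
  then show "left_module R N"
    by (intro left_module.intro left_module_axioms.intro)
      (auto simp: R.ring_axioms smult_l_distr smult_r_distr smult_assoc1)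
  show "g \<in> left_module_hom R M N" "bij_betw g (carrier M) (carrier N)"
    using g by (auto simp: left_module_hom_def bij_betw_def)
qed

lemma simple_left_module_transfer:
  assumes M: "simple_left_module R M" and N: "left_module R N"
    and g: "g \<in> left_module_hom R M N" and b: "bij_betw g (carrier M) (carrier N)"
  shows "simple_left_module R N"
proof -
  interpret M: left_module R M using M by (simp add: simple_left_module_def)
  interpret N: left_module R N by fact
  have gc: "g x \<in> carrier N" if "x \<in> carrier M" for x using g that by (auto simp: left_module_hom_def)
  have ga: "g (x \<oplus>\<^bsub>M\<^esub> y) = g x \<oplus>\<^bsub>N\<^esub> g y" if "x \<in> carrier M" "y \<in> carrier M" for x y
    using g that by (auto simp: left_module_hom_def)
  have gs: "g (a \<odot>\<^bsub>M\<^esub> y) = a \<odot>\<^bsub>N\<^esub> g y" if "a \<in> carrier R" "y \<in> carrier M" for a y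
    using g that by (auto simp: left_module_hom_def)
  have g0: "g \<zero>\<^bsub>M\<^esub> = \<zero>\<^bsub>N\<^esub>"
    using ga[of "\<zero>\<^bsub>M\<^esub>" "\<zero>\<^bsub>M\<^esub>"] gc[of "\<zero>\<^bsub>M\<^esub>"] by (simp add: N.M.add.l_cancel_one')
  have inj: "inj_on g (carrier M)" and img: "g ` carrier M = carrier N"
    using b by (auto simp: bij_betw_def)
  have "carrier N \<noteq> {\<zero>\<^bsub>N\<^esub>}"
  proof
    assume "carrier N = {\<zero>\<^bsub>N\<^esub>}"
    then have "carrier M = {\<zero>\<^bsub>M\<^esub>}"
      using inj gc g0 by (auto simp: inj_on_def)
    with M show False by (simp add: simple_left_module_def)
  qed
  moreover have "S = {\<zero>\<^bsub>N\<^esub>} \<or> S = carrier N" if S: "submodule S R N" for S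
  proof -
    interpret S: submodule S R N by fact
    define T where "T = {x \<in> carrier M. g x \<in> S}"
    have gm: "g (\<ominus>\<^bsub>M\<^esub> x) = \<ominus>\<^bsub>N\<^esub> g x" if "x \<in> carrier M" for x
      by (metis that M.M.a_inv_closed M.M.l_neg N.M.minus_equality ga gc g0)
    have "submodule T R M"
    proof (intro submodule.intro submodule_axioms.intro subgroup.intro)
      show "inv\<^bsub>add_monoid M\<^esub> x \<in> T" if "x \<in> T" for x
        using that gm S.m_inv_closed unfolding T_def
        by (simp add: a_inv_def[symmetric]) 
    qed (use S.m_closed S.one_closed in \<open>auto simp: T_def ga gs g0\<close>)
    then have "T = {\<zero>\<^bsub>M\<^esub>} \<or> T = carrier M"
      using M by (simp add: simple_left_module_def)
    moreover have "S = g ` T"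
      using S.subset img by (auto simp: T_def image_iff)
    ultimately show ?thesis using g0 img by auto
  qed
  ultimately show ?thesis using N by (simp add: simple_left_module_def)
qed

lemma simple_left_module_representative:
  fixes M :: "('a, 'm) module"
  assumes "simple_left_module R M"
  shows "\<exists>N :: ('a, 'a set) module. simple_left_module R N \<and> left_module_iso R M N"
proof -
  interpret left_module R M using assms by (simp add: simple_left_module_def)
  obtain x where x: "x \<in> carrier M" "x \<noteq> \<zero>\<^bsub>M\<^esub>"
    using assms M.zero_closed by (fastforce simp: simple_left_module_def)
  define S where "S = (\<lambda>r. r \<odot>\<^bsub>M\<^esub> x) ` carrier R"
  have SM: "S \<subseteq> carrier M" using x by (auto simp: S_def)
  have neg: "\<ominus>\<^bsub>M\<^esub> (r \<odot>\<^bsub>M\<^esub> x) = (\<ominus>\<^bsub>R\<^esub> r) \<odot>\<^bsub>M\<^esub> x" if "r \<in> carrier R" for r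
  proof (rule M.minus_equality)
    have "\<zero>\<^bsub>R\<^esub> \<odot>\<^bsub>M\<^esub> x = \<zero>\<^bsub>M\<^esub>"
      using smult_l_distr[of "\<zero>\<^bsub>R\<^esub>" "\<zero>\<^bsub>R\<^esub>" x] x(1)
      by (metis M.add.l_cancel_one' R.l_zero R.zero_closed smult_closed)
    then show "\<ominus>\<^bsub>R\<^esub> r \<odot>\<^bsub>M\<^esub> x \<oplus>\<^bsub>M\<^esub> r \<odot>\<^bsub>M\<^esub> x = \<zero>\<^bsub>M\<^esub>"
      by (metis that R.a_inv_closed R.l_neg smult_l_distr x(1))
  qed (use that x in auto)
  have x_S: "x \<in> S"
    using x(1) by (auto simp: S_def intro!: image_eqI[of _ _ "\<one>\<^bsub>R\<^esub>"])
  have plus: "y \<oplus>\<^bsub>M\<^esub> z \<in> S" if "y \<in> S" "z \<in> S" for y z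
  proof -
    from that obtain r s where "r \<in> carrier R" "y = r \<odot>\<^bsub>M\<^esub> x" "s \<in> carrier R" "z = s \<odot>\<^bsub>M\<^esub> x"
      by (auto simp: S_def)
    then show ?thesis
      using x(1) by (auto simp: S_def smult_l_distr[symmetric])
  qed
  have minus: "\<ominus>\<^bsub>M\<^esub> y \<in> S" if "y \<in> S" for y
    using that by (auto simp: S_def neg)
  have "submodule S R M"
  proof (intro submodule.intro submodule_axioms.intro subgroup.intro)
    show "\<one>\<^bsub>add_monoid M\<^esub> \<in> S"
      using plus[OF minus[OF x_S] x_S] x(1) by (simp add: M.l_neg)
    show "inv\<^bsub>add_monoid M\<^esub> y \<in> S" if "y \<in> S" for y
      using minus[OF that] by (simp add: a_inv_def)
    show "a \<odot>\<^bsub>M\<^esub> y \<in> S" if "a \<in> carrier R" "y \<in> S" for a y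
      using that x(1) by (auto simp: S_def smult_assoc1[symmetric])
  qed (use SM plus in auto)
  then have S: "S = carrier M"
    using assms x_S x(2) by (auto simp: simple_left_module_def)
  define g where "g = (\<lambda>y. {r \<in> carrier R. r \<odot>\<^bsub>M\<^esub> x = y})"
  have "inj_on g (carrier M)"
  proof (rule inj_onI)
    fix y z assume "y \<in> carrier M" and eq: "g y = g z"
    then obtain r where "r \<in> carrier R" "y = r \<odot>\<^bsub>M\<^esub> x" using S by (auto simp: S_def)
    then have "r \<in> g z" using eq by (auto simp: g_def)
    then show "y = z" using \<open>y = _\<close> by (simp add: g_def)
  qed
  from left_module_transport[OF left_module_axioms this]
  show ?thesis
    using simple_left_module_transfer[OF assms] unfolding left_module_iso_def by blast
qed


section \<open>The constructions above are rings, modules and fields as intended\<close>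

lemma left_module_iff_module: "cring R \<Longrightarrow> left_module R M \<longleftrightarrow> module R M"
  by (auto simp: left_module_def module_def left_module_axioms_def module_axioms_def cring.axioms)

lemma cring_centre_ring:
  assumes "ring R" shows "cring (centre_ring R)"
proof -
  interpret ring R by fact
  have c: "z \<in> carrier R" and com: "x \<in> carrier R \<Longrightarrow> z \<otimes>\<^bsub>R\<^esub> x = x \<otimes>\<^bsub>R\<^esub> z" if "z \<in> centre R" for z x
    using that by (auto simp: centre_def)
  have I: "z \<in> centre R"
    if "z \<in> carrier R" "\<And>x. x \<in> carrier R \<Longrightarrow> z \<otimes>\<^bsub>R\<^esub> x = x \<otimes>\<^bsub>R\<^esub> z" for z
    using that by (auto simp: centre_def)
  have "subring (centre R) R"
  proof (rule subringI)
    fix x y assume xy: "x \<in> centre R" "y \<in> centre R"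
    show "x \<otimes>\<^bsub>R\<^esub> y \<in> centre R"
    proof (rule I)
      fix z assume z: "z \<in> carrier R"
      have "x \<otimes>\<^bsub>R\<^esub> y \<otimes>\<^bsub>R\<^esub> z = x \<otimes>\<^bsub>R\<^esub> (z \<otimes>\<^bsub>R\<^esub> y)"
        using xy z c com[of y z] by (simp add: m_assoc)
      also have "\<dots> = z \<otimes>\<^bsub>R\<^esub> (x \<otimes>\<^bsub>R\<^esub> y)"
        using xy z c com[of x z] m_assoc by metis
      finally show "x \<otimes>\<^bsub>R\<^esub> y \<otimes>\<^bsub>R\<^esub> z = z \<otimes>\<^bsub>R\<^esub> (x \<otimes>\<^bsub>R\<^esub> y)" .
    qed (use xy c in auto)
    show "x \<oplus>\<^bsub>R\<^esub> y \<in> centre R"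
      by (rule I) (use xy c com in \<open>simp_all add: l_distr r_distr\<close>)
  next
    fix x assume x: "x \<in> centre R"
    show "\<ominus>\<^bsub>R\<^esub> x \<in> centre R"
      by (rule I) (use x c com in \<open>simp_all add: l_minus r_minus\<close>)
  qed (auto intro: I c)
  then have "subcring (centre R) R"
    by (intro subcring.intro subcring_axioms.intro) (simp_all add: c com)
  then show ?thesis
    using subcring_iff[of "centre R"] c by (auto simp: centre_ring_def)
qed

lemma left_module_regular_centre:
  assumes "ring R" shows "left_module (centre_ring R) (regular_module R)"
proof -
  interpret ring R by fact
  have "abelian_group (regular_module R)"
  proof (rule abelian_groupI)
    fix x assume "x \<in> carrier (regular_module R)"
    then show "\<exists>y\<in>carrier (regular_module R). y \<oplus>\<^bsub>regular_module R\<^esub> x = \<zero>\<^bsub>regular_module R\<^esub>"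
      by (intro bexI[of _ "\<ominus>\<^bsub>R\<^esub> x"]) (auto simp: regular_module_def l_neg)
  qed (auto simp: regular_module_def a_ac)
  moreover have "ring (centre_ring R)"
    using cring_centre_ring[OF assms] by (simp add: cring_def)
  moreover have "centre R \<subseteq> carrier R" by (auto simp: centre_def)
  ultimately show ?thesis
    by (intro left_module.intro left_module_axioms.intro)
       (auto simp: regular_module_def centre_ring_def l_distr r_distr m_assoc subset_iff)
qed

lemma equiv_fraction_rel:
  assumes "domain D" shows "equiv (fraction_pairs D) (fraction_rel D)"
proof -
  interpret domain D by fact
  show ?thesis
  proof (rule equivI)
    show "trans (fraction_rel D)"
    proof (rule transI, clarsimp simp: fraction_rel_def fraction_pairs_def)
      fix a b c d e f
      assume *: "a \<in> carrier D" "b \<in> carrier D" "c \<in> carrier D" "d \<in> carrier D" "e \<in> carrier D"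
        "f \<in> carrier D" "d \<noteq> \<zero>\<^bsub>D\<^esub>" "a \<otimes>\<^bsub>D\<^esub> d = c \<otimes>\<^bsub>D\<^esub> b" "c \<otimes>\<^bsub>D\<^esub> f = e \<otimes>\<^bsub>D\<^esub> d"
      have "d \<otimes>\<^bsub>D\<^esub> (a \<otimes>\<^bsub>D\<^esub> f) = (a \<otimes>\<^bsub>D\<^esub> d) \<otimes>\<^bsub>D\<^esub> f" using *(1-6) by (simp add: m_ac)
      also have "\<dots> = (c \<otimes>\<^bsub>D\<^esub> f) \<otimes>\<^bsub>D\<^esub> b" unfolding *(8) using *(1-6) by (simp add: m_ac)
      also have "\<dots> = d \<otimes>\<^bsub>D\<^esub> (e \<otimes>\<^bsub>D\<^esub> b)" unfolding *(9) using *(1-6) by (simp add: m_ac)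
      finally show "a \<otimes>\<^bsub>D\<^esub> f = e \<otimes>\<^bsub>D\<^esub> b" using * m_lcancel by simp
    qed
  qed (auto simp: refl_on_def sym_def fraction_rel_def fraction_pairs_def)
qed

lemma fraction_eq_iff:
  assumes "domain D" "(a, b) \<in> fraction_pairs D" "(c, d) \<in> fraction_pairs D"
  shows "fraction D a b = fraction D c d \<longleftrightarrow> a \<otimes>\<^bsub>D\<^esub> d = c \<otimes>\<^bsub>D\<^esub> b"
  unfolding fraction_def
  using eq_equiv_class_iff[OF equiv_fraction_rel[OF assms(1)] assms(2,3)] assms(2,3)
  by (auto simp: fraction_rel_def)

lemma fraction_add_mult:
  fixes D :: "('a, 'k) ring_scheme"
  assumes "domain D" "a \<in> carrier D" "b \<in> carrier D" "c \<in> carrier D" "d \<in> carrier D"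
     "b \<noteq> \<zero>\<^bsub>D\<^esub>" "d \<noteq> \<zero>\<^bsub>D\<^esub>"
  shows "fraction D a b \<otimes>\<^bsub>field_of_fractions D\<^esub> fraction D c d =
           fraction D (a \<otimes>\<^bsub>D\<^esub> c) (b \<otimes>\<^bsub>D\<^esub> d)" (is ?mult)
    and "fraction D a b \<oplus>\<^bsub>field_of_fractions D\<^esub> fraction D c d =
           fraction D (a \<otimes>\<^bsub>D\<^esub> d \<oplus>\<^bsub>D\<^esub> c \<otimes>\<^bsub>D\<^esub> b) (b \<otimes>\<^bsub>D\<^esub> d)" (is ?add)
proof -
  interpret domain D by fact
  note eqv = equiv_fraction_rel[OF assms(1)]
  have in1: "(a, b) \<in> fraction D a b" "(c, d) \<in> fraction D c d"
    using assms by (auto simp: fraction_def fraction_rel_def fraction_pairs_def)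
  have mem: "(x, y) \<in> fraction D p q \<longleftrightarrow> (p, q) \<in> fraction_pairs D \<and> (x, y) \<in> fraction_pairs D \<and>
      p \<otimes>\<^bsub>D\<^esub> y = x \<otimes>\<^bsub>D\<^esub> q" for x y p q
    by (auto simp: fraction_def fraction_rel_def)
  have "fraction D (x \<otimes>\<^bsub>D\<^esub> z) (y \<otimes>\<^bsub>D\<^esub> w) = fraction D (a \<otimes>\<^bsub>D\<^esub> c) (b \<otimes>\<^bsub>D\<^esub> d) \<and>
     fraction D (x \<otimes>\<^bsub>D\<^esub> w \<oplus>\<^bsub>D\<^esub> z \<otimes>\<^bsub>D\<^esub> y) (y \<otimes>\<^bsub>D\<^esub> w) =
       fraction D (a \<otimes>\<^bsub>D\<^esub> d \<oplus>\<^bsub>D\<^esub> c \<otimes>\<^bsub>D\<^esub> b) (b \<otimes>\<^bsub>D\<^esub> d)"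
    if "(x, y) \<in> fraction D a b" "(z, w) \<in> fraction D c d" for x y z w
  proof -
    have *: "x \<in> carrier D" "y \<in> carrier D" "z \<in> carrier D" "w \<in> carrier D" "y \<noteq> \<zero>\<^bsub>D\<^esub>" "w \<noteq> \<zero>\<^bsub>D\<^esub>"
      "a \<otimes>\<^bsub>D\<^esub> y = x \<otimes>\<^bsub>D\<^esub> b" "c \<otimes>\<^bsub>D\<^esub> w = z \<otimes>\<^bsub>D\<^esub> d"
      using that by (auto simp: mem fraction_pairs_def)
    have "(x \<otimes>\<^bsub>D\<^esub> z) \<otimes>\<^bsub>D\<^esub> (b \<otimes>\<^bsub>D\<^esub> d) = (x \<otimes>\<^bsub>D\<^esub> b) \<otimes>\<^bsub>D\<^esub> (z \<otimes>\<^bsub>D\<^esub> d)"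
      using *(1-4) assms(2-5) by (simp add: m_ac)
    also have "\<dots> = (a \<otimes>\<^bsub>D\<^esub> c) \<otimes>\<^bsub>D\<^esub> (y \<otimes>\<^bsub>D\<^esub> w)"
      unfolding *(7,8)[symmetric] using *(1-4) assms(2-5) by (simp add: m_ac)
    finally have 1: "(x \<otimes>\<^bsub>D\<^esub> z) \<otimes>\<^bsub>D\<^esub> (b \<otimes>\<^bsub>D\<^esub> d) = (a \<otimes>\<^bsub>D\<^esub> c) \<otimes>\<^bsub>D\<^esub> (y \<otimes>\<^bsub>D\<^esub> w)" .
    have "(x \<otimes>\<^bsub>D\<^esub> w \<oplus>\<^bsub>D\<^esub> z \<otimes>\<^bsub>D\<^esub> y) \<otimes>\<^bsub>D\<^esub> (b \<otimes>\<^bsub>D\<^esub> d) =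
       (x \<otimes>\<^bsub>D\<^esub> b) \<otimes>\<^bsub>D\<^esub> (w \<otimes>\<^bsub>D\<^esub> d) \<oplus>\<^bsub>D\<^esub> (z \<otimes>\<^bsub>D\<^esub> d) \<otimes>\<^bsub>D\<^esub> (y \<otimes>\<^bsub>D\<^esub> b)"
      using *(1-4) assms(2-5) by (simp add: m_ac l_distr r_distr)
    also have "\<dots> = (a \<otimes>\<^bsub>D\<^esub> d \<oplus>\<^bsub>D\<^esub> c \<otimes>\<^bsub>D\<^esub> b) \<otimes>\<^bsub>D\<^esub> (y \<otimes>\<^bsub>D\<^esub> w)"
      unfolding *(7,8)[symmetric] using *(1-4) assms(2-5) by (simp add: m_ac l_distr r_distr)
    finally have 2: "(x \<otimes>\<^bsub>D\<^esub> w \<oplus>\<^bsub>D\<^esub> z \<otimes>\<^bsub>D\<^esub> y) \<otimes>\<^bsub>D\<^esub> (b \<otimes>\<^bsub>D\<^esub> d) =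
      (a \<otimes>\<^bsub>D\<^esub> d \<oplus>\<^bsub>D\<^esub> c \<otimes>\<^bsub>D\<^esub> b) \<otimes>\<^bsub>D\<^esub> (y \<otimes>\<^bsub>D\<^esub> w)" .
    show ?thesis
      using 1 2 * assms integral[of y w] integral[of b d]
      by (subst (1 2) fraction_eq_iff) (auto simp: fraction_pairs_def)
  qed
  note * = this
  have const: "(\<Union>x \<in> F. \<Union>y \<in> G. h x y) = C"
    if "p \<in> F" "q \<in> G" "\<And>x y. x \<in> F \<Longrightarrow> y \<in> G \<Longrightarrow> h x y = C"
    for F G :: "('a \<times> 'a) set" and h :: "'a \<times> 'a \<Rightarrow> 'a \<times> 'a \<Rightarrow> ('a \<times> 'a) set" and C p q
    using that by blast
  show ?mult
    unfolding field_of_fractions_def monoid.simps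
    by (rule const[OF in1]) (use * in \<open>force simp: split_paired_all\<close>)
  show ?add
    unfolding field_of_fractions_def ring.simps
    by (rule const[OF in1]) (use * in \<open>force simp: split_paired_all\<close>)
qed

lemma carrier_field_of_fractions:
  "carrier (field_of_fractions D) =
    {fraction D a b | a b. a \<in> carrier D \<and> b \<in> carrier D \<and> b \<noteq> \<zero>\<^bsub>D\<^esub>}"
  by (auto simp: field_of_fractions_def quotient_def fraction_def fraction_pairs_def)

lemma field_field_of_fractions:
  assumes "domain D" shows "field (field_of_fractions D)"
proof -
  interpret domain D by fact
  let ?Q = "field_of_fractions D"
  have one: "\<one>\<^bsub>?Q\<^esub> = fraction D \<one>\<^bsub>D\<^esub> \<one>\<^bsub>D\<^esub>" and zero: "\<zero>\<^bsub>?Q\<^esub> = fraction D \<zero>\<^bsub>D\<^esub> \<one>\<^bsub>D\<^esub>"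
    by (simp_all add: field_of_fractions_def)
  note ops = fraction_add_mult[OF assms]
  note car = carrier_field_of_fractions[of D]
  have frc: "fraction D a b \<in> carrier ?Q" if "a \<in> carrier D" "b \<in> carrier D" "b \<noteq> \<zero>\<^bsub>D\<^esub>" for a b
    using that by (auto simp: car)
  note feq = fraction_eq_iff[OF assms]
  have E: "\<exists>a b. x = fraction D a b \<and> a \<in> carrier D \<and> b \<in> carrier D \<and> b \<noteq> \<zero>\<^bsub>D\<^esub>"
    if "x \<in> carrier ?Q" for x using that by (auto simp: car)
  have nz: "b \<otimes>\<^bsub>D\<^esub> d \<noteq> \<zero>\<^bsub>D\<^esub>" if "b \<in> carrier D" "b \<noteq> \<zero>\<^bsub>D\<^esub>" "d \<in> carrier D" "d \<noteq> \<zero>\<^bsub>D\<^esub>" for b d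
    using that integral by blast
  have "cring ?Q"
  proof (rule cringI)
    show "abelian_group ?Q"
    proof (rule abelian_groupI)
      fix x y assume "x \<in> carrier ?Q" "y \<in> carrier ?Q"
      then obtain a b c d where xyz: "x = fraction D a b" "a \<in> carrier D" "b \<in> carrier D" "b \<noteq> \<zero>\<^bsub>D\<^esub>"
        "y = fraction D c d" "c \<in> carrier D" "d \<in> carrier D" "d \<noteq> \<zero>\<^bsub>D\<^esub>"
        using E by meson
      then show "x \<oplus>\<^bsub>?Q\<^esub> y \<in> carrier ?Q" "x \<oplus>\<^bsub>?Q\<^esub> y = y \<oplus>\<^bsub>?Q\<^esub> x"
        by (simp_all add: ops nz frc m_ac a_ac)
    next
      fix x y z assume "x \<in> carrier ?Q" "y \<in> carrier ?Q" "z \<in> carrier ?Q"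
      then obtain a b c d e f where xyz: "x = fraction D a b" "a \<in> carrier D" "b \<in> carrier D" "b \<noteq> \<zero>\<^bsub>D\<^esub>"
        "y = fraction D c d" "c \<in> carrier D" "d \<in> carrier D" "d \<noteq> \<zero>\<^bsub>D\<^esub>"
        "z = fraction D e f" "e \<in> carrier D" "f \<in> carrier D" "f \<noteq> \<zero>\<^bsub>D\<^esub>"
        using E by meson
      then show "x \<oplus>\<^bsub>?Q\<^esub> y \<oplus>\<^bsub>?Q\<^esub> z = x \<oplus>\<^bsub>?Q\<^esub> (y \<oplus>\<^bsub>?Q\<^esub> z)"
        by (simp add: ops nz m_ac a_ac l_distr r_distr)
    next
      fix x assume "x \<in> carrier ?Q"
      then obtain a b where x: "x = fraction D a b" "a \<in> carrier D" "b \<in> carrier D" "b \<noteq> \<zero>\<^bsub>D\<^esub>"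
        using E by meson
      then show "\<zero>\<^bsub>?Q\<^esub> \<oplus>\<^bsub>?Q\<^esub> x = x" by (simp add: zero ops)
      show "\<exists>y\<in>carrier ?Q. y \<oplus>\<^bsub>?Q\<^esub> x = \<zero>\<^bsub>?Q\<^esub>"
      proof (rule bexI)
        show "fraction D (\<ominus>\<^bsub>D\<^esub> a) b \<oplus>\<^bsub>?Q\<^esub> x = \<zero>\<^bsub>?Q\<^esub>"
          using x by (simp add: zero ops nz feq fraction_pairs_def l_minus l_neg)
      qed (use x in \<open>auto intro: frc\<close>)
    qed (auto simp: zero intro: frc)
    show "comm_monoid ?Q"
    proof (rule comm_monoidI)
      fix x y z assume "x \<in> carrier ?Q" "y \<in> carrier ?Q" "z \<in> carrier ?Q"
      then obtain a b c d e f where xyz: "x = fraction D a b" "a \<in> carrier D" "b \<in> carrier D" "b \<noteq> \<zero>\<^bsub>D\<^esub>"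
        "y = fraction D c d" "c \<in> carrier D" "d \<in> carrier D" "d \<noteq> \<zero>\<^bsub>D\<^esub>"
        "z = fraction D e f" "e \<in> carrier D" "f \<in> carrier D" "f \<noteq> \<zero>\<^bsub>D\<^esub>"
        using E by meson
      then show "x \<otimes>\<^bsub>?Q\<^esub> y \<otimes>\<^bsub>?Q\<^esub> z = x \<otimes>\<^bsub>?Q\<^esub> (y \<otimes>\<^bsub>?Q\<^esub> z)"
        by (simp add: ops nz m_assoc)
    next
      fix x y assume "x \<in> carrier ?Q" "y \<in> carrier ?Q"
      then obtain a b c d where xyz: "x = fraction D a b" "a \<in> carrier D" "b \<in> carrier D" "b \<noteq> \<zero>\<^bsub>D\<^esub>"
        "y = fraction D c d" "c \<in> carrier D" "d \<in> carrier D" "d \<noteq> \<zero>\<^bsub>D\<^esub>"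
        using E by meson
      then show "x \<otimes>\<^bsub>?Q\<^esub> y \<in> carrier ?Q" "x \<otimes>\<^bsub>?Q\<^esub> y = y \<otimes>\<^bsub>?Q\<^esub> x"
        by (simp_all add: ops nz frc m_comm)
    next
      fix x assume "x \<in> carrier ?Q"
      then obtain a b where "x = fraction D a b" "a \<in> carrier D" "b \<in> carrier D" "b \<noteq> \<zero>\<^bsub>D\<^esub>"
        by (blast dest: E)
      then show "\<one>\<^bsub>?Q\<^esub> \<otimes>\<^bsub>?Q\<^esub> x = x" by (simp add: one ops)
    qed (auto simp: one intro: frc)
    fix x y z assume "x \<in> carrier ?Q" "y \<in> carrier ?Q" "z \<in> carrier ?Q"
    then obtain a b c d e f where xyz: "x = fraction D a b" "a \<in> carrier D" "b \<in> carrier D" "b \<noteq> \<zero>\<^bsub>D\<^esub>"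
        "y = fraction D c d" "c \<in> carrier D" "d \<in> carrier D" "d \<noteq> \<zero>\<^bsub>D\<^esub>"
        "z = fraction D e f" "e \<in> carrier D" "f \<in> carrier D" "f \<noteq> \<zero>\<^bsub>D\<^esub>"
      using E by meson
    let ?n = "(a \<otimes>\<^bsub>D\<^esub> d \<oplus>\<^bsub>D\<^esub> c \<otimes>\<^bsub>D\<^esub> b) \<otimes>\<^bsub>D\<^esub> e"
    let ?n' = "(a \<otimes>\<^bsub>D\<^esub> e) \<otimes>\<^bsub>D\<^esub> (d \<otimes>\<^bsub>D\<^esub> f) \<oplus>\<^bsub>D\<^esub> (c \<otimes>\<^bsub>D\<^esub> e) \<otimes>\<^bsub>D\<^esub> (b \<otimes>\<^bsub>D\<^esub> f)"
    let ?d = "(b \<otimes>\<^bsub>D\<^esub> d) \<otimes>\<^bsub>D\<^esub> f" and ?d' = "(b \<otimes>\<^bsub>D\<^esub> f) \<otimes>\<^bsub>D\<^esub> (d \<otimes>\<^bsub>D\<^esub> f)"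
    have car': "a \<in> carrier D" "b \<in> carrier D" "c \<in> carrier D" "d \<in> carrier D" "e \<in> carrier D" "f \<in> carrier D"
      using xyz by auto
    have "?n \<otimes>\<^bsub>D\<^esub> ?d' = ?n' \<otimes>\<^bsub>D\<^esub> ?d"
      using car' by (simp add: m_ac l_distr r_distr)
    moreover have "(?n, ?d) \<in> fraction_pairs D" "(?n', ?d') \<in> fraction_pairs D"
      using xyz by (simp_all add: fraction_pairs_def nz)
    ultimately have "fraction D ?n ?d = fraction D ?n' ?d'"
      by (simp only: feq)
    then show "(x \<oplus>\<^bsub>?Q\<^esub> y) \<otimes>\<^bsub>?Q\<^esub> z = x \<otimes>\<^bsub>?Q\<^esub> z \<oplus>\<^bsub>?Q\<^esub> y \<otimes>\<^bsub>?Q\<^esub> z"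
      using xyz by (simp add: ops nz)
  qed
  then show ?thesis
  proof (rule cring.cring_fieldI2)
    show "\<zero>\<^bsub>?Q\<^esub> \<noteq> \<one>\<^bsub>?Q\<^esub>" by (simp add: zero one feq fraction_pairs_def)
    fix x assume "x \<in> carrier ?Q" "x \<noteq> \<zero>\<^bsub>?Q\<^esub>"
    then obtain a b where ab: "x = fraction D a b" "a \<in> carrier D" "b \<in> carrier D" "b \<noteq> \<zero>\<^bsub>D\<^esub>"
      using E by meson
    have "a \<noteq> \<zero>\<^bsub>D\<^esub>"
      using ab \<open>x \<noteq> \<zero>\<^bsub>?Q\<^esub>\<close> feq[of a b "\<zero>\<^bsub>D\<^esub>" "\<one>\<^bsub>D\<^esub>"] by (auto simp: zero fraction_pairs_def)
    note x = ab this
    show "\<exists>y\<in>carrier ?Q. x \<otimes>\<^bsub>?Q\<^esub> y = \<one>\<^bsub>?Q\<^esub>"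
    proof (rule bexI)
      show "x \<otimes>\<^bsub>?Q\<^esub> fraction D b a = \<one>\<^bsub>?Q\<^esub>"
        using x by (simp add: one ops nz feq fraction_pairs_def m_comm)
    qed (use x in \<open>auto intro: frc\<close>)
  qed
qed

lemma formal_tensor_ring_simps [simp]:
  "x \<in> carrier (formal_tensor_ring A B) \<longleftrightarrow> Poly_Mapping.keys x \<subseteq> carrier A \<times> carrier B"
  "\<zero>\<^bsub>formal_tensor_ring A B\<^esub> = 0"
  "\<one>\<^bsub>formal_tensor_ring A B\<^esub> = frag_of (\<one>\<^bsub>A\<^esub>, \<one>\<^bsub>B\<^esub>)"
  "x \<oplus>\<^bsub>formal_tensor_ring A B\<^esub> y = x + y"
  "frag_of (a, b) \<otimes>\<^bsub>formal_tensor_ring A B\<^esub> frag_of (a', b') = frag_of (a \<otimes>\<^bsub>A\<^esub> a', b \<otimes>\<^bsub>B\<^esub> b')"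
  by (simp_all add: formal_tensor_ring_def free_Abelian_group_def)

lemma formal_tensor_mult_diff:
  "(x - y) \<otimes>\<^bsub>formal_tensor_ring A B\<^esub> z =
     x \<otimes>\<^bsub>formal_tensor_ring A B\<^esub> z - y \<otimes>\<^bsub>formal_tensor_ring A B\<^esub> z"
  "x \<otimes>\<^bsub>formal_tensor_ring A B\<^esub> (y - z) =
     x \<otimes>\<^bsub>formal_tensor_ring A B\<^esub> y - x \<otimes>\<^bsub>formal_tensor_ring A B\<^esub> z"
  "0 \<otimes>\<^bsub>formal_tensor_ring A B\<^esub> z = 0"
  "x \<otimes>\<^bsub>formal_tensor_ring A B\<^esub> 0 = 0"
proof -
  show "(x - y) \<otimes>\<^bsub>formal_tensor_ring A B\<^esub> z =
     x \<otimes>\<^bsub>formal_tensor_ring A B\<^esub> z - y \<otimes>\<^bsub>formal_tensor_ring A B\<^esub> z"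
    by (simp add: formal_tensor_ring_def frag_extend_diff)
  show "0 \<otimes>\<^bsub>formal_tensor_ring A B\<^esub> z = 0"
    by (simp add: formal_tensor_ring_def)
  show "x \<otimes>\<^bsub>formal_tensor_ring A B\<^esub> 0 = 0"
    by (auto simp add: formal_tensor_ring_def intro: frag_extend_eq_0)
  show "x \<otimes>\<^bsub>formal_tensor_ring A B\<^esub> (y - z) =
     x \<otimes>\<^bsub>formal_tensor_ring A B\<^esub> y - x \<otimes>\<^bsub>formal_tensor_ring A B\<^esub> z"
    using subset_UNIV
    by (induction x rule: frag_induction)
       (auto simp: formal_tensor_ring_def frag_extend_diff)
qed

lemma formal_tensor_mult_closed:
  assumes "ring A" "ring B" "x \<in> carrier (formal_tensor_ring A B)" "y \<in> carrier (formal_tensor_ring A B)"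
  shows "x \<otimes>\<^bsub>formal_tensor_ring A B\<^esub> y \<in> carrier (formal_tensor_ring A B)"
proof -
  interpret A: ring A by fact
  interpret B: ring B by fact
  let ?K = "\<lambda>z :: _ \<Rightarrow>\<^sub>0 int. Poly_Mapping.keys z \<subseteq> carrier A \<times> carrier B"
  have diff: "?K (u - v)" if "?K u" "?K v" for u v
    using keys_diff[of u v] that by blast
  have "Poly_Mapping.keys x \<subseteq> carrier A \<times> carrier B" using assms by simp
  then have "?K (x \<otimes>\<^bsub>formal_tensor_ring A B\<^esub> y)"
  proof (induction x rule: frag_induction)
    case (one u)
    have "Poly_Mapping.keys y \<subseteq> carrier A \<times> carrier B" using assms by simp
    then show ?case
    proof (induction y rule: frag_induction)
      case (one v)
      then show ?case using \<open>u \<in> _\<close> by (cases u; cases v) auto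
    qed (simp_all add: formal_tensor_mult_diff diff)
  qed (simp_all add: formal_tensor_mult_diff diff)
  then show ?thesis by simp
qed

lemma ring_formal_tensor_ring:
  assumes "ring A" "ring B"
  shows "ring (formal_tensor_ring A B)"
proof -
  interpret A: ring A by fact
  interpret B: ring B by fact
  let ?F = "formal_tensor_ring A B"
  note diff = formal_tensor_mult_diff[where A = A and B = B]
  have plus: "x + y = x - (0 - y)" for x y :: "_ \<Rightarrow>\<^sub>0 int" by simp
  show ?thesis
  proof (rule ringI)
    show "abelian_group ?F"
    proof (rule abelian_groupI)
      fix x assume "x \<in> carrier ?F"
      then show "\<exists>y\<in>carrier ?F. y \<oplus>\<^bsub>?F\<^esub> x = \<zero>\<^bsub>?F\<^esub>"
        by (intro bexI[of _ "- x"]) auto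
    next
      fix x y assume "x \<in> carrier ?F" "y \<in> carrier ?F"
      then show "x \<oplus>\<^bsub>?F\<^esub> y \<in> carrier ?F" using keys_add[of x y] by auto
    qed (auto simp: algebra_simps)
    show "monoid ?F"
    proof (rule monoidI)
      show "x \<otimes>\<^bsub>?F\<^esub> y \<in> carrier ?F" if "x \<in> carrier ?F" "y \<in> carrier ?F" for x y
        using formal_tensor_mult_closed[OF assms] that .
      show "\<one>\<^bsub>?F\<^esub> \<in> carrier ?F" by simp
      fix x assume "x \<in> carrier ?F"
      then have x: "Poly_Mapping.keys x \<subseteq> carrier A \<times> carrier B" by simp
      then show "\<one>\<^bsub>?F\<^esub> \<otimes>\<^bsub>?F\<^esub> x = x"
        by (induction x rule: frag_induction) (auto simp: diff)
      from x show "x \<otimes>\<^bsub>?F\<^esub> \<one>\<^bsub>?F\<^esub> = x"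
        by (induction x rule: frag_induction) (auto simp: diff)
      fix y z assume "y \<in> carrier ?F" "z \<in> carrier ?F"
      then have y: "Poly_Mapping.keys y \<subseteq> carrier A \<times> carrier B"
        and z: "Poly_Mapping.keys z \<subseteq> carrier A \<times> carrier B" by simp_all
      from x show "x \<otimes>\<^bsub>?F\<^esub> y \<otimes>\<^bsub>?F\<^esub> z = x \<otimes>\<^bsub>?F\<^esub> (y \<otimes>\<^bsub>?F\<^esub> z)"
      proof (induction x rule: frag_induction)
        case (one u)
        from y show ?case
        proof (induction y rule: frag_induction)
          case (one v)
          from z show ?case
          proof (induction z rule: frag_induction)
            case (one w)
            then show ?case using \<open>u \<in> _\<close> \<open>v \<in> _\<close>
              by (cases u; cases v; cases w) (auto simp: A.m_assoc B.m_assoc)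
          qed (simp_all add: diff)
        qed (simp_all add: diff)
      qed (simp_all add: diff)
    qed
    fix x y z
    show "(x \<oplus>\<^bsub>?F\<^esub> y) \<otimes>\<^bsub>?F\<^esub> z = x \<otimes>\<^bsub>?F\<^esub> z \<oplus>\<^bsub>?F\<^esub> y \<otimes>\<^bsub>?F\<^esub> z"
      unfolding formal_tensor_ring_simps plus[of x y] diff by simp
    show "z \<otimes>\<^bsub>?F\<^esub> (x \<oplus>\<^bsub>?F\<^esub> y) = z \<otimes>\<^bsub>?F\<^esub> x \<oplus>\<^bsub>?F\<^esub> z \<otimes>\<^bsub>?F\<^esub> y"
      unfolding formal_tensor_ring_simps plus[of x y] diff by simp
  qed
qed

lemma ideal_tensor_kernel:
  assumes A: "ring A" and B: "ring B"
    and f: "\<And>z. z \<in> carrier K \<Longrightarrow> f z \<in> centre A"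
    and g: "\<And>z. z \<in> carrier K \<Longrightarrow> g z \<in> centre B"
  shows "ideal (tensor_kernel K f A g B) (formal_tensor_ring A B)"
proof -
  interpret A: ring A by fact
  interpret B: ring B by fact
  interpret F: ring "formal_tensor_ring A B" using ring_formal_tensor_ring[OF A B] .
  let ?F = "formal_tensor_ring A B"
  let ?G = "free_Abelian_group (carrier A \<times> carrier B)"
  let ?T = "tensor_relators K f A g B"
  let ?N = "tensor_kernel K f A g B"
  interpret G: group ?G by simp
  note diff = formal_tensor_mult_diff[where A = A and B = B]
  have fc: "f z \<in> carrier A" "a \<in> carrier A \<Longrightarrow> f z \<otimes>\<^bsub>A\<^esub> a = a \<otimes>\<^bsub>A\<^esub> f z" if "z \<in> carrier K" for z a
    using f[OF that] by (auto simp: centre_def)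
  have gc: "g z \<in> carrier B" "b \<in> carrier B \<Longrightarrow> b \<otimes>\<^bsub>B\<^esub> g z = g z \<otimes>\<^bsub>B\<^esub> b" if "z \<in> carrier K" for z b
    using g[OF that] by (auto simp: centre_def)
  have T: "?T \<subseteq> carrier ?G"
    unfolding tensor_relators_def
    by (auto simp: fc gc dest!: subsetD[OF keys_diff] split: if_splits)
  have sub: "subgroup ?N ?G"
    unfolding tensor_kernel_def using T by (rule G.generate_is_subgroup)
  have add: "add_monoid ?F = ?G"
    by (simp add: formal_tensor_ring_def free_Abelian_group_def)
  have inv: "inv\<^bsub>?G\<^esub> x = - x" if "x \<in> carrier ?G" for x
    using that by (intro G.inv_equality) (auto simp: free_Abelian_group_def)
  have N0: "0 \<in> ?N" using subgroup.one_closed[OF sub] by simp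
  have Nplus: "x + y \<in> ?N" if "x \<in> ?N" "y \<in> ?N" for x y
    using subgroup.m_closed[OF sub that] by (simp add: free_Abelian_group_def)
  have Nminus: "x - y \<in> ?N" if "x \<in> ?N" "y \<in> ?N" for x y
    using Nplus[OF that(1) subgroup.m_inv_closed[OF sub that(2)]] inv[of y] subgroup.subset[OF sub] that
    by auto
  have TN: "x \<in> ?N" if "x \<in> ?T" for x
    using that unfolding tensor_kernel_def by (rule generate.incl)
  have rel:
    "\<lbrakk>a \<in> carrier A; a' \<in> carrier A; b \<in> carrier B\<rbrakk> \<Longrightarrow>
      frag_of (a \<oplus>\<^bsub>A\<^esub> a', b) - frag_of (a, b) - frag_of (a', b) \<in> ?T"
    "\<lbrakk>a \<in> carrier A; b \<in> carrier B; b' \<in> carrier B\<rbrakk> \<Longrightarrow>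
      frag_of (a, b \<oplus>\<^bsub>B\<^esub> b') - frag_of (a, b) - frag_of (a, b') \<in> ?T"
    "\<lbrakk>a \<in> carrier A; z \<in> carrier K; b \<in> carrier B\<rbrakk> \<Longrightarrow>
      frag_of (a \<otimes>\<^bsub>A\<^esub> f z, b) - frag_of (a, g z \<otimes>\<^bsub>B\<^esub> b) \<in> ?T" for a a' b b' z
    unfolding tensor_relators_def by (rule UnI1, rule UnI1, blast, rule UnI1, rule UnI2, blast, rule UnI2, blast)
  have gen: "frag_of u \<otimes>\<^bsub>?F\<^esub> t \<in> ?T \<and> t \<otimes>\<^bsub>?F\<^esub> frag_of u \<in> ?T"
    if tu: "t \<in> ?T" "u \<in> carrier A \<times> carrier B" for t u
  proof -
    obtain c d where u: "u = (c, d)" "c \<in> carrier A" "d \<in> carrier B" using tu(2) by blast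
    from tu(1) consider
      (1) a a' b where "a \<in> carrier A" "a' \<in> carrier A" "b \<in> carrier B"
        "t = frag_of (a \<oplus>\<^bsub>A\<^esub> a', b) - frag_of (a, b) - frag_of (a', b)"
      | (2) a b b' where "a \<in> carrier A" "b \<in> carrier B" "b' \<in> carrier B"
        "t = frag_of (a, b \<oplus>\<^bsub>B\<^esub> b') - frag_of (a, b) - frag_of (a, b')"
      | (3) a z b where "a \<in> carrier A" "z \<in> carrier K" "b \<in> carrier B"
        "t = frag_of (a \<otimes>\<^bsub>A\<^esub> f z, b) - frag_of (a, g z \<otimes>\<^bsub>B\<^esub> b)"
      unfolding tensor_relators_def
      by (elim UnE CollectE exE conjE) metis+
    then show ?thesis
    proof cases
      case 1
      have "frag_of u \<otimes>\<^bsub>?F\<^esub> t = frag_of ((c \<otimes>\<^bsub>A\<^esub> a) \<oplus>\<^bsub>A\<^esub> (c \<otimes>\<^bsub>A\<^esub> a'), d \<otimes>\<^bsub>B\<^esub> b) -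
          frag_of (c \<otimes>\<^bsub>A\<^esub> a, d \<otimes>\<^bsub>B\<^esub> b) - frag_of (c \<otimes>\<^bsub>A\<^esub> a', d \<otimes>\<^bsub>B\<^esub> b)"
        "t \<otimes>\<^bsub>?F\<^esub> frag_of u = frag_of ((a \<otimes>\<^bsub>A\<^esub> c) \<oplus>\<^bsub>A\<^esub> (a' \<otimes>\<^bsub>A\<^esub> c), b \<otimes>\<^bsub>B\<^esub> d) -
          frag_of (a \<otimes>\<^bsub>A\<^esub> c, b \<otimes>\<^bsub>B\<^esub> d) - frag_of (a' \<otimes>\<^bsub>A\<^esub> c, b \<otimes>\<^bsub>B\<^esub> d)"
        using 1 u by (simp_all add: diff A.l_distr A.r_distr)
      moreover have "c \<otimes>\<^bsub>A\<^esub> a \<in> carrier A" "c \<otimes>\<^bsub>A\<^esub> a' \<in> carrier A" "d \<otimes>\<^bsub>B\<^esub> b \<in> carrier B"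
        "a \<otimes>\<^bsub>A\<^esub> c \<in> carrier A" "a' \<otimes>\<^bsub>A\<^esub> c \<in> carrier A" "b \<otimes>\<^bsub>B\<^esub> d \<in> carrier B"
        using 1 u by auto
      ultimately show ?thesis by (simp only: rel)
    next
      case 2
      have "frag_of u \<otimes>\<^bsub>?F\<^esub> t = frag_of (c \<otimes>\<^bsub>A\<^esub> a, (d \<otimes>\<^bsub>B\<^esub> b) \<oplus>\<^bsub>B\<^esub> (d \<otimes>\<^bsub>B\<^esub> b')) -
          frag_of (c \<otimes>\<^bsub>A\<^esub> a, d \<otimes>\<^bsub>B\<^esub> b) - frag_of (c \<otimes>\<^bsub>A\<^esub> a, d \<otimes>\<^bsub>B\<^esub> b')"
        "t \<otimes>\<^bsub>?F\<^esub> frag_of u = frag_of (a \<otimes>\<^bsub>A\<^esub> c, (b \<otimes>\<^bsub>B\<^esub> d) \<oplus>\<^bsub>B\<^esub> (b' \<otimes>\<^bsub>B\<^esub> d)) -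
          frag_of (a \<otimes>\<^bsub>A\<^esub> c, b \<otimes>\<^bsub>B\<^esub> d) - frag_of (a \<otimes>\<^bsub>A\<^esub> c, b' \<otimes>\<^bsub>B\<^esub> d)"
        using 2 u by (simp_all add: diff B.l_distr B.r_distr)
      moreover have "c \<otimes>\<^bsub>A\<^esub> a \<in> carrier A" "d \<otimes>\<^bsub>B\<^esub> b' \<in> carrier B" "d \<otimes>\<^bsub>B\<^esub> b \<in> carrier B"
        "a \<otimes>\<^bsub>A\<^esub> c \<in> carrier A" "b' \<otimes>\<^bsub>B\<^esub> d \<in> carrier B" "b \<otimes>\<^bsub>B\<^esub> d \<in> carrier B"
        using 2 u by auto
      ultimately show ?thesis by (simp only: rel)
    next
      case 3
      have "d \<otimes>\<^bsub>B\<^esub> (g z \<otimes>\<^bsub>B\<^esub> b) = g z \<otimes>\<^bsub>B\<^esub> (d \<otimes>\<^bsub>B\<^esub> b)"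
        using 3 u gc B.m_assoc by metis
      moreover have "a \<otimes>\<^bsub>A\<^esub> f z \<otimes>\<^bsub>A\<^esub> c = a \<otimes>\<^bsub>A\<^esub> c \<otimes>\<^bsub>A\<^esub> f z"
        using 3 u fc A.m_assoc by metis
      ultimately have "frag_of u \<otimes>\<^bsub>?F\<^esub> t = frag_of ((c \<otimes>\<^bsub>A\<^esub> a) \<otimes>\<^bsub>A\<^esub> f z, d \<otimes>\<^bsub>B\<^esub> b) -
          frag_of (c \<otimes>\<^bsub>A\<^esub> a, g z \<otimes>\<^bsub>B\<^esub> (d \<otimes>\<^bsub>B\<^esub> b))"
        "t \<otimes>\<^bsub>?F\<^esub> frag_of u = frag_of ((a \<otimes>\<^bsub>A\<^esub> c) \<otimes>\<^bsub>A\<^esub> f z, b \<otimes>\<^bsub>B\<^esub> d) -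
          frag_of (a \<otimes>\<^bsub>A\<^esub> c, g z \<otimes>\<^bsub>B\<^esub> (b \<otimes>\<^bsub>B\<^esub> d))"
        using 3 u fc(1)[of z] gc(1)[of z] by (simp_all add: diff A.m_assoc B.m_assoc)
      moreover have "c \<otimes>\<^bsub>A\<^esub> a \<in> carrier A" "d \<otimes>\<^bsub>B\<^esub> b \<in> carrier B"
        "a \<otimes>\<^bsub>A\<^esub> c \<in> carrier A" "b \<otimes>\<^bsub>B\<^esub> d \<in> carrier B"
        using 3 u by auto
      ultimately show ?thesis using 3(2) by (simp only: rel)
    qed
  qed
  have gen': "frag_of u \<otimes>\<^bsub>?F\<^esub> t \<in> ?N \<and> t \<otimes>\<^bsub>?F\<^esub> frag_of u \<in> ?N"
    if t: "t \<in> ?N" and u: "u \<in> carrier A \<times> carrier B" for t u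
    using t unfolding tensor_kernel_def
  proof (induction rule: generate.induct)
    case one
    then show ?case using N0 by (simp add: diff tensor_kernel_def)
  next
    case (incl h)
    then show ?case using gen[OF incl u] by (auto intro: generate.incl)
  next
    case (inv h)
    have "inv\<^bsub>?G\<^esub> h = 0 - h" using T inv \<open>\<And>x. x \<in> carrier ?G \<Longrightarrow> inv\<^bsub>?G\<^esub> x = - x\<close> by auto
    then show ?case
      using gen[OF inv u] Nminus[OF N0 TN] by (simp only: diff) (simp add: tensor_kernel_def)
  next
    case (eng x y)
    have e: "x \<otimes>\<^bsub>?G\<^esub> y = x - (0 - y)" by (simp add: free_Abelian_group_def)
    show ?case
      unfolding e diff using eng.IH Nminus N0 unfolding tensor_kernel_def by blast
  qed
  show ?thesis
  proof (rule idealI)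
    show "subgroup ?N (add_monoid ?F)" using sub add by simp
    fix t x assume t: "t \<in> ?N" and "x \<in> carrier ?F"
    then have x: "Poly_Mapping.keys x \<subseteq> carrier A \<times> carrier B" by simp
    then show "x \<otimes>\<^bsub>?F\<^esub> t \<in> ?N"
      by (induction x rule: frag_induction) (simp_all add: diff gen'[OF t] N0 Nminus)
    from x show "t \<otimes>\<^bsub>?F\<^esub> x \<in> ?N"
      by (induction x rule: frag_induction) (simp_all add: diff gen'[OF t] N0 Nminus)
  qed (rule F.ring_axioms)
qed

lemma ring_tensor_ring:
  assumes "ring A" "ring B"
    and "\<And>z. z \<in> carrier K \<Longrightarrow> f z \<in> centre A" "\<And>z. z \<in> carrier K \<Longrightarrow> g z \<in> centre B"
  shows "ring (tensor_ring K f A g B)"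
  unfolding tensor_ring_def by (intro ideal.quotient_is_ring ideal_tensor_kernel assms)

lemma ideal_extended_ideal:
  assumes "ring R" and p: "ideal p (centre_ring R)"
  shows "ideal (extended_ideal R p) R"
proof -
  interpret ring R by fact
  interpret p: ideal p "centre_ring R" by fact
  have pc: "x \<in> carrier R" "y \<in> carrier R \<Longrightarrow> x \<otimes>\<^bsub>R\<^esub> y = y \<otimes>\<^bsub>R\<^esub> x" if "x \<in> p" for x y
    using p.a_subset that by (auto simp: centre_ring_def centre_def)
  have p0: "\<zero>\<^bsub>R\<^esub> \<in> p" using additive_subgroup.zero_closed[OF p.is_additive_subgroup] by (simp add: centre_ring_def)
  have closed: "extended_ideal R p \<subseteq> carrier R"
  proof
    show "x \<in> carrier R" if "x \<in> extended_ideal R p" for x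
      using that unfolding extended_ideal_def
      by (induction rule: ideal_prod.induct) (auto simp: pc)
  qed
  have mult: "y \<otimes>\<^bsub>R\<^esub> x \<in> extended_ideal R p \<and> x \<otimes>\<^bsub>R\<^esub> y \<in> extended_ideal R p"
    if "x \<in> extended_ideal R p" "y \<in> carrier R" for x y
    using that(1) unfolding extended_ideal_def
  proof (induction rule: ideal_prod.induct)
    case (prod i j)
    have "y \<otimes>\<^bsub>R\<^esub> (i \<otimes>\<^bsub>R\<^esub> j) = (y \<otimes>\<^bsub>R\<^esub> i) \<otimes>\<^bsub>R\<^esub> j" "i \<otimes>\<^bsub>R\<^esub> j \<otimes>\<^bsub>R\<^esub> y = (i \<otimes>\<^bsub>R\<^esub> y) \<otimes>\<^bsub>R\<^esub> j"
      using prod that(2) pc[OF prod(2)] by (simp_all add: m_assoc)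
    then show ?case
      using prod that(2) by (auto intro!: ideal_prod.prod)
  next
    case (sum s t)
    have "s \<in> carrier R" "t \<in> carrier R"
      using sum closed by (auto simp: extended_ideal_def)
    then show ?case
      using sum that(2) by (auto simp: l_distr r_distr intro!: ideal_prod.sum)
  qed
  show ?thesis
  proof (rule idealI)
    show "subgroup (extended_ideal R p) (add_monoid R)"
    proof (rule add.subgroupI)
      show "extended_ideal R p \<noteq> {}"
        using ideal_prod.prod[of "\<zero>\<^bsub>R\<^esub>" "carrier R" "\<zero>\<^bsub>R\<^esub>" p R] p0 by (auto simp: extended_ideal_def)
      show "\<ominus>\<^bsub>R\<^esub> x \<in> extended_ideal R p" if "x \<in> extended_ideal R p" for x
        using mult[OF that, of "\<ominus>\<^bsub>R\<^esub> \<one>\<^bsub>R\<^esub>"] closed that by (auto simp: l_minus)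
      show "x \<oplus>\<^bsub>R\<^esub> y \<in> extended_ideal R p" if "x \<in> extended_ideal R p" "y \<in> extended_ideal R p" for x y
        using that by (auto simp: extended_ideal_def intro: ideal_prod.sum)
    qed (rule closed)
  qed (use mult assms in auto)
qed

lemma ring_fibre_ring:
  assumes "ring R" and p: "primeideal p (centre_ring R)"
  shows "ring (fibre_ring R p)"
proof -
  interpret ring R by fact
  interpret Z: cring "centre_ring R" by (rule cring_centre_ring) fact
  interpret p: primeideal p "centre_ring R" by fact
  interpret I: ideal "extended_ideal R p" R
    by (rule ideal_extended_ideal[OF assms(1) p.is_ideal])
  interpret D: "domain" "residue_domain R p"
    unfolding residue_domain_def by (rule p.quotient_is_domain)
  interpret k: field "residue_field R p"
    unfolding residue_field_def by (rule field_field_of_fractions) (rule D.domain_axioms)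
  show ?thesis
    unfolding fibre_ring_def
  proof (rule ring_tensor_ring)
    show "ring (residue_field R p)" by (rule k.ring_axioms)
    show "ring (R Quot extended_ideal R p)" by (rule I.quotient_is_ring)
    fix z assume z: "z \<in> carrier (centre_ring R)"
    have "p +>\<^bsub>centre_ring R\<^esub> z \<in> carrier (residue_domain R p)"
      using Z.a_rcosetsI[OF p.a_subset z] by (simp add: residue_domain_def FactRing_def)
    then have "to_residue_field R p z \<in> carrier (residue_field R p)"
      unfolding to_residue_field_def residue_field_def carrier_field_of_fractions
      using D.one_closed D.one_not_zero by blast
    then show "to_residue_field R p z \<in> centre (residue_field R p)"
      by (simp add: centre_def k.m_comm)
    have zR: "z \<in> carrier R" "\<And>x. x \<in> carrier R \<Longrightarrow> z \<otimes>\<^bsub>R\<^esub> x = x \<otimes>\<^bsub>R\<^esub> z"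
      using z by (auto simp: centre_ring_def centre_def)
    then show "to_quotient R p z \<in> centre (R Quot extended_ideal R p)"
      by (auto simp: centre_def to_quotient_def FactRing_def A_RCOSETS_def' I.rcoset_mult_add)
  qed
qed

end

theory Submission
  imports Defs
begin

text \<open>Write \<open>Z\<close> for the centre of \<open>R\<close>. For \<open>p \<in> Spec Z\<close>, the ring \<open>k(p) \<otimes> R/Rp\<close> is the localization of
  \<open>R/Rp\<close> at \<open>Z/p - {0}\<close>, and freeness of \<open>R\<close> makes \<open>R/Rp\<close> embed in it: a coordinate functional
  \<open>R \<rightarrow> Z\<close> induces a functional on the tensor product. If the localization is simple, then \<open>Rp\<close> is
  the only prime ideal of \<open>R\<close> over \<open>p\<close>.

  Let \<open>M\<close> be a simple module with annihilator \<open>Rp\<close>. The annihilators of finite subsets of \<open>M\<close> are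
  contracted from the artinian localization, so a finite subset already has annihilator \<open>Rp\<close>, and a
  minimal such subset with \<open>n\<close> elements gives \<open>R/Rp \<cong> M\<^sup>n\<close>. A central \<open>c \<notin> p\<close> acts bijectively on \<open>M\<close>,
  hence is invertible in \<open>R/Rp\<close>; by freeness its inverse can be taken in \<open>Z/p\<close>. Thus \<open>p\<close> is maximal,
  \<open>k(p) \<otimes> R/Rp \<cong> R/Rp\<close>, and everything else is the theory of simple artinian rings. In particular
  \<open>R/Rp \<cong> M\<^sup>n\<close> yields matrix units over the corner at one basis vector.\<close>

section \<open>Simple left modules\<close>

text \<open>The artinian hypothesis concerns a ring that need not be a quotient of \<open>R\<close>:
  before \<open>p\<close> is known to be maximal, \<open>k(p)\<close> may be larger than
  \<open>Z/p\<close>, and no chain condition is available in \<open>R/Rp\<close> itself. Yet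
  maximality of \<open>p\<close> is to be deduced from a finiteness property of a simple module over
  \<open>R/Rp\<close>. The way out is that a central element outside \<open>p\<close> acts
  injectively on a simple module whose annihilator lies over \<open>p\<close>, so nothing is lost
  when annihilators of finite sets are compared after localization. Freeness acts through a basis
  element \<open>b\<close> and the coordinate at \<open>b\<close>, which is linear over the centre
  and takes the value 1 at \<open>b\<close>. It turns congruences modulo \<open>Rp\<close> into
  congruences modulo \<open>p\<close>. The fibre hypothesis covers contractions of prime ideals.
  That every maximal ideal \<open>m\<close> of the centre is one is a separate point:
  \<open>Rm\<close> is proper because it contracts to \<open>m\<close>, so a maximal ideal of
  \<open>R\<close> lies above it. Primitive ideals and isomorphism classes are formed from modules
  carried by sets of subsets of \<open>R\<close>, whereas \<open>U(m)\<close> has a carrier of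
  another type; hence the passage through isomorphic copies.\<close>

context left_module
begin

lemma smult_l_null [simp]: "x \<in> carrier M \<Longrightarrow> \<zero> \<odot>\<^bsub>M\<^esub> x = \<zero>\<^bsub>M\<^esub>"
  by (metis M.add.l_cancel_one' R.l_zero R.zero_closed smult_closed smult_l_distr)

lemma smult_r_null [simp]: "a \<in> carrier R \<Longrightarrow> a \<odot>\<^bsub>M\<^esub> \<zero>\<^bsub>M\<^esub> = \<zero>\<^bsub>M\<^esub>"
  by (metis M.add.l_cancel_one' M.l_zero M.zero_closed smult_closed smult_r_distr)

lemma smult_l_minus: "a \<in> carrier R \<Longrightarrow> x \<in> carrier M \<Longrightarrow> (\<ominus> a) \<odot>\<^bsub>M\<^esub> x = \<ominus>\<^bsub>M\<^esub> (a \<odot>\<^bsub>M\<^esub> x)"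
  by (metis M.minus_equality R.a_inv_closed R.l_neg smult_closed smult_l_distr smult_l_null)

lemma smult_l_diff_eq_zero:
  assumes "a \<in> carrier R" "b \<in> carrier R" "x \<in> carrier M"
  shows "(a \<ominus> b) \<odot>\<^bsub>M\<^esub> x = \<zero>\<^bsub>M\<^esub> \<longleftrightarrow> a \<odot>\<^bsub>M\<^esub> x = b \<odot>\<^bsub>M\<^esub> x"
  using assms by (simp add: R.minus_eq smult_l_distr smult_l_minus)
    (metis M.minus_equality M.minus_minus M.r_neg M.a_inv_closed smult_closed)

lemma finsum_smult_left:
  assumes "finite I" "x \<in> carrier M" "g \<in> I \<rightarrow> carrier R"
  shows "(\<Oplus>i\<in>I. g i) \<odot>\<^bsub>M\<^esub> x = (\<Oplus>\<^bsub>M\<^esub>i\<in>I. g i \<odot>\<^bsub>M\<^esub> x)"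
  using assms(1,3)
proof (induction I rule: finite_induct)
  case (insert i I)
  have "(\<lambda>i. g i \<odot>\<^bsub>M\<^esub> x) \<in> I \<rightarrow> carrier M" "g i \<odot>\<^bsub>M\<^esub> x \<in> carrier M" using insert assms(2) by auto
  with insert assms(2) show ?case
    by (simp add: Pi_iff smult_l_distr)
qed (simp add: assms(2))

lemma smult_finsum_right:
  assumes "finite I" "a \<in> carrier R" "g \<in> I \<rightarrow> carrier M"
  shows "a \<odot>\<^bsub>M\<^esub> (\<Oplus>\<^bsub>M\<^esub>i\<in>I. g i) = (\<Oplus>\<^bsub>M\<^esub>i\<in>I. a \<odot>\<^bsub>M\<^esub> g i)"
  using assms(1,3)
proof (induction I rule: finite_induct)
  case (insert i I)
  have "(\<lambda>i. a \<odot>\<^bsub>M\<^esub> g i) \<in> I \<rightarrow> carrier M" "a \<odot>\<^bsub>M\<^esub> g i \<in> carrier M" using insert assms(2) by auto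
  with insert assms(2) show ?case
    by (simp add: Pi_iff smult_r_distr)
qed (simp add: assms(2))

text \<open>Negatives are the multiples by \<open>\<ominus> \<one>\<close>, so closure under sums
  and scalars is enough.\<close>

lemma submoduleI:
  assumes "N \<subseteq> carrier M" "N \<noteq> {}"
    and "\<And>x y. x \<in> N \<Longrightarrow> y \<in> N \<Longrightarrow> x \<oplus>\<^bsub>M\<^esub> y \<in> N"
    and "\<And>a x. a \<in> carrier R \<Longrightarrow> x \<in> N \<Longrightarrow> a \<odot>\<^bsub>M\<^esub> x \<in> N"
  shows "submodule N R M"
proof (intro submodule.intro submodule_axioms.intro M.add.subgroupI)
  show "\<ominus>\<^bsub>M\<^esub> x \<in> N" if "x \<in> N" for x
  proof -
    have "\<ominus>\<^bsub>M\<^esub> x = (\<ominus> \<one>) \<odot>\<^bsub>M\<^esub> x"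
      using that assms(1) by (auto simp: smult_l_minus)
    then show ?thesis using assms(4)[OF _ that, of "\<ominus> \<one>"] by simp
  qed
qed (use assms in auto)

lemma submoduleD:
  assumes "submodule N R M"
  shows "N \<subseteq> carrier M" "\<zero>\<^bsub>M\<^esub> \<in> N"
    "\<And>x y. x \<in> N \<Longrightarrow> y \<in> N \<Longrightarrow> x \<oplus>\<^bsub>M\<^esub> y \<in> N"
    "\<And>a x. a \<in> carrier R \<Longrightarrow> x \<in> N \<Longrightarrow> a \<odot>\<^bsub>M\<^esub> x \<in> N"
  using submodule.smult_closed[OF assms] subgroup.subset[OF submodule.axioms(1)[OF assms]]
    subgroup.one_closed[OF submodule.axioms(1)[OF assms]]
    subgroup.m_closed[OF submodule.axioms(1)[OF assms]] by auto

end

section \<open>Left ideals and two-sided ideals of a ring\<close>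

lemma regular_module_simps [simp]:
  fixes R :: "('a, 'k) ring_scheme"
  shows "carrier (regular_module R) = carrier R" "a \<odot>\<^bsub>regular_module R\<^esub> b = a \<otimes>\<^bsub>R\<^esub> b"
  "a \<oplus>\<^bsub>regular_module R\<^esub> b = a \<oplus>\<^bsub>R\<^esub> b" "\<zero>\<^bsub>regular_module R\<^esub> = \<zero>\<^bsub>R\<^esub>"
  "carrier (add_monoid (regular_module R)) = carrier R"
  by (simp_all add: regular_module_def)

lemma left_module_regular:
  assumes "ring R" shows "left_module R (regular_module R)"
proof -
  interpret ring R by fact
  have "abelian_group (regular_module R)"
  proof (rule abelian_groupI)
    show "\<exists>y\<in>carrier (regular_module R). y \<oplus>\<^bsub>regular_module R\<^esub> x = \<zero>\<^bsub>regular_module R\<^esub>"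
      if "x \<in> carrier (regular_module R)" for x
      using that by (intro bexI[of _ "\<ominus>\<^bsub>R\<^esub> x"]) (auto simp: l_neg)
  qed (auto simp: a_ac)
  then show ?thesis
    by (intro left_module.intro left_module_axioms.intro)
      (auto simp: l_distr r_distr m_assoc ring_axioms)
qed

text \<open>Left ideals are submodules of the regular module, which is the form in which
  \<open>artinian_ring\<close> speaks of them.\<close>

abbreviation left_ideal :: "'a set \<Rightarrow> ('a, 'k) ring_scheme \<Rightarrow> bool" where
  "left_ideal I R \<equiv> submodule I R (regular_module R)"

lemma (in ring) left_idealI:
  assumes "I \<subseteq> carrier R" "I \<noteq> {}"
    and "\<And>x y. x \<in> I \<Longrightarrow> y \<in> I \<Longrightarrow> x \<oplus> y \<in> I"
    and "\<And>a x. a \<in> carrier R \<Longrightarrow> x \<in> I \<Longrightarrow> a \<otimes> x \<in> I"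
  shows "left_ideal I R"
  using left_module.submoduleI[OF left_module_regular[OF ring_axioms], of I] assms by simp

lemma (in ring) left_idealD:
  assumes "left_ideal I R"
  shows "I \<subseteq> carrier R" "\<zero> \<in> I" "\<And>x y. x \<in> I \<Longrightarrow> y \<in> I \<Longrightarrow> x \<oplus> y \<in> I"
    "\<And>a x. a \<in> carrier R \<Longrightarrow> x \<in> I \<Longrightarrow> a \<otimes> x \<in> I"
  using left_module.submoduleD[OF left_module_regular[OF ring_axioms] assms] by auto

lemma (in ring) ideal_imp_left_ideal: "ideal I R \<Longrightarrow> left_ideal I R"
  by (rule left_idealI)
    (auto simp: ideal.Icarr ideal.I_l_closed additive_subgroup.a_closed ideal.axioms
      dest: additive_subgroup.zero_closed[OF ideal.axioms(1)])

lemma (in ring) idealI':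
  assumes "I \<subseteq> carrier R" "I \<noteq> {}"
    and "\<And>x y. x \<in> I \<Longrightarrow> y \<in> I \<Longrightarrow> x \<oplus> y \<in> I"
    and "\<And>a x. a \<in> carrier R \<Longrightarrow> x \<in> I \<Longrightarrow> a \<otimes> x \<in> I"
    and "\<And>a x. a \<in> carrier R \<Longrightarrow> x \<in> I \<Longrightarrow> x \<otimes> a \<in> I"
  shows "ideal I R"
proof (rule idealI[OF ring_axioms])
  show "subgroup I (add_monoid R)"
  proof (rule add.subgroupI)
    show "\<ominus> x \<in> I" if "x \<in> I" for x
      using assms(4)[OF _ that, of "\<ominus> \<one>"] that assms(1) by (auto simp: l_minus)
  qed (use assms in auto)
qed (use assms in auto)

text \<open>Annihilation of chosen vectors gives a left ideal, in general not a two-sided one, in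
  contrast to \<open>annihilator\<close>. These left ideals are the ones compared by the chain
  condition.\<close>

definition annihilator_of :: "('a, 'k) ring_scheme \<Rightarrow> ('a, 'm, 'l) module_scheme \<Rightarrow> 'm set \<Rightarrow> 'a set" where
  "annihilator_of R M F = {a \<in> carrier R. \<forall>x\<in>F. a \<odot>\<^bsub>M\<^esub> x = \<zero>\<^bsub>M\<^esub>}"

context left_module
begin

lemma submodule_smult_image:
  assumes "left_ideal I R" "x \<in> carrier M"
  shows "submodule ((\<lambda>r. r \<odot>\<^bsub>M\<^esub> x) ` I) R M"
proof (rule submoduleI)
  note D = R.left_idealD[OF assms(1)]
  show "(\<lambda>r. r \<odot>\<^bsub>M\<^esub> x) ` I \<noteq> {}" using D(2) by blast
  show "(\<lambda>r. r \<odot>\<^bsub>M\<^esub> x) ` I \<subseteq> carrier M" using D(1) assms(2) by auto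
  show "y \<oplus>\<^bsub>M\<^esub> z \<in> (\<lambda>r. r \<odot>\<^bsub>M\<^esub> x) ` I"
    if "y \<in> (\<lambda>r. r \<odot>\<^bsub>M\<^esub> x) ` I" "z \<in> (\<lambda>r. r \<odot>\<^bsub>M\<^esub> x) ` I" for y z
  proof -
    from that obtain r s where "r \<in> I" "s \<in> I" "y = r \<odot>\<^bsub>M\<^esub> x" "z = s \<odot>\<^bsub>M\<^esub> x" by auto
    then show ?thesis using D assms(2) by (intro image_eqI[of _ _ "r \<oplus> s"]) (auto simp: smult_l_distr subset_iff)
  qed
  show "a \<odot>\<^bsub>M\<^esub> y \<in> (\<lambda>r. r \<odot>\<^bsub>M\<^esub> x) ` I"
    if "a \<in> carrier R" "y \<in> (\<lambda>r. r \<odot>\<^bsub>M\<^esub> x) ` I" for a y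
  proof -
    from that obtain r where "r \<in> I" "y = r \<odot>\<^bsub>M\<^esub> x" by auto
    then show ?thesis using that(1) D assms(2)
      by (intro image_eqI[of _ _ "a \<otimes> r"]) (auto simp: smult_assoc1 subset_iff)
  qed
qed

lemma left_ideal_annihilator_of:
  assumes "F \<subseteq> carrier M"
  shows "left_ideal (annihilator_of R M F) R"
proof (rule R.left_idealI)
  show "annihilator_of R M F \<noteq> {}" using assms by (auto simp: annihilator_of_def intro!: exI[of _ "\<zero>"])
qed (use assms in \<open>auto simp: annihilator_of_def smult_l_distr smult_assoc1 subset_iff\<close>)

end

section \<open>Simple modules and their annihilators\<close>

lemma ideal_annihilator:
  assumes "left_module R M" shows "ideal (annihilator R M) R"
proof -
  interpret left_module R M by fact
  show ?thesis
  proof (rule R.idealI')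
    show "annihilator R M \<noteq> {}" by (auto simp: annihilator_def intro!: exI[of _ "\<zero>\<^bsub>R\<^esub>"])
  qed (auto simp: annihilator_def smult_l_distr smult_assoc1)
qed

text \<open>The submodule \<open>I x\<close> is not zero because of \<open>a\<close>, so it is all
  of \<open>M\<close>. The ideal \<open>I\<close> varies with the application: two-sided ideals for
  primeness, minimal left ideals for uniqueness, annihilators of finite sets for
  interpolation.\<close>

lemma simple_left_module_cyclic:
  assumes M: "simple_left_module R M" and I: "left_ideal I R" and x: "x \<in> carrier M"
    and a: "a \<in> I" "a \<odot>\<^bsub>M\<^esub> x \<noteq> \<zero>\<^bsub>M\<^esub>" and y: "y \<in> carrier M"
  obtains r where "r \<in> I" "r \<odot>\<^bsub>M\<^esub> x = y"
proof -
  interpret left_module R M using M by (simp add: simple_left_module_def)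
  have "(\<lambda>r. r \<odot>\<^bsub>M\<^esub> x) ` I = carrier M"
    using M submodule_smult_image[OF I x] a unfolding simple_left_module_def by blast
  with y that show ?thesis by (metis image_iff)
qed

lemma simple_left_module_generated:
  assumes M: "simple_left_module R M" and x: "x \<in> carrier M" "x \<noteq> \<zero>\<^bsub>M\<^esub>" and y: "y \<in> carrier M"
  obtains r where "r \<in> carrier R" "r \<odot>\<^bsub>M\<^esub> x = y"
proof -
  interpret left_module R M using M by (simp add: simple_left_module_def)
  show ?thesis
    using simple_left_module_cyclic[OF M R.ideal_imp_left_ideal[OF R.oneideal] x(1) R.one_closed _ y]
      x that by auto
qed

lemma simple_left_module_obtain_nonzero:
  assumes "simple_left_module R M"
  obtains x where "x \<in> carrier M" "x \<noteq> \<zero>\<^bsub>M\<^esub>"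
proof -
  interpret left_module R M using assms by (simp add: simple_left_module_def)
  show ?thesis using assms M.zero_closed that by (fastforce simp: simple_left_module_def)
qed

text \<open>If \<open>J\<close> does not annihilate \<open>M\<close>, then \<open>J z\<close> is all
  of \<open>M\<close> for some vector \<open>z\<close>, so \<open>I M\<close> equals
  \<open>(I J) z\<close>, which vanishes.\<close>

lemma annihilator_simple_in_Spec:
  assumes M: "simple_left_module R M"
  shows "annihilator R M \<in> Spec R"
proof -
  interpret left_module R M using M by (simp add: simple_left_module_def)
  obtain x where x: "x \<in> carrier M" "x \<noteq> \<zero>\<^bsub>M\<^esub>" using simple_left_module_obtain_nonzero[OF M] .
  have "annihilator R M \<noteq> carrier R"
  proof
    assume "annihilator R M = carrier R"
    then have "\<one>\<^bsub>R\<^esub> \<in> annihilator R M" by simp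
    then show False using x by (auto simp: annihilator_def)
  qed
  moreover have "I \<subseteq> annihilator R M"
    if I: "ideal I R" "ideal J R" "I \<cdot>\<^bsub>R\<^esub> J \<subseteq> annihilator R M" "\<not> J \<subseteq> annihilator R M" for I J
  proof
    fix i assume i: "i \<in> I"
    have ic: "i \<in> carrier R" using ideal.Icarr[OF I(1) i] .
    from I(4) obtain j z where j: "j \<in> J" "z \<in> carrier M" "j \<odot>\<^bsub>M\<^esub> z \<noteq> \<zero>\<^bsub>M\<^esub>"
      using ideal.Icarr[OF I(2)] by (auto simp: annihilator_def)
    have "i \<odot>\<^bsub>M\<^esub> y = \<zero>\<^bsub>M\<^esub>" if y: "y \<in> carrier M" for y
    proof -
      obtain r where r: "r \<in> J" "r \<odot>\<^bsub>M\<^esub> z = y"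
        using simple_left_module_cyclic[OF M R.ideal_imp_left_ideal[OF I(2)] j(2,1,3) y] .
      have "i \<otimes>\<^bsub>R\<^esub> r \<in> annihilator R M" using I(3) i r(1) by (auto intro: ideal_prod.prod)
      then show ?thesis
        using r j(2) ic ideal.Icarr[OF I(2) r(1)] by (auto simp: annihilator_def smult_assoc1[symmetric])
    qed
    then show "i \<in> annihilator R M" using ic by (simp add: annihilator_def)
  qed
  ultimately show ?thesis
    using ideal_annihilator[OF left_module_axioms] unfolding Spec_def by blast
qed

text \<open>Over a minimal set \<open>F\<close> with annihilator \<open>ann M\<close>, the module is a quotient of each left ideal
  \<open>ann (F - {x})\<close> via \<open>r \<mapsto> r x\<close>, so \<open>R \<rightarrow> M\<^sup>F\<close> is onto.\<close>

lemma simple_left_module_interpolation: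
  assumes M: "simple_left_module R M" and G: "finite G" "G \<subseteq> carrier M"
    and annG: "annihilator_of R M G = annihilator R M"
  obtains F where "finite F" "F \<subseteq> carrier M" "annihilator_of R M F = annihilator R M"
    "\<And>y. y \<in> F \<rightarrow> carrier M \<Longrightarrow> \<exists>r\<in>carrier R. \<forall>x\<in>F. r \<odot>\<^bsub>M\<^esub> x = y x"
proof -
  interpret left_module R M using M by (simp add: simple_left_module_def)
  let ?P = "\<lambda>F. finite F \<and> F \<subseteq> carrier M \<and> annihilator_of R M F = annihilator R M"
  have "\<exists>F. ?P F \<and> (\<forall>F'. ?P F' \<longrightarrow> card F \<le> card F')"
    using ex_has_least_nat[of ?P G card] G annG by blast
  then obtain F where F: "?P F" and min: "\<And>F'. ?P F' \<Longrightarrow> card F \<le> card F'" by blast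
  have loc: "\<exists>r\<in>annihilator_of R M (F - {x}). r \<odot>\<^bsub>M\<^esub> x = z" if x: "x \<in> F" and z: "z \<in> carrier M" for x z
  proof -
    have sub: "F - {x} \<subseteq> carrier M" "x \<in> carrier M" using F x by auto
    have "\<not> ?P (F - {x})"
      using min[of "F - {x}"] F x card_Diff1_less[of F x] by linarith
    then have "annihilator_of R M (F - {x}) \<noteq> annihilator R M" using F sub by blast
    moreover have "annihilator R M \<subseteq> annihilator_of R M (F - {x})"
      using sub by (auto simp: annihilator_def annihilator_of_def)
    ultimately obtain a where a: "a \<in> annihilator_of R M (F - {x})" "a \<notin> annihilator_of R M F" using F by auto
    then have "a \<odot>\<^bsub>M\<^esub> x \<noteq> \<zero>\<^bsub>M\<^esub>" by (auto simp: annihilator_of_def)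
    from simple_left_module_cyclic[OF M left_ideal_annihilator_of[OF sub(1)] sub(2) a(1) this z]
    show ?thesis by blast
  qed
  \<comment> \<open>Prescribing the values on \<open>H\<close> and zero on the rest of
    \<open>F\<close> makes the induction work: the next vector is corrected by an element of
    \<open>R\<close> that kills all the others.\<close>
  have "\<exists>r\<in>carrier R. (\<forall>x\<in>F. r \<odot>\<^bsub>M\<^esub> x = (if x \<in> H then y x else \<zero>\<^bsub>M\<^esub>))"
    if y: "y \<in> F \<rightarrow> carrier M" and H: "finite H" "H \<subseteq> F" for y H
    using H
  proof (induction H rule: finite_induct)
    case empty
    show ?case using F by (auto intro!: bexI[of _ "\<zero>\<^bsub>R\<^esub>"] simp: subset_iff)
  next
    case (insert x H)
    then obtain r where r: "r \<in> carrier R" "\<forall>z\<in>F. r \<odot>\<^bsub>M\<^esub> z = (if z \<in> H then y z else \<zero>\<^bsub>M\<^esub>)" by auto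
    obtain s where s: "s \<in> annihilator_of R M (F - {x})" "s \<odot>\<^bsub>M\<^esub> x = y x"
      using loc[of x "y x"] insert y by blast
    have sR: "s \<in> carrier R" using s by (simp add: annihilator_of_def)
    show ?case
    proof (intro bexI[of _ "r \<oplus>\<^bsub>R\<^esub> s"] ballI)
      fix z assume z: "z \<in> F"
      then have "z \<in> carrier M" "y z \<in> carrier M" using F y by auto
      then show "(r \<oplus>\<^bsub>R\<^esub> s) \<odot>\<^bsub>M\<^esub> z = (if z \<in> insert x H then y z else \<zero>\<^bsub>M\<^esub>)"
        using r s sR z insert(2) by (auto simp: smult_l_distr annihilator_of_def)
    qed (use r sR in auto)
  qed
  from this[of _ F] F show ?thesis using that[of F] by auto
qed

section \<open>Change of rings along a surjection\<close>

lemma ring_hom_minus: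
  assumes "ring R" "ring T" "\<phi> \<in> ring_hom R T" "a \<in> carrier R" "b \<in> carrier R"
  shows "\<phi> (a \<ominus>\<^bsub>R\<^esub> b) = \<phi> a \<ominus>\<^bsub>T\<^esub> \<phi> b" "\<phi> (\<ominus>\<^bsub>R\<^esub> b) = \<ominus>\<^bsub>T\<^esub> \<phi> b"
proof -
  interpret ring_hom_ring R T \<phi> by (rule ring_hom_ringI2) fact+
  show "\<phi> (a \<ominus>\<^bsub>R\<^esub> b) = \<phi> a \<ominus>\<^bsub>T\<^esub> \<phi> b" "\<phi> (\<ominus>\<^bsub>R\<^esub> b) = \<ominus>\<^bsub>T\<^esub> \<phi> b"
    using assms(4,5) by (simp_all add: a_minus_def)
qed

text \<open>\<open>M\<close> is \<open>V\<close> with scalars pulled back along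
  \<open>\<phi>\<close>. A relation is used because the passage goes both ways: from
  \<open>V\<close> to \<open>M\<close> by restriction of scalars, and from \<open>M\<close> to
  \<open>V\<close> when the action factors through \<open>\<phi>\<close>. The actions have to agree
  on the carriers only.\<close>

definition scalars_along ::
    "('a, 'k) ring_scheme \<Rightarrow> ('a \<Rightarrow> 'b) \<Rightarrow> ('a, 'm) module \<Rightarrow> ('b, 'm) module \<Rightarrow> bool" where
  "scalars_along R \<phi> M V \<longleftrightarrow> carrier M = carrier V \<and> add M = add V \<and> \<zero>\<^bsub>M\<^esub> = \<zero>\<^bsub>V\<^esub> \<and>
    (\<forall>a\<in>carrier R. \<forall>x\<in>carrier V. a \<odot>\<^bsub>M\<^esub> x = \<phi> a \<odot>\<^bsub>V\<^esub> x)"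

lemma scalars_along_restrict_scalars: "scalars_along R \<phi> (restrict_scalars \<phi> V) V"
  by (simp add: scalars_along_def restrict_scalars_def)

text \<open>Surjectivity makes the \<open>R\<close>-action and the \<open>T\<close>-action on
  related modules consist of the same maps, so submodules, homomorphisms and simplicity agree. The
  instances are \<open>R\<close> onto a quotient and, over a maximal ideal of the centre,
  \<open>R\<close> onto the fibre ring.\<close>

locale surjective_ring_hom =
  fixes R :: "('a, 'k) ring_scheme" and T :: "('b, 'l) ring_scheme" and \<phi> :: "'a \<Rightarrow> 'b"
  assumes ring_R: "ring R" and ring_T: "ring T" and hom: "\<phi> \<in> ring_hom R T"
    and surj: "\<phi> ` carrier R = carrier T"
begin

context
  fixes M :: "('a, 'm) module" and V :: "('b, 'm) module"
  assumes along: "scalars_along R \<phi> M V"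
begin

lemma along_simps:
  "carrier M = carrier V" "add M = add V" "\<zero>\<^bsub>M\<^esub> = \<zero>\<^bsub>V\<^esub>"
  "\<And>a x. a \<in> carrier R \<Longrightarrow> x \<in> carrier V \<Longrightarrow> a \<odot>\<^bsub>M\<^esub> x = \<phi> a \<odot>\<^bsub>V\<^esub> x"
  using along by (auto simp: scalars_along_def)

lemma left_module_along: "left_module R M \<longleftrightarrow> left_module T V"
proof -
  interpret R: ring R by (rule ring_R)
  have ag: "abelian_group M \<longleftrightarrow> abelian_group V"
  proof
    show "abelian_group V" if "abelian_group M"
    proof -
      interpret abelian_group M by fact
      show ?thesis
      proof (rule abelian_groupI)
        show "\<exists>y\<in>carrier V. y \<oplus>\<^bsub>V\<^esub> x = \<zero>\<^bsub>V\<^esub>" if "x \<in> carrier V" for x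
          using that l_neg[of x] a_inv_closed[of x] by (metis along_simps(1-3))
      qed (use a_closed zero_closed a_assoc a_comm l_zero in \<open>auto simp: along_simps\<close>)
    qed
    show "abelian_group M" if "abelian_group V"
    proof -
      interpret abelian_group V by fact
      show ?thesis
      proof (rule abelian_groupI)
        show "\<exists>y\<in>carrier M. y \<oplus>\<^bsub>M\<^esub> x = \<zero>\<^bsub>M\<^esub>" if "x \<in> carrier M" for x
          using that l_neg[of x] a_inv_closed[of x] by (metis along_simps(1-3))
      qed (use a_closed zero_closed a_assoc a_comm l_zero in \<open>auto simp: along_simps\<close>)
    qed
  qed
  show ?thesis
  proof
    assume "left_module R M"
    then interpret M: left_module R M .
    have c [simp]: "x \<oplus>\<^bsub>V\<^esub> y \<in> carrier V" if "x \<in> carrier V" "y \<in> carrier V" for x y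
      using M.M.a_closed that by (simp add: along_simps)
    have s [simp]: "\<phi> a \<odot>\<^bsub>V\<^esub> x \<in> carrier V" if "a \<in> carrier R" "x \<in> carrier V" for a x
      using M.smult_closed that by (simp add: along_simps)
    have e: "\<phi> a \<odot>\<^bsub>V\<^esub> x = a \<odot>\<^bsub>M\<^esub> x" if "a \<in> carrier R" "x \<in> carrier V" for a x
      using that by (simp add: along_simps)
    have E: "\<exists>a\<in>carrier R. t = \<phi> a" if "t \<in> carrier T" for t using that surj by auto
    have "left_module_axioms T V"
    proof
      fix t x assume "t \<in> carrier T" and x: "x \<in> carrier V"
      then obtain a where a: "a \<in> carrier R" "t = \<phi> a" using E by blast
      show "t \<odot>\<^bsub>V\<^esub> x \<in> carrier V" using a x by simp
      show "t \<odot>\<^bsub>V\<^esub> (x \<oplus>\<^bsub>V\<^esub> y) = t \<odot>\<^bsub>V\<^esub> x \<oplus>\<^bsub>V\<^esub> t \<odot>\<^bsub>V\<^esub> y" if y: "y \<in> carrier V" for y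
        using a x y M.smult_r_distr[of a x y] by (simp add: e) (simp add: along_simps)
    next
      fix t t' x assume "t \<in> carrier T" "t' \<in> carrier T" and x: "x \<in> carrier V"
      then obtain a b where a: "a \<in> carrier R" "t = \<phi> a" and b: "b \<in> carrier R" "t' = \<phi> b" using E by blast
      have "t \<oplus>\<^bsub>T\<^esub> t' = \<phi> (a \<oplus>\<^bsub>R\<^esub> b)" "t \<otimes>\<^bsub>T\<^esub> t' = \<phi> (a \<otimes>\<^bsub>R\<^esub> b)"
        using a b by (simp_all add: ring_hom_add[OF hom] ring_hom_mult[OF hom])
      then show "(t \<oplus>\<^bsub>T\<^esub> t') \<odot>\<^bsub>V\<^esub> x = t \<odot>\<^bsub>V\<^esub> x \<oplus>\<^bsub>V\<^esub> t' \<odot>\<^bsub>V\<^esub> x" "t \<otimes>\<^bsub>T\<^esub> t' \<odot>\<^bsub>V\<^esub> x = t \<odot>\<^bsub>V\<^esub> (t' \<odot>\<^bsub>V\<^esub> x)"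
        using M.smult_l_distr[of a b x] M.smult_assoc1[of a b x] a b x
        by (simp_all add: along_simps)
    next
      fix x assume "x \<in> carrier V"
      then show "\<one>\<^bsub>T\<^esub> \<odot>\<^bsub>V\<^esub> x = x"
        using M.smult_one[of x] along_simps(4)[of "\<one>\<^bsub>R\<^esub>" x] ring_hom_one[OF hom]
        by (simp add: along_simps(1))
    qed
    then show "left_module T V"
      using ag M.M.abelian_group_axioms ring_T by (simp add: left_module_def)
  next
    assume "left_module T V"
    then interpret V: left_module T V .
    have "left_module_axioms R M"
      using ring_hom_closed[OF hom] ring_hom_add[OF hom] ring_hom_mult[OF hom] ring_hom_one[OF hom]
      by unfold_locales
        (simp_all add: along_simps V.smult_l_distr V.smult_r_distr V.smult_assoc1)
    then show "left_module R M"
      using ag V.M.abelian_group_axioms ring_R by (simp add: left_module_def)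
  qed
qed

lemma submodule_along:
  assumes "left_module T V"
  shows "submodule N R M \<longleftrightarrow> submodule N T V"
proof -
  interpret V: left_module T V by fact
  interpret M: left_module R M using assms left_module_along by simp
  show ?thesis
  proof
    assume N: "submodule N R M"
    note D = M.submoduleD[OF N, unfolded along_simps]
    show "submodule N T V"
    proof (rule V.submoduleI)
      show "t \<odot>\<^bsub>V\<^esub> x \<in> N" if t: "t \<in> carrier T" and x: "x \<in> N" for t x
      proof -
        obtain a where "a \<in> carrier R" "t = \<phi> a" using t surj by auto
        with D(4)[of a x] x D(1) show ?thesis by (auto simp: along_simps subset_iff)
      qed
    qed (use D in auto)
  next
    assume N: "submodule N T V"
    note D = V.submoduleD[OF N]
    show "submodule N R M"
      by (rule M.submoduleI)
        (use D ring_hom_closed[OF hom] in \<open>auto simp: along_simps subset_iff\<close>)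
  qed
qed

lemma simple_left_module_along: "simple_left_module R M \<longleftrightarrow> simple_left_module T V"
  using left_module_along submodule_along by (auto simp: simple_left_module_def along_simps)

lemma annihilator_along:
  assumes "left_module T V"
  shows "annihilator R M = {a \<in> carrier R. \<phi> a \<in> annihilator T V}"
  using ring_hom_closed[OF hom] by (auto simp: annihilator_def along_simps)

end

lemma left_module_hom_along:
  assumes "scalars_along R \<phi> M V" "scalars_along R \<phi> M' V'"
  shows "left_module_hom R M M' = left_module_hom T V V'"
proof -
  note s = along_simps[OF assms(1)] along_simps[OF assms(2)]
  have "(\<forall>a\<in>carrier R. \<forall>x\<in>carrier V. f (a \<odot>\<^bsub>M\<^esub> x) = a \<odot>\<^bsub>M'\<^esub> f x) \<longleftrightarrow>
      (\<forall>t\<in>carrier T. \<forall>x\<in>carrier V. f (t \<odot>\<^bsub>V\<^esub> x) = t \<odot>\<^bsub>V'\<^esub> f x)"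
    if "f \<in> carrier V \<rightarrow> carrier V'" for f
    using that unfolding surj[symmetric] by (auto simp: s Pi_iff)
  then show ?thesis
    unfolding left_module_hom_def by (auto simp: s)
qed

lemma left_module_iso_along:
  assumes "scalars_along R \<phi> M V" "scalars_along R \<phi> M' V'"
  shows "left_module_iso R M M' \<longleftrightarrow> left_module_iso T V V'"
  using left_module_hom_along[OF assms] along_simps(1)[OF assms(1)] along_simps(1)[OF assms(2)]
  by (simp add: left_module_iso_def)

text \<open>An equality of rings, since carrier, addition and homomorphisms literally coincide. It
  lets endomorphisms over \<open>R\<close> be computed over a quotient of \<open>R\<close>.\<close>

lemma endomorphism_ring_along:
  assumes "scalars_along R \<phi> M V"
  shows "endomorphism_ring R M = endomorphism_ring T V"
  using left_module_hom_along[OF assms assms]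
  by (simp add: endomorphism_ring_def along_simps[OF assms])

text \<open>An element of the kernel acts as zero, so the action of \<open>a\<close> depends on
  \<open>\<phi> a\<close> alone; any choice of preimages, here \<open>inv_into\<close>, defines the
  \<open>T\<close>-action.\<close>

lemma obtain_along:
  fixes M :: "('a, 'm) module"
  assumes M: "left_module R M" and ker: "\<And>a. a \<in> carrier R \<Longrightarrow> \<phi> a = \<zero>\<^bsub>T\<^esub> \<Longrightarrow> a \<in> annihilator R M"
  obtains V :: "('b, 'm) module" where "scalars_along R \<phi> M V"
proof -
  interpret left_module R M by fact
  interpret T: ring T by (rule ring_T)
  define V :: "('b, 'm) module" where "V = \<lparr>carrier = carrier M, monoid.mult = undefined, one = undefined,
    ring.zero = \<zero>\<^bsub>M\<^esub>, add = add M, smult = (\<lambda>t x. inv_into (carrier R) \<phi> t \<odot>\<^bsub>M\<^esub> x)\<rparr>"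
  have "inv_into (carrier R) \<phi> (\<phi> a) \<odot>\<^bsub>M\<^esub> x = a \<odot>\<^bsub>M\<^esub> x"
    if a: "a \<in> carrier R" and x: "x \<in> carrier M" for a x
  proof -
    let ?b = "inv_into (carrier R) \<phi> (\<phi> a)"
    have b: "?b \<in> carrier R" "\<phi> ?b = \<phi> a"
      using a by (auto intro: inv_into_into f_inv_into_f)
    have "\<phi> (?b \<ominus>\<^bsub>R\<^esub> a) = \<zero>\<^bsub>T\<^esub>"
      using a b ring_hom_closed[OF hom a] by (simp add: ring_hom_minus[OF ring_R ring_T hom])
    then have "?b \<ominus>\<^bsub>R\<^esub> a \<in> annihilator R M" using ker a b by simp
    then show ?thesis
      using smult_l_diff_eq_zero[OF b(1) a x] x by (simp add: annihilator_def)
  qed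
  then have "scalars_along R \<phi> M V" by (simp add: scalars_along_def V_def)
  then show ?thesis by (rule that)
qed

end

lemma surjective_ring_hom_quotient:
  assumes "ring R" "ideal I R"
  shows "surjective_ring_hom R (R Quot I) (\<lambda>a. I +>\<^bsub>R\<^esub> a)"
proof -
  interpret ideal I R by fact
  show ?thesis
    by (intro surjective_ring_hom.intro rcos_ring_hom quotient_is_ring assms)
       (auto simp: FactRing_def A_RCOSETS_def')
qed

section \<open>Simple modules over simple artinian rings\<close>

lemma left_module_iso_sym:
  assumes "left_module R M" "left_module_iso R M N"
  shows "left_module_iso R N M"
proof -
  interpret left_module R M by fact
  from assms(2) obtain f where f: "f \<in> left_module_hom R M N" "bij_betw f (carrier M) (carrier N)"
    by (auto simp: left_module_iso_def)
  let ?g = "inv_into (carrier M) f"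
  have g: "bij_betw ?g (carrier N) (carrier M)" using f(2) by (rule bij_betw_inv_into)
  have ex: "\<exists>y\<in>carrier M. f y = x" if "x \<in> carrier N" for x
    using that bij_betw_imp_surj_on[OF f(2)] by (metis imageE)
  have [simp]: "?g (f y) = y" if "y \<in> carrier M" for y
    using that f(2) by (simp add: bij_betw_inv_into_left)
  have fa: "f y \<oplus>\<^bsub>N\<^esub> f z = f (y \<oplus>\<^bsub>M\<^esub> z)" "a \<odot>\<^bsub>N\<^esub> f y = f (a \<odot>\<^bsub>M\<^esub> y)"
    if "y \<in> carrier M" "z \<in> carrier M" "a \<in> carrier R" for y z a
    using that f(1) by (auto simp: left_module_hom_def)
  have "?g \<in> left_module_hom R N M"
    unfolding left_module_hom_def
  proof (intro CollectI conjI ballI)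
    show "?g \<in> carrier N \<rightarrow> carrier M" using g by (auto simp: bij_betw_def)
    fix x assume x: "x \<in> carrier N"
    then obtain x' where x': "x' \<in> carrier M" "f x' = x" using ex by blast
    show "?g (x \<oplus>\<^bsub>N\<^esub> y) = ?g x \<oplus>\<^bsub>M\<^esub> ?g y" if y: "y \<in> carrier N" for y
    proof -
      obtain y' where y': "y' \<in> carrier M" "f y' = y" using ex y by blast
      show ?thesis using x' y' fa[OF x'(1) y'(1) R.zero_closed] by auto
    qed
  next
    fix a x assume a: "a \<in> carrier R" and x: "x \<in> carrier N"
    then obtain x' where x': "x' \<in> carrier M" "f x' = x" using ex by blast
    show "?g (a \<odot>\<^bsub>N\<^esub> x) = a \<odot>\<^bsub>M\<^esub> ?g x"
      using x' fa(2)[OF x'(1) x'(1) a] a by auto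
  qed
  with g show ?thesis by (auto simp: left_module_iso_def)
qed

lemma left_module_iso_trans:
  assumes "left_module_iso R M N" "left_module_iso R N L"
  shows "left_module_iso R M L"
proof -
  from assms obtain f g where "f \<in> left_module_hom R M N" "bij_betw f (carrier M) (carrier N)"
    "g \<in> left_module_hom R N L" "bij_betw g (carrier N) (carrier L)"
    by (auto simp: left_module_iso_def)
  then have "g \<circ> f \<in> left_module_hom R M L" "bij_betw (g \<circ> f) (carrier M) (carrier L)"
    by (auto simp: left_module_hom_def Pi_iff intro: bij_betw_trans)
  then show ?thesis by (auto simp: left_module_iso_def)
qed

lemma annihilator_iso:
  assumes "left_module R M" "left_module R N" "left_module_iso R M N"
  shows "annihilator R M = annihilator R N"
proof -
  interpret M: left_module R M by fact
  interpret N: left_module R N by fact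
  obtain f where f: "f \<in> left_module_hom R M N" "bij_betw f (carrier M) (carrier N)"
    using assms(3) by (auto simp: left_module_iso_def)
  have f0: "f \<zero>\<^bsub>M\<^esub> = \<zero>\<^bsub>N\<^esub>"
  proof -
    have "f (\<zero>\<^bsub>R\<^esub> \<odot>\<^bsub>M\<^esub> \<zero>\<^bsub>M\<^esub>) = \<zero>\<^bsub>R\<^esub> \<odot>\<^bsub>N\<^esub> f \<zero>\<^bsub>M\<^esub>" "f \<zero>\<^bsub>M\<^esub> \<in> carrier N"
      using f(1) M.R.zero_closed M.M.zero_closed unfolding left_module_hom_def by blast+
    then show ?thesis by simp
  qed
  have "a \<odot>\<^bsub>M\<^esub> x = \<zero>\<^bsub>M\<^esub> \<longleftrightarrow> a \<odot>\<^bsub>N\<^esub> f x = \<zero>\<^bsub>N\<^esub>" if "a \<in> carrier R" "x \<in> carrier M" for a x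
  proof -
    have "a \<odot>\<^bsub>N\<^esub> f x = f (a \<odot>\<^bsub>M\<^esub> x)" using f(1) that by (auto simp: left_module_hom_def)
    moreover have "f (a \<odot>\<^bsub>M\<^esub> x) = f \<zero>\<^bsub>M\<^esub> \<longleftrightarrow> a \<odot>\<^bsub>M\<^esub> x = \<zero>\<^bsub>M\<^esub>"
      using inj_on_eq_iff[OF bij_betw_imp_inj_on[OF f(2)]] that by simp
    ultimately show ?thesis by (simp add: f0)
  qed
  then show ?thesis
    unfolding annihilator_def bij_betw_imp_surj_on[OF f(2), symmetric] by auto
qed

section \<open>Minimal left ideals of artinian rings\<close>

definition left_ideal_module :: "('a, 'k) ring_scheme \<Rightarrow> 'a set \<Rightarrow> ('a, 'a) module" where
  "left_ideal_module R L = (regular_module R)\<lparr>carrier := L\<rparr>"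

lemma left_ideal_module_simps [simp]:
  "carrier (left_ideal_module R L) = L" "a \<odot>\<^bsub>left_ideal_module R L\<^esub> b = a \<otimes>\<^bsub>R\<^esub> b"
  "a \<oplus>\<^bsub>left_ideal_module R L\<^esub> b = a \<oplus>\<^bsub>R\<^esub> b" "\<zero>\<^bsub>left_ideal_module R L\<^esub> = \<zero>\<^bsub>R\<^esub>"
  by (simp_all add: left_ideal_module_def regular_module_def)

lemma left_module_left_ideal:
  assumes "ring R" "left_ideal L R"
  shows "left_module R (left_ideal_module R L)"
proof -
  interpret ring R by fact
  note D = left_idealD[OF assms(2)]
  have c [simp]: "x \<in> L \<Longrightarrow> x \<in> carrier R" for x using D(1) by auto
  have "abelian_group (left_ideal_module R L)"
  proof (rule abelian_groupI)
    show "\<exists>y\<in>carrier (left_ideal_module R L). y \<oplus>\<^bsub>left_ideal_module R L\<^esub> x = \<zero>\<^bsub>left_ideal_module R L\<^esub>"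
      if "x \<in> carrier (left_ideal_module R L)" for x
      using that D(4)[of "\<ominus>\<^bsub>R\<^esub> \<one>\<^bsub>R\<^esub>" x]
      by (intro bexI[of _ "\<ominus>\<^bsub>R\<^esub> x"]) (auto simp: l_neg l_minus)
  qed (use D in \<open>auto simp: a_ac\<close>)
  then show ?thesis
    by (intro left_module.intro left_module_axioms.intro)
      (use D in \<open>auto simp: l_distr r_distr m_assoc ring_axioms\<close>)
qed

text \<open>If every member of the family had a smaller one, iterating the choice \<open>nxt\<close>
  would give a strictly decreasing sequence of left ideals.\<close>

lemma artinian_ring_minimal:
  assumes "artinian_ring T" and "\<And>I. I \<in> \<I> \<Longrightarrow> left_ideal I T" and "J \<in> \<I>"
  obtains I where "I \<in> \<I>" "\<And>J. J \<in> \<I> \<Longrightarrow> J \<subseteq> I \<Longrightarrow> J = I"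
proof -
  have "\<exists>I\<in>\<I>. \<forall>J\<in>\<I>. J \<subseteq> I \<longrightarrow> J = I"
  proof (rule ccontr)
    assume "\<not> ?thesis"
    then have "\<forall>I\<in>\<I>. \<exists>J. J \<in> \<I> \<and> J \<subset> I" by blast
    then obtain nxt where "\<forall>I\<in>\<I>. nxt I \<in> \<I> \<and> nxt I \<subset> I"
      using bchoice[of \<I> "\<lambda>I J. J \<in> \<I> \<and> J \<subset> I"] by blast
    then have nxt: "\<And>I. I \<in> \<I> \<Longrightarrow> nxt I \<in> \<I> \<and> nxt I \<subset> I" by blast
    define c where "c n = (nxt ^^ n) J" for n
    have c: "c n \<in> \<I>" for n by (induction n) (auto simp: c_def assms(3) nxt)
    have s: "c (Suc n) \<subset> c n" for n using nxt[OF c[of n]] by (simp add: c_def)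
    have "\<forall>n. left_ideal (c n) T" "\<forall>n. c (Suc n) \<subseteq> c n" using c assms(2) s by auto
    then have "\<exists>N. \<forall>n\<ge>N. c n = c N"
      using assms(1) unfolding artinian_ring_def by blast
    then obtain N where "\<forall>n\<ge>N. c n = c N" by blast
    then have "c (Suc N) = c N" by (rule allE[of _ "Suc N"]) auto
    with s[of N] show False by blast
  qed
  then show ?thesis using that by blast
qed

text \<open>A minimal nonzero left ideal serves, because the submodules of a left ideal are again
  left ideals of \<open>T\<close>.\<close>

lemma simple_artinian_ring_obtain_simple_left_ideal:
  assumes "simple_artinian_ring T"
  obtains L where "left_ideal L T" "simple_left_module T (left_ideal_module T L)"
proof -
  have art: "artinian_ring T" and T: "ring T" and nz: "carrier T \<noteq> {\<zero>\<^bsub>T\<^esub>}"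
    using assms by (auto simp: simple_artinian_ring_def simple_ring_def)
  interpret ring T by fact
  obtain L where L: "left_ideal L T" "L \<noteq> {\<zero>\<^bsub>T\<^esub>}"
    and min: "\<And>J. left_ideal J T \<Longrightarrow> J \<noteq> {\<zero>\<^bsub>T\<^esub>} \<Longrightarrow> J \<subseteq> L \<Longrightarrow> J = L"
  proof (rule artinian_ring_minimal[OF art, of "{I. left_ideal I T \<and> I \<noteq> {\<zero>\<^bsub>T\<^esub>}}"])
    show "carrier T \<in> {I. left_ideal I T \<and> I \<noteq> {\<zero>\<^bsub>T\<^esub>}}"
      using nz ideal_imp_left_ideal[OF oneideal] by simp
  qed auto
  interpret L: left_module T "left_ideal_module T L" by (rule left_module_left_ideal[OF T L(1)])
  have "N = {\<zero>\<^bsub>T\<^esub>} \<or> N = L" if N: "submodule N T (left_ideal_module T L)" for N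
  proof -
    note D = L.submoduleD[OF N, simplified]
    have "left_ideal N T" by (rule left_idealI) (use D left_idealD(1)[OF L(1)] in auto)
    then show ?thesis using min D by blast
  qed
  then have "simple_left_module T (left_ideal_module T L)"
    using L(2) L.left_module_axioms by (simp add: simple_left_module_def)
  with L(1) show ?thesis by (rule that)
qed

text \<open>Simplicity of \<open>T\<close> makes \<open>M\<close> faithful, so \<open>l x\<close> is
  nonzero for some \<open>l\<close> in \<open>L\<close> and \<open>x\<close> in \<open>M\<close>.
  The map sending \<open>a\<close> to \<open>a x\<close> is onto because \<open>L x\<close> is all
  of \<open>M\<close>, and injective because its kernel is a submodule of \<open>L\<close> without
  \<open>l\<close>.\<close>

lemma simple_left_module_iso_left_ideal:
  assumes T: "simple_ring T" and L: "left_ideal L T" and S: "simple_left_module T (left_ideal_module T L)"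
    and M: "simple_left_module T M"
  shows "left_module_iso T (left_ideal_module T L) M"
proof -
  interpret M: left_module T M using M by (simp add: simple_left_module_def)
  interpret L: left_module T "left_ideal_module T L" using S by (simp add: simple_left_module_def)
  note D = M.R.left_idealD[OF L]
  have "annihilator T M \<noteq> carrier T"
    using annihilator_simple_in_Spec[OF M] by (simp add: Spec_def)
  then have ann: "annihilator T M = {\<zero>\<^bsub>T\<^esub>}"
    using T ideal_annihilator[OF M.left_module_axioms] by (auto simp: simple_ring_def)
  obtain l where l: "l \<in> L" "l \<noteq> \<zero>\<^bsub>T\<^esub>" using simple_left_module_obtain_nonzero[OF S] by auto
  then have "l \<notin> annihilator T M" using ann by simp
  then obtain x where x: "x \<in> carrier M" "l \<odot>\<^bsub>M\<^esub> x \<noteq> \<zero>\<^bsub>M\<^esub>" using l D(1) by (auto simp: annihilator_def)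
  define f where "f a = a \<odot>\<^bsub>M\<^esub> x" for a
  have "f \<in> left_module_hom T (left_ideal_module T L) M"
    using x D(1) by (auto simp: left_module_hom_def f_def M.smult_l_distr M.smult_assoc1 subset_iff)
  moreover have "f ` L = carrier M"
  proof
    show "f ` L \<subseteq> carrier M" using D(1) x(1) by (auto simp: f_def)
    show "carrier M \<subseteq> f ` L"
    proof
      fix y assume y: "y \<in> carrier M"
      obtain r where "r \<in> L" "r \<odot>\<^bsub>M\<^esub> x = y"
        using simple_left_module_cyclic[OF M L x(1) l(1) x(2) y] .
      then show "y \<in> f ` L" by (auto simp: f_def)
    qed
  qed
  moreover have "inj_on f L"
  proof -
    let ?K = "{a \<in> L. f a = \<zero>\<^bsub>M\<^esub>}"
    have "submodule ?K T (left_ideal_module T L)"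
      by (rule L.submoduleI)
        (use D x(1) in \<open>auto simp: f_def M.smult_l_distr M.smult_assoc1 subset_iff\<close>)
    moreover have "l \<notin> ?K" using x by (simp add: f_def)
    ultimately have K: "?K = {\<zero>\<^bsub>T\<^esub>}" using S l(1) by (auto simp: simple_left_module_def)
    show ?thesis
    proof (rule inj_onI)
      fix a b assume ab: "a \<in> L" "b \<in> L" "f a = f b"
      have c: "a \<in> carrier T" "b \<in> carrier T" using ab D(1) by auto
      have "\<ominus>\<^bsub>T\<^esub> b \<in> L" using D(4)[of "\<ominus>\<^bsub>T\<^esub> \<one>\<^bsub>T\<^esub>" b] ab c by (simp add: M.R.l_minus)
      then have "a \<ominus>\<^bsub>T\<^esub> b \<in> L" using ab D(3) by (simp add: M.R.minus_eq)
      moreover have "f (a \<ominus>\<^bsub>T\<^esub> b) = \<zero>\<^bsub>M\<^esub>"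
        using ab M.smult_l_diff_eq_zero[OF c x(1)] by (simp add: f_def)
      ultimately have "a \<ominus>\<^bsub>T\<^esub> b = \<zero>\<^bsub>T\<^esub>" using K by blast
      then show "a = b" using c M.R.r_right_minus_eq by blast
    qed
  qed
  ultimately show ?thesis unfolding left_module_iso_def bij_betw_def by auto
qed

lemma simple_left_module_unique:
  assumes "simple_artinian_ring T" "simple_left_module T M" "simple_left_module T N"
  shows "left_module_iso T M N"
proof -
  obtain L where L: "left_ideal L T" "simple_left_module T (left_ideal_module T L)"
    using simple_artinian_ring_obtain_simple_left_ideal[OF assms(1)] .
  have T: "simple_ring T" using assms(1) by (simp add: simple_artinian_ring_def)
  have "left_module T (left_ideal_module T L)" using L(2) by (simp add: simple_left_module_def)
  then show ?thesis
    using simple_left_module_iso_left_ideal[OF T L] assms(2,3) left_module_iso_sym left_module_iso_trans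
    by metis
qed

text \<open>The minimal left ideal lives on \<open>'b\<close>; its isomorphic copy on
  \<open>'b set\<close> has the type among which \<open>fibre_simple_module\<close> makes its
  choice.\<close>

lemma simple_artinian_ring_obtain_simple_left_module:
  fixes T :: "('b, 'l) ring_scheme"
  assumes "simple_artinian_ring T"
  obtains V :: "('b, 'b set) module" where "simple_left_module T V"
proof -
  obtain L where "simple_left_module T (left_ideal_module T L)"
    using simple_artinian_ring_obtain_simple_left_ideal[OF assms] .
  from simple_left_module_representative[OF this]
  obtain V :: "('b, 'b set) module" where "simple_left_module T V" by (elim exE conjE)
  then show ?thesis by (rule that)
qed

section \<open>Tensor products\<close>

locale tensor_algebra =
  fixes K :: "('c, 'j) ring_scheme" and f :: "'c \<Rightarrow> 'a" and A :: "('a, 'k) ring_scheme"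
    and g :: "'c \<Rightarrow> 'b" and B :: "('b, 'l) ring_scheme"
  assumes ring_A: "ring A" and ring_B: "ring B"
    and central_f: "z \<in> carrier K \<Longrightarrow> f z \<in> centre A"
    and central_g: "z \<in> carrier K \<Longrightarrow> g z \<in> centre B"
begin

abbreviation "F \<equiv> formal_tensor_ring A B"
abbreviation "N \<equiv> tensor_kernel K f A g B"
abbreviation "T \<equiv> tensor_ring K f A g B"
abbreviation "pt \<equiv> pure_tensor K f A g B"

sublocale N: ideal N F
  by (rule ideal_tensor_kernel[OF ring_A ring_B central_f central_g])

sublocale T: ring T
  by (rule ring_tensor_ring[OF ring_A ring_B central_f central_g])

lemma formal_minus:
  assumes "x \<in> carrier F" "y \<in> carrier F"
  shows "x \<ominus>\<^bsub>F\<^esub> y = x - y"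
proof -
  have "- y \<in> carrier F" using assms by simp
  then have "\<ominus>\<^bsub>F\<^esub> y = - y" using assms by (intro N.minus_equality) auto
  then show ?thesis by (simp add: a_minus_def)
qed

lemma coset_eq_iff:
  assumes "x \<in> carrier F" "y \<in> carrier F"
  shows "N +>\<^bsub>F\<^esub> x = N +>\<^bsub>F\<^esub> y \<longleftrightarrow> x - y \<in> N"
  using N.quotient_eq_iff_same_a_r_cos[OF N.is_ideal assms] formal_minus[OF assms] by simp

lemma frag_of_closed: "a \<in> carrier A \<Longrightarrow> b \<in> carrier B \<Longrightarrow> frag_of (a, b) \<in> carrier F"
  by simp

lemma pure_tensor_closed: "a \<in> carrier A \<Longrightarrow> b \<in> carrier B \<Longrightarrow> pt a b \<in> carrier T"
  using frag_of_closed by (auto simp: tensor_ring_def pure_tensor_def FactRing_def A_RCOSETS_def')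

lemma coset_add:
  "x \<in> carrier F \<Longrightarrow> y \<in> carrier F \<Longrightarrow> (N +>\<^bsub>F\<^esub> x) \<oplus>\<^bsub>T\<^esub> (N +>\<^bsub>F\<^esub> y) = N +>\<^bsub>F\<^esub> (x + y)"
  using N.a_rcos_sum[of x y] by (simp add: tensor_ring_def FactRing_def)

lemma plus_closed: "x \<in> carrier F \<Longrightarrow> y \<in> carrier F \<Longrightarrow> x + y \<in> carrier F"
  using N.a_closed[of x y] N.add.m_closed[of x y] by simp

lemma pure_tensor_mult:
  assumes "a \<in> carrier A" "b \<in> carrier B" "a' \<in> carrier A" "b' \<in> carrier B"
  shows "pt a b \<otimes>\<^bsub>T\<^esub> pt a' b' = pt (a \<otimes>\<^bsub>A\<^esub> a') (b \<otimes>\<^bsub>B\<^esub> b')"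
  using N.rcoset_mult_add[OF frag_of_closed[OF assms(1,2)] frag_of_closed[OF assms(3,4)]]
  by (simp add: tensor_ring_def pure_tensor_def FactRing_def)

lemma pure_tensor_one: "pt \<one>\<^bsub>A\<^esub> \<one>\<^bsub>B\<^esub> = \<one>\<^bsub>T\<^esub>"
  by (simp add: tensor_ring_def pure_tensor_def FactRing_def)

lemma relator_in_kernel: "t \<in> tensor_relators K f A g B \<Longrightarrow> t \<in> N"
  unfolding tensor_kernel_def by (rule generate.incl)

lemma pure_tensor_add_right:
  assumes "a \<in> carrier A" "b \<in> carrier B" "b' \<in> carrier B"
  shows "pt a (b \<oplus>\<^bsub>B\<^esub> b') = pt a b \<oplus>\<^bsub>T\<^esub> pt a b'"
proof -
  interpret B: ring B by (rule ring_B)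
  have "frag_of (a, b \<oplus>\<^bsub>B\<^esub> b') - (frag_of (a, b) + frag_of (a, b')) \<in> N"
    unfolding diff_diff_eq[symmetric]
    by (rule relator_in_kernel) (use assms in \<open>auto simp: tensor_relators_def\<close>)
  then show ?thesis
    using assms unfolding pure_tensor_def
    by (simp only: coset_add coset_eq_iff frag_of_closed plus_closed B.a_closed)
qed

lemma pure_tensor_balanced:
  assumes "a \<in> carrier A" "z \<in> carrier K" "b \<in> carrier B"
  shows "pt (a \<otimes>\<^bsub>A\<^esub> f z) b = pt a (g z \<otimes>\<^bsub>B\<^esub> b)"
proof -
  interpret A: ring A by (rule ring_A)
  interpret B: ring B by (rule ring_B)
  have "f z \<in> carrier A" "g z \<in> carrier B"
    using central_f[OF assms(2)] central_g[OF assms(2)] by (auto simp: centre_def)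
  moreover have "frag_of (a \<otimes>\<^bsub>A\<^esub> f z, b) - frag_of (a, g z \<otimes>\<^bsub>B\<^esub> b) \<in> N"
    by (rule relator_in_kernel) (use assms in \<open>auto simp: tensor_relators_def\<close>)
  ultimately show ?thesis
    using assms unfolding pure_tensor_def by (subst coset_eq_iff) auto
qed

text \<open>Elements of \<open>T\<close> are cosets of formal integer combinations of pairs. A rule
  for differences covers sums and negatives together and matches
  \<open>frag_induction\<close>.\<close>

lemma tensor_induct [consumes 1, case_names pure diff]:
  assumes t: "t \<in> carrier T"
    and pure: "\<And>a b. a \<in> carrier A \<Longrightarrow> b \<in> carrier B \<Longrightarrow> P (pt a b)"
    and diff: "\<And>s t. s \<in> carrier T \<Longrightarrow> t \<in> carrier T \<Longrightarrow> P s \<Longrightarrow> P t \<Longrightarrow> P (s \<ominus>\<^bsub>T\<^esub> t)"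
  shows "P t"
proof -
  obtain x where x: "x \<in> carrier F" "t = N +>\<^bsub>F\<^esub> x"
    using t by (auto simp: tensor_ring_def FactRing_def A_RCOSETS_def')
  have in_T: "N +>\<^bsub>F\<^esub> y \<in> carrier T" if "y \<in> carrier F" for y
    using that by (auto simp: tensor_ring_def FactRing_def A_RCOSETS_def')
  have minus: "(N +>\<^bsub>F\<^esub> y) \<ominus>\<^bsub>T\<^esub> (N +>\<^bsub>F\<^esub> z) = N +>\<^bsub>F\<^esub> (y - z)" if "y \<in> carrier F" "z \<in> carrier F" for y z
    using ring_hom_minus(1)[OF N.ring_axioms T.ring_axioms N.rcos_ring_hom[folded tensor_ring_def] that]
      formal_minus[OF that] by simp
  have car: "y - z \<in> carrier F" if "y \<in> carrier F" "z \<in> carrier F" for y z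
    using that formal_minus[OF that] N.minus_closed by metis
  interpret A: ring A by (rule ring_A)
  interpret B: ring B by (rule ring_B)
  have P1: "P (pt \<one>\<^bsub>A\<^esub> \<one>\<^bsub>B\<^esub>)" by (rule pure) auto
  \<comment> \<open>Zero is the difference of the identity, a pure tensor, with itself; the rule has
    no case of its own for it.\<close>
  have P0: "P (N +>\<^bsub>F\<^esub> 0)"
    using diff[OF T.one_closed T.one_closed] P1 pure_tensor_one
      minus[of "frag_of (\<one>\<^bsub>A\<^esub>, \<one>\<^bsub>B\<^esub>)" "frag_of (\<one>\<^bsub>A\<^esub>, \<one>\<^bsub>B\<^esub>)"]
    by (simp add: pure_tensor_def)
  have "Poly_Mapping.keys x \<subseteq> carrier A \<times> carrier B" using x by simp
  then have "P (N +>\<^bsub>F\<^esub> x) \<and> x \<in> carrier F"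
  proof (induction x rule: frag_induction)
    case zero
    then show ?case using P0 by simp
  next
    case (one u)
    then show ?case using pure by (cases u) (auto simp: pure_tensor_def)
  next
    case (diff y z)
    then show ?case using assms(3)[OF in_T in_T, of y z] minus[of y z] car[of y z] by simp
  qed
  then show ?thesis using x by simp
qed

text \<open>The part of the universal property that separates elements: the extension of
  \<open>\<beta>\<close> to the free abelian group kills the relators, hence \<open>N\<close>, and a
  pure tensor that is zero has its pair in \<open>N\<close>. Read contrapositively, it shows pure
  tensors to be nonzero.\<close>

lemma balanced_map_zero:
  fixes G :: "('d, 'e) ring_scheme" and \<beta> :: "'a \<Rightarrow> 'b \<Rightarrow> 'd"
  assumes G: "abelian_group G"
    and closed: "\<And>a b. a \<in> carrier A \<Longrightarrow> b \<in> carrier B \<Longrightarrow> \<beta> a b \<in> carrier G"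
    and left: "\<And>a a' b. a \<in> carrier A \<Longrightarrow> a' \<in> carrier A \<Longrightarrow> b \<in> carrier B \<Longrightarrow>
      \<beta> (a \<oplus>\<^bsub>A\<^esub> a') b = \<beta> a b \<oplus>\<^bsub>G\<^esub> \<beta> a' b"
    and right: "\<And>a b b'. a \<in> carrier A \<Longrightarrow> b \<in> carrier B \<Longrightarrow> b' \<in> carrier B \<Longrightarrow>
      \<beta> a (b \<oplus>\<^bsub>B\<^esub> b') = \<beta> a b \<oplus>\<^bsub>G\<^esub> \<beta> a b'"
    and balanced: "\<And>a z b. a \<in> carrier A \<Longrightarrow> z \<in> carrier K \<Longrightarrow> b \<in> carrier B \<Longrightarrow>
      \<beta> (a \<otimes>\<^bsub>A\<^esub> f z) b = \<beta> a (g z \<otimes>\<^bsub>B\<^esub> b)"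
    and ab: "a \<in> carrier A" "b \<in> carrier B" "pt a b = \<zero>\<^bsub>T\<^esub>"
  shows "\<beta> a b = \<zero>\<^bsub>G\<^esub>"
proof -
  interpret G: abelian_group G by fact
  interpret A: ring A by (rule ring_A)
  interpret B: ring B by (rule ring_B)
  let ?Fr = "free_Abelian_group (carrier A \<times> carrier B)"
  interpret Fr: group ?Fr by simp
  have "case_prod \<beta> ` (carrier A \<times> carrier B) \<subseteq> carrier (add_monoid G)" using closed by auto
  then obtain h where h: "h \<in> hom ?Fr (add_monoid G)"
    and hf: "\<And>u. u \<in> carrier A \<times> carrier B \<Longrightarrow> h (frag_of u) = case_prod \<beta> u"
    using comm_group.free_Abelian_group_universal[OF G.a_comm_group] by blast
  interpret h: group_hom ?Fr "add_monoid G" h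
    using h G.add.group_axioms Fr.group_axioms by (simp add: group_hom_def group_hom_axioms_def)
  have hadd: "h (x + y) = h x \<oplus>\<^bsub>G\<^esub> h y" if "x \<in> carrier ?Fr" "y \<in> carrier ?Fr" for x y
    using h.hom_mult[OF that] by (simp add: free_Abelian_group_def)
  have car: "x - y \<in> carrier ?Fr" if "x \<in> carrier ?Fr" "y \<in> carrier ?Fr" for x y
    using that keys_diff[of x y] by auto
  have h_in: "h x \<in> carrier G" if "x \<in> carrier ?Fr" for x using h.hom_closed[OF that] by simp
  have hdiff: "h (x - y) = h x \<ominus>\<^bsub>G\<^esub> h y" if xy: "x \<in> carrier ?Fr" "y \<in> carrier ?Fr" for x y
  proof -
    have "h x = h (x - y) \<oplus>\<^bsub>G\<^esub> h y" using hadd[OF car[OF xy] xy(2)] by simp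
    then show ?thesis
      using h_in xy car by (simp add: G.minus_eq G.a_assoc G.r_neg)
  qed
  have fr: "frag_of (c, d) \<in> carrier ?Fr" if "c \<in> carrier A" "d \<in> carrier B" for c d
    using that by simp
  have fc: "f z \<in> carrier A" "g z \<in> carrier B" if "z \<in> carrier K" for z
    using central_f[OF that] central_g[OF that] by (auto simp: centre_def)
  have relc: "t \<in> carrier ?Fr \<and> h t = \<zero>\<^bsub>G\<^esub>" if t: "t \<in> tensor_relators K f A g B" for t
  proof -
    have e: "(u \<oplus>\<^bsub>G\<^esub> v) \<ominus>\<^bsub>G\<^esub> u \<ominus>\<^bsub>G\<^esub> v = \<zero>\<^bsub>G\<^esub>" if "u \<in> carrier G" "v \<in> carrier G" for u v
      using that G.r_neg[of "u \<oplus>\<^bsub>G\<^esub> v"] by (simp add: G.minus_eq G.a_assoc G.minus_add)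
    consider c c' d where "c \<in> carrier A" "c' \<in> carrier A" "d \<in> carrier B"
        "t = frag_of (c \<oplus>\<^bsub>A\<^esub> c', d) - frag_of (c, d) - frag_of (c', d)"
      | c d d' where "c \<in> carrier A" "d \<in> carrier B" "d' \<in> carrier B"
        "t = frag_of (c, d \<oplus>\<^bsub>B\<^esub> d') - frag_of (c, d) - frag_of (c, d')"
      | c z d where "c \<in> carrier A" "z \<in> carrier K" "d \<in> carrier B"
        "t = frag_of (c \<otimes>\<^bsub>A\<^esub> f z, d) - frag_of (c, g z \<otimes>\<^bsub>B\<^esub> d)"
      using t unfolding tensor_relators_def by (elim UnE CollectE exE conjE) metis+
    then show ?thesis
    proof cases
      case 1
      then show ?thesis
        by (simp only: hdiff fr car A.a_closed hf mem_Sigma_iff simp_thms left case_prod_conv) (simp only: e closed)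
    next
      case 2
      then show ?thesis
        by (simp only: hdiff fr car B.a_closed hf mem_Sigma_iff simp_thms right case_prod_conv) (simp only: e closed)
    next
      case 3
      have "c \<otimes>\<^bsub>A\<^esub> f z \<in> carrier A" "g z \<otimes>\<^bsub>B\<^esub> d \<in> carrier B" using 3 fc by auto
      with 3 show ?thesis
        by (simp only: hdiff fr car hf mem_Sigma_iff simp_thms balanced case_prod_conv)
          (simp add: G.minus_eq G.r_neg closed)
    qed
  qed
  have "h t = \<zero>\<^bsub>G\<^esub>" if "t \<in> N" for t
  proof -
    have "generate ?Fr (tensor_relators K f A g B) \<subseteq> kernel ?Fr (add_monoid G) h"
      by (rule Fr.generate_subgroup_incl[OF _ h.subgroup_kernel]) (use relc in \<open>auto simp: kernel_def\<close>)
    with that show ?thesis by (auto simp: tensor_kernel_def kernel_def)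
  qed
  moreover have "frag_of (a, b) \<in> N"
  proof -
    have "N +>\<^bsub>F\<^esub> frag_of (a, b) = N" using ab(3) by (simp add: pure_tensor_def tensor_ring_def FactRing_def)
    then show ?thesis using N.rcos_const_imp_mem frag_of_closed[OF ab(1,2)] by blast
  qed
  ultimately show ?thesis using hf[of "(a, b)"] ab by simp
qed

end

section \<open>Rings that are free over their centre\<close>

lemma centre_ring_simps [simp]:
  "carrier (centre_ring R) = centre R" "\<zero>\<^bsub>centre_ring R\<^esub> = \<zero>\<^bsub>R\<^esub>" "\<one>\<^bsub>centre_ring R\<^esub> = \<one>\<^bsub>R\<^esub>"
  "x \<oplus>\<^bsub>centre_ring R\<^esub> y = x \<oplus>\<^bsub>R\<^esub> y" "x \<otimes>\<^bsub>centre_ring R\<^esub> y = x \<otimes>\<^bsub>R\<^esub> y"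
  by (simp_all add: centre_ring_def)

lemma centreD: "z \<in> centre R \<Longrightarrow> z \<in> carrier R" "z \<in> centre R \<Longrightarrow> x \<in> carrier R \<Longrightarrow> z \<otimes>\<^bsub>R\<^esub> x = x \<otimes>\<^bsub>R\<^esub> z"
  by (auto simp: centre_def)

text \<open>The additive inverse is defined by a description that ranges over the carrier, so its
  agreement with the one in the whole ring rests on uniqueness of inverses.\<close>

lemma (in ring) centre_ring_minus:
  assumes "z \<in> centre R" "w \<in> centre R"
  shows "z \<ominus>\<^bsub>centre_ring R\<^esub> w = z \<ominus> w"
proof -
  interpret Z: cring "centre_ring R" by (rule cring_centre_ring) (rule ring_axioms)
  have "\<ominus>\<^bsub>centre_ring R\<^esub> w = \<ominus> w"
    using Z.l_neg[of w] Z.a_inv_closed[of w] assms centreD(1)[of _ R] minus_equality by fastforce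
  then show ?thesis by (simp add: a_minus_def)
qed

text \<open>Coordinates with respect to a basis, as linear functionals over the centre.
  \<open>co_span\<close> says that \<open>x\<close> is the sum of its components
  \<open>co x b \<otimes> b\<close> without naming a finite sum: whatever is closed under addition
  and contains zero and the components contains \<open>x\<close>. Of the coordinates of basis
  elements only the diagonal value is recorded.\<close>

locale free_over_centre =
  fixes R :: "('a, 'k) ring_scheme" (structure) and B :: "'a set" and co :: "'a \<Rightarrow> 'a \<Rightarrow> 'a"
  assumes ring_R: "ring R" and basis: "B \<subseteq> carrier R"
    and co_closed: "x \<in> carrier R \<Longrightarrow> b \<in> B \<Longrightarrow> co x b \<in> centre R"
    and co_add: "x \<in> carrier R \<Longrightarrow> y \<in> carrier R \<Longrightarrow> b \<in> B \<Longrightarrow> co (x \<oplus> y) b = co x b \<oplus> co y b"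
    and co_mult: "z \<in> centre R \<Longrightarrow> x \<in> carrier R \<Longrightarrow> b \<in> B \<Longrightarrow> co (z \<otimes> x) b = z \<otimes> co x b"
    and co_basis: "b \<in> B \<Longrightarrow> co b b = \<one>"
    and co_span: "x \<in> carrier R \<Longrightarrow> H \<subseteq> carrier R \<Longrightarrow> \<zero> \<in> H \<Longrightarrow>
      (\<And>u v. u \<in> H \<Longrightarrow> v \<in> H \<Longrightarrow> u \<oplus> v \<in> H) \<Longrightarrow> (\<And>b. b \<in> B \<Longrightarrow> co x b \<otimes> b \<in> H) \<Longrightarrow> x \<in> H"

text \<open>Unique representation gives the function \<open>co\<close>; it is linear because adding
  or scaling representations gives representations, which uniqueness identifies.\<close>

lemma free_left_module_obtain_coordinates:
  fixes R :: "('a, 'k) ring_scheme" (structure)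
  assumes "ring R" and free: "free_left_module (centre_ring R) (regular_module R)"
  obtains B co where "free_over_centre R B co"
proof -
  let ?G = "regular_module R" and ?Z = "centre_ring R"
  interpret R: ring R by fact
  interpret G: left_module ?Z ?G by (rule left_module_regular_centre) fact
  obtain B where B: "B \<subseteq> carrier R"
    and ex1: "\<forall>x\<in>carrier R. \<exists>!c. c \<in> B \<rightarrow>\<^sub>E centre R \<and> finite {b \<in> B. c b \<noteq> \<zero>} \<and>
      x = (\<Oplus>\<^bsub>?G\<^esub>b\<in>{b \<in> B. c b \<noteq> \<zero>}. c b \<odot>\<^bsub>?G\<^esub> b)"
    using free by (auto simp only: free_left_module_def regular_module_simps(1) centre_ring_simps(1,2))
  define rep where "rep x c \<longleftrightarrow> c \<in> B \<rightarrow>\<^sub>E centre R \<and> finite {b \<in> B. c b \<noteq> \<zero>} \<and>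
      x = (\<Oplus>\<^bsub>?G\<^esub>b\<in>{b \<in> B. c b \<noteq> \<zero>}. c b \<odot>\<^bsub>?G\<^esub> b)" for x c
  have "\<exists>!c. rep x c" if "x \<in> carrier R" for x
    using bspec[OF ex1 that] unfolding rep_def .
  then obtain co where rep_co: "\<And>x. x \<in> carrier R \<Longrightarrow> rep x (co x)"
    and uniq': "\<And>x c. x \<in> carrier R \<Longrightarrow> rep x c \<Longrightarrow> c = co x"
    by metis
  note co = rep_co[unfolded rep_def] and uniq = uniq'[unfolded rep_def]
  have coc: "co x b \<in> centre R" if "x \<in> carrier R" "b \<in> B" for x b
    using co[OF that(1)] that(2) by auto
  have bc: "b \<in> carrier R" if "b \<in> B" for b using that B by blast
  have zc: "z \<in> carrier R" if "z \<in> centre R" for z using that by (rule centreD)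
  \<comment> \<open>A representation is summed over its own support, so two of them can be added
    only after padding both with zero terms.\<close>
  have neutral: "(\<Oplus>\<^bsub>?G\<^esub>b\<in>S'. c b \<odot>\<^bsub>?G\<^esub> b) = (\<Oplus>\<^bsub>?G\<^esub>b\<in>S. d b \<odot>\<^bsub>?G\<^esub> b)"
    if "finite S" "S' \<subseteq> S" "S \<subseteq> B" "\<And>b. b \<in> S' \<Longrightarrow> c b = d b" "\<And>b. b \<in> S - S' \<Longrightarrow> d b = \<zero>"
      "\<And>b. b \<in> S \<Longrightarrow> d b \<in> centre R" for S S' c d
    by (rule G.M.add.finprod_mono_neutral_cong_left) (use that bc zc in \<open>auto simp: Pi_iff\<close>)
  have co_sum: "co (\<Oplus>\<^bsub>?G\<^esub>b\<in>S. c b \<odot>\<^bsub>?G\<^esub> b) b = (if b \<in> S then c b else \<zero>)"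
    if S: "finite S" "S \<subseteq> B" "c \<in> S \<rightarrow> centre R" and b: "b \<in> B" for S c b
  proof -
    \<comment> \<open>Padding by zero on \<open>B\<close> and \<open>undefined\<close> outside
      \<open>B\<close> puts the coefficients into the extensional form that uniqueness refers
      to.\<close>
    define c' where "c' = (\<lambda>b\<in>B. if b \<in> S then c b else \<zero>)"
    have supp: "{b \<in> B. c' b \<noteq> \<zero>} \<subseteq> S" by (auto simp: c'_def)
    have "c' \<in> B \<rightarrow>\<^sub>E centre R"
      using S(3) G.R.zero_closed by (auto simp: c'_def Pi_iff)
    moreover have "(\<Oplus>\<^bsub>?G\<^esub>b\<in>S. c b \<odot>\<^bsub>?G\<^esub> b) = (\<Oplus>\<^bsub>?G\<^esub>b\<in>{b \<in> B. c' b \<noteq> \<zero>}. c' b \<odot>\<^bsub>?G\<^esub> b)"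
      by (rule neutral[symmetric, OF S(1) supp S(2)]) (use S in \<open>auto simp: c'_def\<close>)
    moreover have "(\<Oplus>\<^bsub>?G\<^esub>b\<in>S. c b \<odot>\<^bsub>?G\<^esub> b) \<in> carrier ?G"
      by (rule G.M.finsum_closed) (use S bc zc in \<open>auto simp: Pi_iff subset_iff\<close>)
    ultimately have "c' = co (\<Oplus>\<^bsub>?G\<^esub>b\<in>S. c b \<odot>\<^bsub>?G\<^esub> b)"
      using finite_subset[OF supp S(1)] by (intro uniq) auto
    then have "co (\<Oplus>\<^bsub>?G\<^esub>b\<in>S. c b \<odot>\<^bsub>?G\<^esub> b) b = c' b" by (simp only:)
    with b show ?thesis by (simp add: c'_def)
  qed
  have expand: "x = (\<Oplus>\<^bsub>?G\<^esub>b\<in>S. co x b \<odot>\<^bsub>?G\<^esub> b)"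
    if "x \<in> carrier R" "finite S" "S \<subseteq> B" "{b \<in> B. co x b \<noteq> \<zero>} \<subseteq> S" for x S
  proof -
    have "x = (\<Oplus>\<^bsub>?G\<^esub>b\<in>{b \<in> B. co x b \<noteq> \<zero>}. co x b \<odot>\<^bsub>?G\<^esub> b)"
      using co[OF that(1)] by (elim conjE)
    also have "\<dots> = (\<Oplus>\<^bsub>?G\<^esub>b\<in>S. co x b \<odot>\<^bsub>?G\<^esub> b)"
      by (rule neutral[OF that(2,4,3)]) (use that(3) coc[OF that(1)] in auto)
    finally show ?thesis .
  qed
  let ?s = "\<lambda>x. {b \<in> B. co x b \<noteq> \<zero>}"
  have fin: "finite (?s x)" if "x \<in> carrier R" for x using co[OF that] by simp
  have "free_over_centre R B co"
  proof (rule free_over_centre.intro)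
    show "ring R" by fact
    show "B \<subseteq> carrier R" by (rule B)
    fix x assume x: "x \<in> carrier R"
    show "co x b \<in> centre R" if "b \<in> B" for b using coc[OF x that] .
    show "co (x \<oplus> y) b = co x b \<oplus> co y b" if y: "y \<in> carrier R" and b: "b \<in> B" for y b
    proof -
      let ?S = "?s x \<union> ?s y"
      have S: "finite ?S" "?S \<subseteq> B" using fin x y by auto
      have "x \<oplus> y = (\<Oplus>\<^bsub>?G\<^esub>b\<in>?S. co x b \<odot>\<^bsub>?G\<^esub> b) \<oplus>\<^bsub>?G\<^esub> (\<Oplus>\<^bsub>?G\<^esub>b\<in>?S. co y b \<odot>\<^bsub>?G\<^esub> b)"
        using expand[OF x S] expand[OF y S] by auto
      also have "\<dots> = (\<Oplus>\<^bsub>?G\<^esub>b\<in>?S. co x b \<odot>\<^bsub>?G\<^esub> b \<oplus>\<^bsub>?G\<^esub> co y b \<odot>\<^bsub>?G\<^esub> b)"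
        by (rule G.M.finsum_addf[symmetric]) (use x y S coc zc bc in \<open>auto simp: Pi_iff\<close>)
      also have "\<dots> = (\<Oplus>\<^bsub>?G\<^esub>b\<in>?S. (co x b \<oplus> co y b) \<odot>\<^bsub>?G\<^esub> b)"
        by (rule G.M.finsum_cong') (use x y S coc zc bc in \<open>auto simp: Pi_iff R.l_distr\<close>)
      finally have e: "x \<oplus> y = \<dots>" .
      have "(\<lambda>b. co x b \<oplus> co y b) \<in> ?S \<rightarrow> centre R"
        using coc[OF x] coc[OF y] G.R.a_closed by auto
      from co_sum[OF S this b]
      have "co (x \<oplus> y) b = (if b \<in> ?S then co x b \<oplus> co y b else \<zero>)"
        unfolding e[symmetric] .
      then show ?thesis using b by auto
    qed
    show "co (z \<otimes> x) b = z \<otimes> co x b" if z: "z \<in> centre R" and b: "b \<in> B" for z b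
    proof -
      have S: "finite (?s x)" "?s x \<subseteq> B" using fin x by auto
      have "z \<otimes> x = z \<odot>\<^bsub>?G\<^esub> (\<Oplus>\<^bsub>?G\<^esub>b\<in>?s x. co x b \<odot>\<^bsub>?G\<^esub> b)"
        using expand[OF x S] by simp
      also have "\<dots> = (\<Oplus>\<^bsub>?G\<^esub>b\<in>?s x. z \<odot>\<^bsub>?G\<^esub> (co x b \<odot>\<^bsub>?G\<^esub> b))"
        by (rule G.smult_finsum_right) (use x z S coc zc bc in \<open>auto simp: Pi_iff\<close>)
      also have "\<dots> = (\<Oplus>\<^bsub>?G\<^esub>b\<in>?s x. (z \<otimes> co x b) \<odot>\<^bsub>?G\<^esub> b)"
        by (rule G.M.finsum_cong') (use x z S coc zc bc in \<open>auto simp: Pi_iff R.m_assoc\<close>)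
      finally have e: "z \<otimes> x = \<dots>" .
      have "(\<lambda>b. z \<otimes> co x b) \<in> ?s x \<rightarrow> centre R"
        using coc[OF x] z G.R.m_closed by auto
      from co_sum[OF S this b]
      have "co (z \<otimes> x) b = (if b \<in> ?s x then z \<otimes> co x b else \<zero>)"
        unfolding e[symmetric] .
      then show ?thesis using b zc[OF z] by auto
    qed
    show "x \<in> H"
      if H: "H \<subseteq> carrier R" "\<zero> \<in> H" "\<And>u v. u \<in> H \<Longrightarrow> v \<in> H \<Longrightarrow> u \<oplus> v \<in> H"
        "\<And>b. b \<in> B \<Longrightarrow> co x b \<otimes> b \<in> H" for H
    proof -
      have "(\<Oplus>\<^bsub>?G\<^esub>b\<in>S. co x b \<odot>\<^bsub>?G\<^esub> b) \<in> H" if "finite S" "S \<subseteq> B" for S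
        using that
      proof (induction S rule: finite_induct)
        case (insert b S)
        have bS: "b \<in> B" "S \<subseteq> B" using insert.prems by auto
        have "(\<Oplus>\<^bsub>?G\<^esub>b\<in>insert b S. co x b \<odot>\<^bsub>?G\<^esub> b) =
            co x b \<odot>\<^bsub>?G\<^esub> b \<oplus>\<^bsub>?G\<^esub> (\<Oplus>\<^bsub>?G\<^esub>b\<in>S. co x b \<odot>\<^bsub>?G\<^esub> b)"
        proof (rule G.M.finsum_insert[OF insert.hyps(1,2)])
          show "(\<lambda>b. co x b \<odot>\<^bsub>?G\<^esub> b) \<in> S \<rightarrow> carrier ?G"
            using bS zc[OF coc[OF x]] bc by auto
          show "co x b \<odot>\<^bsub>?G\<^esub> b \<in> carrier ?G"
            using bS zc[OF coc[OF x]] bc by auto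
        qed
        then show ?case using H(3)[OF H(4)[OF bS(1)] insert.IH[OF bS(2)]] by simp
      qed (use H in simp)
      then have "(\<Oplus>\<^bsub>?G\<^esub>b\<in>?s x. co x b \<odot>\<^bsub>?G\<^esub> b) \<in> H" using fin[OF x] by blast
      moreover have "x = (\<Oplus>\<^bsub>?G\<^esub>b\<in>?s x. co x b \<odot>\<^bsub>?G\<^esub> b)"
        by (rule expand[OF x fin[OF x]]) auto
      ultimately show ?thesis by (simp only:)
    qed
  next
    fix b assume b: "b \<in> B"
    have "co (\<Oplus>\<^bsub>?G\<^esub>b\<in>{b}. \<one> \<odot>\<^bsub>?G\<^esub> b) b = \<one>"
      using co_sum[of "{b}" "\<lambda>_. \<one>" b] b G.R.one_closed by simp
    moreover have "(\<Oplus>\<^bsub>?G\<^esub>b\<in>{b}. \<one> \<odot>\<^bsub>?G\<^esub> b) = b"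
      using bc[OF b] by (subst G.M.finsum_insert) auto
    ultimately show "co b b = \<one>" by simp
  qed
  then show ?thesis by (rule that)
qed

context free_over_centre
begin

interpretation R: ring R by (rule ring_R)
interpretation Z: cring "centre_ring R" by (rule cring_centre_ring) (rule ring_R)

text \<open>\<open>Rp\<close> is the sum of the \<open>p b\<close> over the basis. A generator
  \<open>i \<otimes> j\<close> has \<open>j\<close> in \<open>p\<close>, hence central, so its
  coordinates are \<open>j\<close> times those of \<open>i\<close>; conversely each component
  \<open>co x b \<otimes> b\<close> equals \<open>b \<otimes> co x b\<close>, which has the shape of
  a generator.\<close>

lemma extended_ideal_iff:
  assumes p: "ideal p (centre_ring R)" and x: "x \<in> carrier R"
  shows "x \<in> extended_ideal R p \<longleftrightarrow> (\<forall>b\<in>B. co x b \<in> p)"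
proof -
  interpret p: ideal p "centre_ring R" by fact
  interpret Rp: ideal "extended_ideal R p" R by (rule ideal_extended_ideal[OF ring_R p])
  have pc: "z \<in> centre R" if "z \<in> p" for z using p.Icarr[OF that] by simp
  show ?thesis
  proof
    assume "x \<in> extended_ideal R p"
    then show "\<forall>b\<in>B. co x b \<in> p"
      unfolding extended_ideal_def
    proof (induction rule: ideal_prod.induct)
      case (prod i j)
      have "co (i \<otimes> j) b = j \<otimes> co i b" if "b \<in> B" for b
        using prod that pc[of j] co_mult[of j i b] centreD(2)[of j R i] by simp
      then show ?case
        using prod p.I_r_closed[of j] co_closed by simp
    next
      case (sum s t)
      have "s \<in> carrier R" "t \<in> carrier R" using sum Rp.Icarr by (auto simp: extended_ideal_def)
      then show ?case using sum p.a_closed by (simp add: co_add)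
    qed
  next
    assume *: "\<forall>b\<in>B. co x b \<in> p"
    show "x \<in> extended_ideal R p"
    proof (rule co_span[OF x])
      fix b assume b: "b \<in> B"
      have "co x b \<otimes> b = b \<otimes> co x b" using co_closed[OF x b] b basis by (auto simp: centre_def)
      then show "co x b \<otimes> b \<in> extended_ideal R p"
        using * b basis unfolding extended_ideal_def by (auto intro: ideal_prod.prod)
    qed (use Rp.Icarr Rp.zero_closed Rp.a_closed in auto)
  qed
qed

lemma basis_nonempty:
  assumes "carrier R \<noteq> {\<zero>}" shows "B \<noteq> {}"
proof
  assume B: "B = {}"
  have "x \<in> {\<zero>}" if "x \<in> carrier R" for x
    by (rule co_span[OF that]) (auto simp: B)
  with assms show False using R.zero_closed by auto
qed

lemma co_minus:
  assumes "x \<in> carrier R" "y \<in> carrier R" "b \<in> B"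
  shows "co (x \<ominus> y) b = co x b \<ominus> co y b"
proof -
  have "co x b = co (x \<ominus> y) b \<oplus> co y b"
    using assms co_add[of "x \<ominus> y" y b] by (simp add: R.minus_eq R.a_assoc R.l_neg)
  moreover have "co (x \<ominus> y) b \<in> carrier R" "co y b \<in> carrier R"
    using assms centreD(1)[OF co_closed, of _ b] by auto
  ultimately show ?thesis by (simp add: R.minus_eq R.a_assoc R.r_neg)
qed

text \<open>For central \<open>z\<close> the coordinate of \<open>z \<otimes> b\<close> at
  \<open>b\<close> is \<open>z\<close> itself. The ring has to be nonzero in order to have a basis
  element.\<close>

lemma extended_ideal_contraction:
  assumes "carrier R \<noteq> {\<zero>}" "ideal p (centre_ring R)"
  shows "extended_ideal R p \<inter> centre R = p"
proof -
  interpret p: ideal p "centre_ring R" by fact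
  obtain b where b: "b \<in> B" using basis_nonempty[OF assms(1)] by blast
  have bR: "b \<in> carrier R" using b basis by blast
  interpret Rp: ideal "extended_ideal R p" R by (rule ideal_extended_ideal[OF ring_R assms(2)])
  have "z \<in> p" if "z \<in> extended_ideal R p" "z \<in> centre R" for z
  proof -
    have "co (z \<otimes> b) b \<in> p"
      using extended_ideal_iff[OF assms(2), of "z \<otimes> b"] Rp.I_r_closed[OF that(1) bR] b Rp.Icarr by blast
    then show ?thesis using co_mult[OF that(2) bR b] co_basis[OF b] centreD(1)[OF that(2)] by simp
  qed
  moreover have "z \<in> extended_ideal R p \<and> z \<in> centre R" if "z \<in> p" for z
  proof -
    have "z \<in> centre R" using p.Icarr[OF that] by simp
    moreover have "\<one> \<otimes> z \<in> extended_ideal R p"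
      unfolding extended_ideal_def using that by (auto intro: ideal_prod.prod)
    ultimately show ?thesis using centreD(1)[of z R] by simp
  qed
  ultimately show ?thesis by blast
qed

text \<open>Multiplying \<open>c \<otimes> r \<ominus> \<one>\<close> by a basis element
  \<open>b\<close> and reading off the coordinate at \<open>b\<close> gives
  \<open>c \<otimes> z \<ominus> \<one>\<close>, with \<open>z\<close> the coordinate of
  \<open>r \<otimes> b\<close> at \<open>b\<close>.\<close>

lemma central_inverse_mod:
  assumes "carrier R \<noteq> {\<zero>}" and p: "ideal p (centre_ring R)"
    and c: "c \<in> centre R" and r: "r \<in> carrier R" "c \<otimes> r \<ominus> \<one> \<in> extended_ideal R p"
  obtains z where "z \<in> centre R" "c \<otimes> z \<ominus> \<one> \<in> p"
proof -
  obtain b where b: "b \<in> B" using basis_nonempty[OF assms(1)] by blast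
  have bR: "b \<in> carrier R" using b basis by blast
  have cR: "c \<in> carrier R" using c by (rule centreD)
  interpret Rp: ideal "extended_ideal R p" R by (rule ideal_extended_ideal[OF ring_R p])
  have "(c \<otimes> r \<ominus> \<one>) \<otimes> b \<in> extended_ideal R p" by (rule Rp.I_r_closed[OF r(2) bR])
  moreover have "(c \<otimes> r \<ominus> \<one>) \<otimes> b = c \<otimes> (r \<otimes> b) \<ominus> b"
    using cR r(1) bR by (simp add: R.minus_eq R.l_distr R.l_minus R.m_assoc)
  ultimately have "co (c \<otimes> (r \<otimes> b) \<ominus> b) b \<in> p"
    using extended_ideal_iff[OF p] b cR r(1) bR by simp
  then have "c \<otimes> co (r \<otimes> b) b \<ominus> \<one> \<in> p"
    using cR r(1) bR b c by (simp add: co_minus co_mult co_basis)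
  then show ?thesis using that co_closed[OF _ b] r(1) bR by blast
qed

end

section \<open>The fibre over a prime ideal of the centre\<close>

locale central_prime =
  fixes R :: "('a, 'k) ring_scheme" and p :: "'a set"
  assumes ring_R: "ring R" and prime: "primeideal p (centre_ring R)"
begin

section \<open>The residue field of the centre at \<open>p\<close>\<close>

abbreviation "\<kappa> \<equiv> to_residue_field R p"
abbreviation "K \<equiv> residue_field R p"

lemma cring_centre: "cring (centre_ring R)" by (rule cring_centre_ring[OF ring_R])

lemma ideal_p: "ideal p (centre_ring R)" using prime by (rule primeideal.axioms)

lemma domain_residue_domain: "domain (residue_domain R p)"
  unfolding residue_domain_def by (rule primeideal.quotient_is_domain[OF prime])

lemma field_residue_field: "field K"
  unfolding residue_field_def by (rule field_field_of_fractions[OF domain_residue_domain])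

abbreviation (input) "cls z \<equiv> p +>\<^bsub>centre_ring R\<^esub> z"

lemma residue_class_hom: "cls \<in> ring_hom (centre_ring R) (residue_domain R p)"
  unfolding residue_domain_def by (rule ideal.rcos_ring_hom[OF ideal_p])

lemma residue_class_zero_iff:
  assumes "z \<in> centre R" shows "cls z = \<zero>\<^bsub>residue_domain R p\<^esub> \<longleftrightarrow> z \<in> p"
proof -
  interpret p: ideal p "centre_ring R" by (rule ideal_p)
  show ?thesis
    using p.rcos_const_imp_mem[of z] p.a_coset_join2[of z p] assms p.additive_subgroup_axioms
    by (auto simp: residue_domain_def FactRing_def additive_subgroup_def)
qed

lemma kappa_hom: "\<kappa> \<in> ring_hom (centre_ring R) K"
proof -
  interpret D: "domain" "residue_domain R p" by (rule domain_residue_domain)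
  note c = ring_hom_closed[OF residue_class_hom]
  have k: "\<kappa> z = fraction (residue_domain R p) (cls z) \<one>\<^bsub>residue_domain R p\<^esub>" for z
    by (simp add: to_residue_field_def)
  show ?thesis
  proof (rule ring_hom_memI)
    fix z w assume z: "z \<in> carrier (centre_ring R)" and w: "w \<in> carrier (centre_ring R)"
    show "\<kappa> z \<in> carrier K"
      using c[OF z] D.one_closed D.one_not_zero
      unfolding k residue_field_def carrier_field_of_fractions by blast
    show "\<kappa> (z \<otimes>\<^bsub>centre_ring R\<^esub> w) = \<kappa> z \<otimes>\<^bsub>K\<^esub> \<kappa> w"
      unfolding k residue_field_def ring_hom_mult[OF residue_class_hom z w]
      using c[OF z] c[OF w] by (subst fraction_add_mult(1)[OF domain_residue_domain]) simp_all
    show "\<kappa> (z \<oplus>\<^bsub>centre_ring R\<^esub> w) = \<kappa> z \<oplus>\<^bsub>K\<^esub> \<kappa> w"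
      unfolding k residue_field_def ring_hom_add[OF residue_class_hom z w]
      using c[OF z] c[OF w] by (subst fraction_add_mult(2)[OF domain_residue_domain]) simp_all
  next
    show "\<kappa> \<one>\<^bsub>centre_ring R\<^esub> = \<one>\<^bsub>K\<^esub>"
      using ring_hom_one[OF residue_class_hom]
      by (simp add: k residue_field_def field_of_fractions_def)
  qed
qed

lemma kappa_zero_iff:
  assumes "z \<in> centre R" shows "\<kappa> z = \<zero>\<^bsub>K\<^esub> \<longleftrightarrow> z \<in> p"
proof -
  interpret D: "domain" "residue_domain R p" by (rule domain_residue_domain)
  have c: "cls z \<in> carrier (residue_domain R p)"
    using ring_hom_closed[OF residue_class_hom] assms by simp
  have "\<kappa> z = \<zero>\<^bsub>K\<^esub> \<longleftrightarrow> fraction (residue_domain R p) (cls z) \<one>\<^bsub>residue_domain R p\<^esub> =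
      fraction (residue_domain R p) \<zero>\<^bsub>residue_domain R p\<^esub> \<one>\<^bsub>residue_domain R p\<^esub>"
    by (simp add: to_residue_field_def residue_field_def field_of_fractions_def)
  also have "\<dots> \<longleftrightarrow> cls z = \<zero>\<^bsub>residue_domain R p\<^esub>"
    using c by (subst fraction_eq_iff[OF domain_residue_domain]) (auto simp: fraction_pairs_def)
  finally show ?thesis using residue_class_zero_iff[OF assms] by simp
qed

text \<open>Numerator and denominator are lifted to \<open>z\<close> and \<open>s\<close> in the
  centre, and the fraction is written multiplied out, so clearing denominators in the tensor product
  involves no inverses.\<close>

lemma residue_field_fraction:
  assumes "k \<in> carrier K"
  obtains z s where "z \<in> centre R" "s \<in> centre R" "s \<notin> p" "k \<otimes>\<^bsub>K\<^esub> \<kappa> s = \<kappa> z"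
proof -
  interpret D: "domain" "residue_domain R p" by (rule domain_residue_domain)
  obtain a b where ab: "k = fraction (residue_domain R p) a b" "a \<in> carrier (residue_domain R p)"
    "b \<in> carrier (residue_domain R p)" "b \<noteq> \<zero>\<^bsub>residue_domain R p\<^esub>"
    using assms by (auto simp: residue_field_def carrier_field_of_fractions)
  have E: "\<exists>z\<in>centre R. x = cls z" if "x \<in> carrier (residue_domain R p)" for x
    using that by (auto simp: residue_domain_def FactRing_def A_RCOSETS_def')
  obtain z s where zs: "z \<in> centre R" "a = cls z" "s \<in> centre R" "b = cls s"
    using E[OF ab(2)] E[OF ab(3)] by blast
  have "k \<otimes>\<^bsub>K\<^esub> \<kappa> s = fraction (residue_domain R p) (a \<otimes>\<^bsub>residue_domain R p\<^esub> b) b"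
    unfolding ab(1) to_residue_field_def zs(4)[symmetric] residue_field_def
    using ab by (subst fraction_add_mult(1)[OF domain_residue_domain]) auto
  also have "\<dots> = fraction (residue_domain R p) a \<one>\<^bsub>residue_domain R p\<^esub>"
    using ab by (subst fraction_eq_iff[OF domain_residue_domain]) (auto simp: fraction_pairs_def)
  also have "\<dots> = \<kappa> z" by (simp add: to_residue_field_def zs)
  finally show ?thesis
    using that zs ab(4) residue_class_zero_iff[OF zs(3)] by blast
qed

section \<open>The ring homomorphism from \<open>R\<close> to its fibre over
  \<open>p\<close>\<close>

abbreviation "\<phi> \<equiv> to_fibre_ring R p"

lemma ideal_Rp: "ideal (extended_ideal R p) R"
  by (rule ideal_extended_ideal[OF ring_R ideal_p])

lemma to_quotient_hom: "to_quotient R p \<in> ring_hom R (R Quot extended_ideal R p)"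
  unfolding to_quotient_def[abs_def] by (rule ideal.rcos_ring_hom[OF ideal_Rp])

sublocale tensor_algebra "centre_ring R" \<kappa> K "to_quotient R p" "R Quot extended_ideal R p"
proof (rule tensor_algebra.intro)
  interpret K: field K by (rule field_residue_field)
  show "ring K" by (rule K.ring_axioms)
  show "ring (R Quot extended_ideal R p)" by (rule ideal.quotient_is_ring[OF ideal_Rp])
  fix z assume z: "z \<in> carrier (centre_ring R)"
  show "\<kappa> z \<in> centre K" using ring_hom_closed[OF kappa_hom z] by (simp add: centre_def K.m_comm)
  have zR: "z \<in> carrier R" using z by (simp add: centreD(1))
  have "to_quotient R p z \<otimes>\<^bsub>R Quot extended_ideal R p\<^esub> x = x \<otimes>\<^bsub>R Quot extended_ideal R p\<^esub> to_quotient R p z"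
    if x: "x \<in> carrier (R Quot extended_ideal R p)" for x
  proof -
    obtain r where r: "r \<in> carrier R" "x = to_quotient R p r"
      using x by (auto simp: FactRing_def A_RCOSETS_def' to_quotient_def)
    show ?thesis
      using ring_hom_mult[OF to_quotient_hom zR r(1)] ring_hom_mult[OF to_quotient_hom r(1) zR]
        centreD(2)[of z R r] z r by simp
  qed
  then show "to_quotient R p z \<in> centre (R Quot extended_ideal R p)"
    using ring_hom_closed[OF to_quotient_hom zR] by (simp add: centre_def)
qed

lemma fibre_ring_eq: "fibre_ring R p = T"
  by (simp add: fibre_ring_def)

lemma phi_eq: "\<phi> r = pt \<one>\<^bsub>K\<^esub> (to_quotient R p r)"
  by (simp add: to_fibre_ring_def)

lemma one_K: "\<one>\<^bsub>K\<^esub> \<in> carrier K"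
  by (rule ring.ring_simprules(6)[OF ring_A])

lemma phi_hom: "\<phi> \<in> ring_hom R T"
proof (rule ring_hom_memI)
  interpret K: field K by (rule field_residue_field)
  fix x y assume xy: "x \<in> carrier R" "y \<in> carrier R"
  note q = ring_hom_closed[OF to_quotient_hom]
  show "\<phi> x \<in> carrier T" unfolding phi_eq by (rule pure_tensor_closed[OF one_K q[OF xy(1)]])
  show "\<phi> (x \<otimes>\<^bsub>R\<^esub> y) = \<phi> x \<otimes>\<^bsub>T\<^esub> \<phi> y"
    unfolding phi_eq by (simp add: pure_tensor_mult one_K q xy ring_hom_mult[OF to_quotient_hom])
  show "\<phi> (x \<oplus>\<^bsub>R\<^esub> y) = \<phi> x \<oplus>\<^bsub>T\<^esub> \<phi> y"
    unfolding phi_eq by (simp add: pure_tensor_add_right one_K q xy ring_hom_add[OF to_quotient_hom])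
next
  show "\<phi> \<one>\<^bsub>R\<^esub> = \<one>\<^bsub>T\<^esub>"
    unfolding phi_eq ring_hom_one[OF to_quotient_hom] by (rule pure_tensor_one)
qed

text \<open>Balancedness moves a central scalar across the tensor sign, from \<open>R/Rp\<close> to
  the residue field.\<close>

lemma phi_mult_pure:
  assumes z: "z \<in> centre R" and k: "k \<in> carrier K" and Q: "Q \<in> carrier (R Quot extended_ideal R p)"
  shows "\<phi> z \<otimes>\<^bsub>T\<^esub> pt k Q = pt (k \<otimes>\<^bsub>K\<^esub> \<kappa> z) Q"
proof -
  interpret K: field K by (rule field_residue_field)
  have "to_quotient R p z \<in> carrier (R Quot extended_ideal R p)"
    using ring_hom_closed[OF to_quotient_hom] z by (simp add: centreD(1))
  then show ?thesis
    using pure_tensor_balanced[OF k, of z Q] k Q z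
    by (simp add: phi_eq pure_tensor_mult)
qed

text \<open>\<open>\<phi> s\<close> is the pure tensor of \<open>\<kappa> s\<close> and the
  identity, and \<open>\<kappa> s\<close> is a nonzero element of a field.\<close>

lemma phi_unit:
  assumes s: "s \<in> centre R" "s \<notin> p"
  shows "\<phi> s \<in> Units T"
proof -
  interpret K: field K by (rule field_residue_field)
  interpret A: ring "R Quot extended_ideal R p" by (rule ring_B)
  have k: "\<kappa> s \<in> carrier K" "\<kappa> s \<noteq> \<zero>\<^bsub>K\<^esub>"
    using ring_hom_closed[OF kappa_hom] kappa_zero_iff s by auto
  then have u: "\<kappa> s \<in> Units K" by (simp add: K.field_Units)
  let ?i = "pt (inv\<^bsub>K\<^esub> (\<kappa> s)) \<one>\<^bsub>R Quot extended_ideal R p\<^esub>"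
  have i: "?i \<in> carrier T" using u by (intro pure_tensor_closed) auto
  have "\<phi> s \<otimes>\<^bsub>T\<^esub> \<one>\<^bsub>T\<^esub> = pt (\<one>\<^bsub>K\<^esub> \<otimes>\<^bsub>K\<^esub> \<kappa> s) \<one>\<^bsub>R Quot extended_ideal R p\<^esub>"
    unfolding pure_tensor_one[symmetric] by (rule phi_mult_pure[OF s(1)]) auto
  moreover have ps: "\<phi> s \<in> carrier T" using ring_hom_closed[OF phi_hom] s by (simp add: centreD(1))
  ultimately have e: "\<phi> s = pt (\<kappa> s) \<one>\<^bsub>R Quot extended_ideal R p\<^esub>" using k by simp
  have "\<phi> s \<otimes>\<^bsub>T\<^esub> ?i = \<one>\<^bsub>T\<^esub>" "?i \<otimes>\<^bsub>T\<^esub> \<phi> s = \<one>\<^bsub>T\<^esub>"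
    unfolding e using u k by (simp_all add: pure_tensor_mult pure_tensor_one)
  then show ?thesis using i ps unfolding Units_def by blast
qed

text \<open>For a pure tensor the denominator of its left factor is cleared; for a difference the
  product of the two denominators serves, which lies outside \<open>p\<close> by primeness.\<close>

lemma phi_fraction:
  assumes "t \<in> carrier T"
  shows "\<exists>s\<in>centre R - p. \<exists>r\<in>carrier R. \<phi> s \<otimes>\<^bsub>T\<^esub> t = \<phi> r"
  using assms
proof (induction t rule: tensor_induct)
  case (pure k Q)
  obtain z s where zs: "z \<in> centre R" "s \<in> centre R" "s \<notin> p" "k \<otimes>\<^bsub>K\<^esub> \<kappa> s = \<kappa> z"
    using residue_field_fraction[OF pure(1)] .
  obtain r where r: "r \<in> carrier R" "Q = to_quotient R p r"
    using pure(2) by (auto simp: FactRing_def A_RCOSETS_def' to_quotient_def)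
  interpret K: field K by (rule field_residue_field)
  have "\<phi> s \<otimes>\<^bsub>T\<^esub> pt k Q = pt (\<one>\<^bsub>K\<^esub> \<otimes>\<^bsub>K\<^esub> \<kappa> z) Q"
    using phi_mult_pure[OF zs(2) pure] zs ring_hom_closed[OF kappa_hom, of z] by simp
  also have "\<dots> = \<phi> z \<otimes>\<^bsub>T\<^esub> \<phi> r"
    unfolding phi_eq[of r] r(2)[symmetric] by (rule phi_mult_pure[OF zs(1) one_K pure(2), symmetric])
  also have "\<dots> = \<phi> (z \<otimes>\<^bsub>R\<^esub> r)"
    using ring_hom_mult[OF phi_hom] zs r by (simp add: centreD(1))
  finally show ?case using zs r(1) ring.ring_simprules(5)[OF ring_R] centreD(1)[OF zs(1)] by blast
next
  case (diff t t')
  interpret R: ring R by (rule ring_R)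
  interpret p: primeideal p "centre_ring R" by (rule prime)
  obtain s r where s: "s \<in> centre R" "s \<notin> p" "r \<in> carrier R" "\<phi> s \<otimes>\<^bsub>T\<^esub> t = \<phi> r" using diff by blast
  obtain s' r' where s': "s' \<in> centre R" "s' \<notin> p" "r' \<in> carrier R" "\<phi> s' \<otimes>\<^bsub>T\<^esub> t' = \<phi> r'" using diff by blast
  note c = centreD(1)[OF s(1)] centreD(1)[OF s'(1)]
  note h = ring_hom_mult[OF phi_hom] ring_hom_closed[OF phi_hom]
  \<comment> \<open>The central factors are interchanged in front of \<open>t\<close> only, so that
    \<open>\<phi> s\<close> meets \<open>t\<close> while \<open>\<phi> s'\<close> meets
    \<open>t'\<close>.\<close>
  have "\<phi> (s \<otimes>\<^bsub>R\<^esub> s') \<otimes>\<^bsub>T\<^esub> (t \<ominus>\<^bsub>T\<^esub> t') = \<phi> (s' \<otimes>\<^bsub>R\<^esub> s) \<otimes>\<^bsub>T\<^esub> t \<ominus>\<^bsub>T\<^esub> \<phi> (s \<otimes>\<^bsub>R\<^esub> s') \<otimes>\<^bsub>T\<^esub> t'"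
    using c diff(1,2) h(2) centreD(2)[OF s(1) c(2)] by (simp add: T.minus_eq T.r_distr T.r_minus)
  also have "\<dots> = \<phi> s' \<otimes>\<^bsub>T\<^esub> \<phi> r \<ominus>\<^bsub>T\<^esub> \<phi> s \<otimes>\<^bsub>T\<^esub> \<phi> r'"
    using c diff(1,2) by (simp add: h T.m_assoc s(4) s'(4))
  finally have e: "\<phi> (s \<otimes>\<^bsub>R\<^esub> s') \<otimes>\<^bsub>T\<^esub> (t \<ominus>\<^bsub>T\<^esub> t') = \<phi> s' \<otimes>\<^bsub>T\<^esub> \<phi> r \<ominus>\<^bsub>T\<^esub> \<phi> s \<otimes>\<^bsub>T\<^esub> \<phi> r'" .
  show ?case
  proof (intro bexI)
    show "\<phi> (s \<otimes>\<^bsub>R\<^esub> s') \<otimes>\<^bsub>T\<^esub> (t \<ominus>\<^bsub>T\<^esub> t') = \<phi> (s' \<otimes>\<^bsub>R\<^esub> r \<ominus>\<^bsub>R\<^esub> s \<otimes>\<^bsub>R\<^esub> r')"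
      unfolding e using c s s' by (simp add: ring_hom_minus(1)[OF ring_R T.ring_axioms phi_hom] h)
    show "s \<otimes>\<^bsub>R\<^esub> s' \<in> centre R - p"
      using p.I_prime[of s s'] s s' p.m_closed[of s s'] by auto
  qed (use c s s' in auto)
qed

text \<open>The coordinate at \<open>b\<close> maps \<open>Rp\<close> into \<open>p\<close>, hence
  induces \<open>\<Lambda>\<close> from \<open>R/Rp\<close> to \<open>K\<close>, and the product of
  \<open>k\<close> and \<open>\<Lambda> Q\<close> is balanced in \<open>k\<close> and
  \<open>Q\<close>. If the tensor of 1 and the class of \<open>r\<close> vanishes, so does
  \<open>\<kappa> (co r b)\<close>, which puts \<open>co r b\<close> into \<open>p\<close>; all
  \<open>b\<close> together give \<open>r\<close> in \<open>Rp\<close>.\<close>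

lemma phi_zero_imp:
  assumes free: "free_over_centre R B co" and r: "r \<in> carrier R" "\<phi> r = \<zero>\<^bsub>T\<^esub>"
  shows "r \<in> extended_ideal R p"
proof -
  interpret R: ring R by (rule ring_R)
  interpret F: free_over_centre R B co by (rule free)
  interpret K: field K by (rule field_residue_field)
  let ?A = "R Quot extended_ideal R p" and ?q = "to_quotient R p"
  note kc = ring_hom_closed[OF kappa_hom, simplified]
  have "co r b \<in> p" if b: "b \<in> B" for b
  proof -
    \<comment> \<open>An arbitrary representative of the coset is chosen; \<open>L\<close> shows
      that the value does not depend on it.\<close>
    define \<Lambda> where "\<Lambda> Q = \<kappa> (co (SOME r. r \<in> carrier R \<and> Q = ?q r) b)" for Q
    have cc: "co x b \<in> centre R" if "x \<in> carrier R" for x using F.co_closed[OF that b] .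
    have L: "\<Lambda> (?q x) = \<kappa> (co x b)" if x: "x \<in> carrier R" for x
    proof -
      define y where "y = (SOME r. r \<in> carrier R \<and> ?q x = ?q r)"
      have y: "y \<in> carrier R" "?q x = ?q y"
        using someI[of "\<lambda>r. r \<in> carrier R \<and> ?q x = ?q r" x] x by (auto simp: y_def)
      have "y \<ominus>\<^bsub>R\<^esub> x \<in> extended_ideal R p"
        using R.quotient_eq_iff_same_a_r_cos[OF ideal_Rp y(1) x] y(2) by (simp add: to_quotient_def)
      then have "co y b \<ominus>\<^bsub>R\<^esub> co x b \<in> p"
        using F.extended_ideal_iff[OF ideal_p, of "y \<ominus>\<^bsub>R\<^esub> x"] F.co_minus[OF y(1) x b] x y b by auto
      then have 1: "\<kappa> (co y b \<ominus>\<^bsub>centre_ring R\<^esub> co x b) = \<zero>\<^bsub>K\<^esub>" (is "\<kappa> ?d = _")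
        using kappa_zero_iff[of ?d] R.centre_ring_minus[OF cc[OF y(1)] cc[OF x]]
          ideal.Icarr[OF ideal_p] by auto
      interpret Z: cring "centre_ring R" by (rule cring_centre)
      have "\<kappa> (co y b) \<ominus>\<^bsub>K\<^esub> \<kappa> (co x b) = \<zero>\<^bsub>K\<^esub>"
        using 1 ring_hom_minus(1)[OF Z.ring_axioms K.ring_axioms kappa_hom] cc[OF y(1)] cc[OF x] by simp
      then have "\<kappa> (co y b) = \<kappa> (co x b)"
        using kc cc[OF y(1)] cc[OF x] K.r_right_minus_eq by simp
      then show ?thesis by (simp add: \<Lambda>_def y_def)
    qed
    have E: "\<exists>x\<in>carrier R. Q = ?q x" if "Q \<in> carrier ?A" for Q
      using that by (auto simp: FactRing_def A_RCOSETS_def' to_quotient_def)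
    have "\<one>\<^bsub>K\<^esub> \<otimes>\<^bsub>K\<^esub> \<Lambda> (?q r) = \<zero>\<^bsub>K\<^esub>"
    proof (rule balanced_map_zero[where G = K and \<beta> = "\<lambda>k Q. k \<otimes>\<^bsub>K\<^esub> \<Lambda> Q"])
      show "abelian_group K" by (rule K.abelian_group_axioms)
      have Lc: "\<Lambda> Q \<in> carrier K" if "Q \<in> carrier ?A" for Q
        using E[OF that] L cc kc by auto
      show "k \<otimes>\<^bsub>K\<^esub> \<Lambda> Q \<in> carrier K" if "k \<in> carrier K" "Q \<in> carrier ?A" for k Q
        using that Lc by auto
      show "(k \<oplus>\<^bsub>K\<^esub> k') \<otimes>\<^bsub>K\<^esub> \<Lambda> Q = k \<otimes>\<^bsub>K\<^esub> \<Lambda> Q \<oplus>\<^bsub>K\<^esub> k' \<otimes>\<^bsub>K\<^esub> \<Lambda> Q"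
        if "k \<in> carrier K" "k' \<in> carrier K" "Q \<in> carrier ?A" for k k' Q
        using that Lc by (simp add: K.l_distr)
      show "k \<otimes>\<^bsub>K\<^esub> \<Lambda> (Q \<oplus>\<^bsub>?A\<^esub> Q') = k \<otimes>\<^bsub>K\<^esub> \<Lambda> Q \<oplus>\<^bsub>K\<^esub> k \<otimes>\<^bsub>K\<^esub> \<Lambda> Q'"
        if k: "k \<in> carrier K" and Q: "Q \<in> carrier ?A" and Q': "Q' \<in> carrier ?A" for k Q Q'
      proof -
        obtain x y where x: "x \<in> carrier R" "Q = ?q x" and y: "y \<in> carrier R" "Q' = ?q y"
          using E Q Q' by blast
        have "\<Lambda> (Q \<oplus>\<^bsub>?A\<^esub> Q') = \<Lambda> (?q (x \<oplus>\<^bsub>R\<^esub> y))"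
          using ring_hom_add[OF to_quotient_hom x(1) y(1)] x y by simp
        also have "\<dots> = \<kappa> (co x b) \<oplus>\<^bsub>K\<^esub> \<kappa> (co y b)"
          using x y b ring_hom_add[OF kappa_hom, of "co x b" "co y b"] cc by (simp add: L F.co_add)
        finally show ?thesis using k x y cc kc by (simp add: L K.r_distr)
      qed
      show "k \<otimes>\<^bsub>K\<^esub> \<kappa> z \<otimes>\<^bsub>K\<^esub> \<Lambda> Q = k \<otimes>\<^bsub>K\<^esub> \<Lambda> (?q z \<otimes>\<^bsub>?A\<^esub> Q)"
        if k: "k \<in> carrier K" and z: "z \<in> carrier (centre_ring R)" and Q: "Q \<in> carrier ?A" for k z Q
      proof -
        obtain x where x: "x \<in> carrier R" "Q = ?q x" using E Q by blast
        have zR: "z \<in> centre R" "z \<in> carrier R" using z by (auto simp: centreD(1))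
        have "\<Lambda> (?q z \<otimes>\<^bsub>?A\<^esub> Q) = \<Lambda> (?q (z \<otimes>\<^bsub>R\<^esub> x))"
          using ring_hom_mult[OF to_quotient_hom zR(2) x(1)] x by simp
        also have "\<dots> = \<kappa> z \<otimes>\<^bsub>K\<^esub> \<kappa> (co x b)"
          using x b zR ring_hom_mult[OF kappa_hom, of z "co x b"] cc by (simp add: L F.co_mult)
        finally show ?thesis using k x cc kc zR by (simp add: L K.m_assoc)
      qed
      show "pt \<one>\<^bsub>K\<^esub> (?q r) = \<zero>\<^bsub>T\<^esub>" using r(2) by (simp add: phi_eq)
      show "?q r \<in> carrier ?A" using ring_hom_closed[OF to_quotient_hom r(1)] .
    qed simp
    then show ?thesis using L[OF r(1)] cc[OF r(1)] kc kappa_zero_iff by auto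
  qed
  then show ?thesis using F.extended_ideal_iff[OF ideal_p r(1)] by blast
qed

lemma phi_extended_ideal:
  assumes "r \<in> extended_ideal R p"
  shows "\<phi> r = \<zero>\<^bsub>T\<^esub>"
proof -
  interpret Rp: ideal "extended_ideal R p" R by (rule ideal_Rp)
  have r: "r \<in> carrier R" by (rule Rp.Icarr[OF assms])
  have "to_quotient R p r = to_quotient R p \<zero>\<^bsub>R\<^esub>"
    unfolding to_quotient_def
    using Rp.quotient_eq_iff_same_a_r_cos[OF ideal_Rp r ring.ring_simprules(2)[OF ring_R]] assms r
    by (simp add: Rp.minus_eq)
  then have "\<phi> r = \<phi> \<zero>\<^bsub>R\<^esub>" by (simp add: phi_eq)
  then show ?thesis
    using ring_hom_zero[OF phi_hom ring_R T.ring_axioms] by simp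
qed

end

section \<open>Prime and maximal ideals\<close>

lemma ideal_eq_carrier: "ideal I R \<Longrightarrow> \<one>\<^bsub>R\<^esub> \<in> I \<Longrightarrow> I = carrier R"
  using ideal.one_imp_carrier by metis

text \<open>Zorn on the ideals over \<open>I\<close> that omit \<open>\<one>\<close>: this form of
  properness passes to unions of chains at once.\<close>

lemma MaxSpec_over:
  fixes R (structure)
  assumes "ring R" "ideal I R" "I \<noteq> carrier R"
  obtains P where "P \<in> MaxSpec R" "I \<subseteq> P"
proof -
  interpret ring R by fact
  let ?A = "{J. ideal J R \<and> I \<subseteq> J \<and> \<one> \<notin> J}"
  have "\<exists>P\<in>?A. \<forall>J\<in>?A. P \<subseteq> J \<longrightarrow> J = P"
  proof (rule subset_Zorn_nonempty)
    show "?A \<noteq> {}" using assms ideal_eq_carrier by blast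
    fix C assume C: "C \<noteq> {}" "subset.chain ?A C"
    have id: "ideal J R" if "J \<in> C" for J using C(2) that by (auto simp: subset.chain_def)
    have sum: "x \<oplus> y \<in> \<Union>C" if "x \<in> \<Union>C" "y \<in> \<Union>C" for x y
    proof -
      from that obtain J K where JK: "J \<in> C" "x \<in> J" "K \<in> C" "y \<in> K" by blast
      then have "J \<subseteq> K \<or> K \<subseteq> J" using C(2) by (auto simp: subset.chain_def)
      then obtain L where "L \<in> C" "x \<in> L" "y \<in> L" using JK by blast
      then show ?thesis
        using additive_subgroup.a_closed[OF ideal.axioms(1)[OF id]] by blast
    qed
    have "ideal (\<Union>C) R"
    proof (rule idealI')
      obtain J where "J \<in> C" using C(1) by blast
      then show "\<Union>C \<noteq> {}" using additive_subgroup.zero_closed[OF ideal.axioms(1)[OF id]] by blast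
      show "\<Union>C \<subseteq> carrier R" using ideal.Icarr[OF id] by blast
      show "a \<otimes> x \<in> \<Union>C" "x \<otimes> a \<in> \<Union>C" if "a \<in> carrier R" "x \<in> \<Union>C" for a x
        using that ideal.I_l_closed[OF id] ideal.I_r_closed[OF id] by blast+
    qed (rule sum)
    then show "\<Union>C \<in> ?A" using C by (auto simp: subset.chain_def)
  qed
  then obtain P where PA: "P \<in> ?A" and max: "\<forall>J\<in>?A. P \<subseteq> J \<longrightarrow> J = P" by (rule bexE)
  then have P: "ideal P R" "I \<subseteq> P" "\<one> \<notin> P" by simp_all
  have "maximalideal P R"
  proof (rule maximalidealI[OF P(1)])
    show "carrier R \<noteq> P" using P(3) by auto
    show "J = P \<or> J = carrier R" if J: "ideal J R" "P \<subseteq> J" for J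
    proof (cases "\<one> \<in> J")
      case True
      then show ?thesis by (rule disjI2[OF ideal_eq_carrier[OF J(1)]])
    next
      case False
      then have "J \<in> ?A" using J P(2) by auto
      then show ?thesis using max J(2) by simp
    qed
  qed
  then show ?thesis using that P(2) by (auto simp: MaxSpec_def)
qed

text \<open>If neither \<open>I\<close> nor \<open>J\<close> lies in \<open>P\<close>, both are
  comaximal with \<open>P\<close>: \<open>i \<oplus> v = \<one>\<close> and
  \<open>j \<oplus> w = \<one>\<close> with \<open>v\<close> and \<open>w\<close> in
  \<open>P\<close>. Then \<open>\<one>\<close> equals
  \<open>i \<otimes> j \<oplus> i \<otimes> w \<oplus> v\<close>, which lies in \<open>P\<close> as
  soon as \<open>i \<otimes> j\<close> does.\<close>

lemma MaxSpec_in_Spec: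
  fixes R (structure)
  assumes P: "P \<in> MaxSpec R" shows "P \<in> Spec R"
proof -
  interpret P: maximalideal P R using P by (simp add: MaxSpec_def)
  have sum: "\<exists>u\<in>I. \<exists>v\<in>P. u \<oplus> v = \<one>" if I: "ideal I R" "\<not> I \<subseteq> P" for I
  proof -
    have id: "ideal (I <+>\<^bsub>R\<^esub> P) R" by (rule P.add_ideals[OF I(1) P.is_ideal])
    have mem: "u \<oplus> v \<in> I <+>\<^bsub>R\<^esub> P" if "u \<in> I" "v \<in> P" for u v
      using that by (auto simp: set_add_def')
    have "I \<subseteq> I <+>\<^bsub>R\<^esub> P"
    proof
      show "u \<in> I <+>\<^bsub>R\<^esub> P" if "u \<in> I" for u
        using mem[OF that additive_subgroup.zero_closed[OF P.is_additive_subgroup]] ideal.Icarr[OF I(1) that] by simp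
    qed
    moreover have "P \<subseteq> I <+>\<^bsub>R\<^esub> P"
    proof
      show "v \<in> I <+>\<^bsub>R\<^esub> P" if "v \<in> P" for v
        using mem[OF additive_subgroup.zero_closed[OF ideal.axioms(1)[OF I(1)]] that] P.Icarr[OF that]
        by simp
    qed
    moreover have "I <+>\<^bsub>R\<^esub> P \<subseteq> carrier R" using ideal.Icarr[OF id] by (rule subsetI)
    ultimately have "I <+>\<^bsub>R\<^esub> P = carrier R"
      using P.I_maximal[OF id] I(2) by auto
    then have "\<one> \<in> I <+>\<^bsub>R\<^esub> P" by simp
    then obtain u v where "u \<in> I" "v \<in> P" "\<one> = u \<oplus> v" by (auto simp: set_add_def')
    then show ?thesis by (intro bexI[of _ u] bexI[of _ v]) simp_all
  qed
  have "I \<subseteq> P \<or> J \<subseteq> P" if IJ: "ideal I R" "ideal J R" "I \<cdot> J \<subseteq> P" for I J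
  proof (rule ccontr)
    assume "\<not> ?thesis"
    then have "\<not> I \<subseteq> P" "\<not> J \<subseteq> P" by auto
    then obtain i v j w where *: "i \<in> I" "v \<in> P" "i \<oplus> v = \<one>" "j \<in> J" "w \<in> P" "j \<oplus> w = \<one>"
      using sum[OF IJ(1)] sum[OF IJ(2)] by fast
    have c: "i \<in> carrier R" "v \<in> carrier R" "j \<in> carrier R" "w \<in> carrier R"
      using ideal.Icarr[OF IJ(1) *(1)] P.Icarr[OF *(2)] ideal.Icarr[OF IJ(2) *(4)] P.Icarr[OF *(5)] by auto
    have ij: "i \<otimes> j \<in> P" using IJ(3) * by (auto intro: ideal_prod.prod)
    have "i \<oplus> v = i \<otimes> (j \<oplus> w) \<oplus> v" using *(6) c by simp
    also have "\<dots> = i \<otimes> j \<oplus> i \<otimes> w \<oplus> v" using c by (simp add: P.r_distr)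
    also have "\<dots> \<in> P"
      using additive_subgroup.a_closed[OF P.is_additive_subgroup
        additive_subgroup.a_closed[OF P.is_additive_subgroup ij P.I_l_closed[OF *(5) c(1)]] *(2)] .
    finally have "\<one> \<in> P" using *(3) by simp
    then show False using ideal_eq_carrier[OF P.is_ideal] P.I_notcarr by blast
  qed
  then show ?thesis
    using P.is_ideal P.I_notcarr[symmetric] by (simp add: Spec_def)
qed

section \<open>Prime ideals, central elements and contraction to the centre\<close>

lemma SpecD:
  fixes R (structure)
  assumes "P \<in> Spec R"
  shows "ideal P R" "P \<noteq> carrier R"
    "ideal I R \<Longrightarrow> ideal J R \<Longrightarrow> I \<cdot> J \<subseteq> P \<Longrightarrow> I \<subseteq> P \<or> J \<subseteq> P"
  using assms by (simp_all add: Spec_def)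

text \<open>Primeness is a condition on ideals; a central \<open>s\<close> gives it elementwise.
  Both \<open>s R\<close> and the set of \<open>x\<close> with \<open>s \<otimes> x\<close> in
  \<open>P\<close> are two-sided because \<open>s\<close> is central, and their product lies in
  \<open>P\<close>.\<close>

lemma Spec_central:
  fixes R (structure)
  assumes "ring R" and P: "P \<in> Spec R" and s: "s \<in> centre R" and r: "r \<in> carrier R"
    and sr: "s \<otimes> r \<in> P"
  shows "s \<in> P \<or> r \<in> P"
proof -
  interpret ring R by fact
  interpret P: ideal P R using P by (simp add: Spec_def)
  have sR: "s \<in> carrier R" using s by (rule centreD)
  let ?I = "(\<lambda>x. s \<otimes> x) ` carrier R" and ?J = "{x \<in> carrier R. s \<otimes> x \<in> P}"
  have I: "ideal ?I R"
  proof (rule idealI')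
    show "a \<oplus> b \<in> ?I" if ab: "a \<in> ?I" "b \<in> ?I" for a b
    proof -
      from ab(1) obtain x where "x \<in> carrier R" "a = s \<otimes> x" by (elim imageE)
      moreover from ab(2) obtain y where "y \<in> carrier R" "b = s \<otimes> y" by (elim imageE)
      ultimately show ?thesis using sR by (intro image_eqI[of _ _ "x \<oplus> y"]) (auto simp: r_distr)
    qed
    show "a \<otimes> b \<in> ?I" "b \<otimes> a \<in> ?I" if a: "a \<in> carrier R" and "b \<in> ?I" for a b
    proof -
      from \<open>b \<in> ?I\<close> obtain x where x: "x \<in> carrier R" "b = s \<otimes> x" by (elim imageE)
      have "a \<otimes> b = s \<otimes> (a \<otimes> x)"
        using x a sR centreD(2)[OF s a] by (simp add: m_assoc[symmetric])
      then show "a \<otimes> b \<in> ?I" using x a by blast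
      have "b \<otimes> a = s \<otimes> (x \<otimes> a)" using x a sR by (simp add: m_assoc)
      then show "b \<otimes> a \<in> ?I" using x a by blast
    qed
  qed (use sR in auto)
  have J: "ideal ?J R"
  proof (rule idealI')
    show "?J \<noteq> {}" using r sr by blast
    show "a \<oplus> b \<in> ?J" if "a \<in> ?J" "b \<in> ?J" for a b
      using that sR by (simp add: r_distr)
    show "a \<otimes> b \<in> ?J" "b \<otimes> a \<in> ?J" if a: "a \<in> carrier R" and "b \<in> ?J" for a b
    proof -
      have b: "b \<in> carrier R" "s \<otimes> b \<in> P" using that by auto
      have "s \<otimes> (a \<otimes> b) = a \<otimes> (s \<otimes> b)"
        using b a sR centreD(2)[OF s a] by (simp add: m_assoc[symmetric])
      then show "a \<otimes> b \<in> ?J" using b a P.I_l_closed by simp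
      have "s \<otimes> (b \<otimes> a) = s \<otimes> b \<otimes> a" using b a sR by (simp add: m_assoc)
      then show "b \<otimes> a \<in> ?J" using b a P.I_r_closed by simp
    qed
  qed auto
  have "x \<in> P" if "x \<in> ?I \<cdot> ?J" for x
    using that
  proof (induction rule: ideal_prod.induct)
    case (prod i j)
    from prod(1) obtain x where x: "x \<in> carrier R" "i = s \<otimes> x" by (elim imageE)
    have "s \<otimes> x \<otimes> j = x \<otimes> (s \<otimes> j)"
      using x sR prod centreD(2)[OF s x(1)] by (simp add: m_assoc)
    then show ?case using x prod P.I_l_closed by simp
  qed (rule additive_subgroup.a_closed[OF P.is_additive_subgroup])
  then have "?I \<subseteq> P \<or> ?J \<subseteq> P" by (intro SpecD(3)[OF P I J] subsetI)
  then show ?thesis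
  proof
    assume "?I \<subseteq> P"
    then have "s \<otimes> \<one> \<in> P" by blast
    then show ?thesis using sR by simp
  next
    assume "?J \<subseteq> P"
    then show ?thesis using r sr by blast
  qed
qed

lemma one_in_centre: "ring R \<Longrightarrow> \<one>\<^bsub>R\<^esub> \<in> centre R"
  using cring_centre_ring[THEN cring.axioms(1), THEN ring.ring_simprules(6)] by fastforce

lemma ideal_centre_contraction:
  fixes R (structure)
  assumes "ring R" "ideal P R"
  shows "ideal (P \<inter> centre R) (centre_ring R)"
proof -
  interpret Z: cring "centre_ring R" by (rule cring_centre_ring) fact
  interpret P: ideal P R by fact
  show ?thesis
  proof (rule Z.idealI')
    have "\<zero> \<in> P \<inter> centre R"
      using additive_subgroup.zero_closed[OF P.is_additive_subgroup] Z.zero_closed by simp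
    then show "P \<inter> centre R \<noteq> {}" by blast
    fix a x assume "a \<in> carrier (centre_ring R)" "x \<in> P \<inter> centre R"
    then show "a \<otimes>\<^bsub>centre_ring R\<^esub> x \<in> P \<inter> centre R" "x \<otimes>\<^bsub>centre_ring R\<^esub> a \<in> P \<inter> centre R"
      using P.I_l_closed P.I_r_closed centreD(1)[of a R] Z.m_closed[of a x] Z.m_closed[of x a] by auto
  next
    fix x y assume "x \<in> P \<inter> centre R" "y \<in> P \<inter> centre R"
    then show "x \<oplus>\<^bsub>centre_ring R\<^esub> y \<in> P \<inter> centre R"
      using additive_subgroup.a_closed[OF P.is_additive_subgroup] Z.a_closed[of x y] by auto
  qed auto
qed

lemma primeideal_centre_contraction:
  fixes R (structure)
  assumes "ring R" "P \<in> Spec R"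
  shows "primeideal (P \<inter> centre R) (centre_ring R)"
proof (rule primeidealI)
  have P: "ideal P R" "P \<noteq> carrier R" using assms(2) by (auto simp: Spec_def)
  show "ideal (P \<inter> centre R) (centre_ring R)" by (rule ideal_centre_contraction[OF assms(1) P(1)])
  show "cring (centre_ring R)" by (rule cring_centre_ring[OF assms(1)])
  show "carrier (centre_ring R) \<noteq> P \<inter> centre R"
    using one_in_centre[OF assms(1)] ideal_eq_carrier[OF P(1)] P(2) by auto
  show "a \<in> P \<inter> centre R \<or> b \<in> P \<inter> centre R"
    if "a \<in> carrier (centre_ring R)" "b \<in> carrier (centre_ring R)" "a \<otimes>\<^bsub>centre_ring R\<^esub> b \<in> P \<inter> centre R" for a b
    using Spec_central[OF assms(1,2), of a b] that centreD(1)[of b R] by auto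
qed

text \<open>\<open>?I\<close> is \<open>c R + P\<close>, written through congruences modulo
  \<open>P\<close>; centrality of \<open>c\<close> makes it two-sided, and it contains both
  \<open>P\<close> and \<open>c\<close>. It is applied to \<open>R\<close> and to its
  centre.\<close>

lemma maximalideal_central_inverse_mod:
  fixes R (structure)
  assumes P: "maximalideal P R" and c: "c \<in> centre R" "c \<notin> P"
  shows "\<exists>r\<in>carrier R. c \<otimes> r \<ominus> \<one> \<in> P"
proof -
  interpret P: maximalideal P R by fact
  note Pa = additive_subgroup.a_closed[OF P.is_additive_subgroup]
  have cR: "c \<in> carrier R" using c(1) by (rule centreD)
  let ?I = "{x \<in> carrier R. \<exists>r\<in>carrier R. c \<otimes> r \<ominus> x \<in> P}"
  have I: "ideal ?I R"
  proof (rule P.idealI')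
    have "c \<otimes> \<zero> \<ominus> \<zero> \<in> P" using cR by (simp add: P.minus_eq)
    then show "?I \<noteq> {}" by blast
    fix x y assume "x \<in> ?I" "y \<in> ?I"
    then obtain r s where *: "x \<in> carrier R" "y \<in> carrier R" "r \<in> carrier R" "s \<in> carrier R"
      "c \<otimes> r \<ominus> x \<in> P" "c \<otimes> s \<ominus> y \<in> P" by blast
    have "c \<otimes> (r \<oplus> s) \<ominus> (x \<oplus> y) = (c \<otimes> r \<ominus> x) \<oplus> (c \<otimes> s \<ominus> y)"
      using * cR by (simp add: P.minus_eq P.r_distr P.minus_add P.a_ac)
    then have "c \<otimes> (r \<oplus> s) \<ominus> (x \<oplus> y) \<in> P" using Pa[OF *(5,6)] by simp
    then show "x \<oplus> y \<in> ?I" using * by blast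
  next
    fix a x assume a: "a \<in> carrier R" and "x \<in> ?I"
    then obtain r where *: "x \<in> carrier R" "r \<in> carrier R" "c \<otimes> r \<ominus> x \<in> P" by blast
    have "c \<otimes> (a \<otimes> r) = a \<otimes> (c \<otimes> r)"
      using * a cR centreD(2)[OF c(1) a] by (simp add: P.m_assoc[symmetric])
    then have "c \<otimes> (a \<otimes> r) \<ominus> (a \<otimes> x) = a \<otimes> (c \<otimes> r \<ominus> x)"
      using * a cR by (simp add: P.minus_eq P.r_distr P.r_minus)
    then have "c \<otimes> (a \<otimes> r) \<ominus> (a \<otimes> x) \<in> P" using P.I_l_closed[OF *(3) a] by simp
    then show "a \<otimes> x \<in> ?I" using * a by blast
    have "c \<otimes> (r \<otimes> a) \<ominus> (x \<otimes> a) = (c \<otimes> r \<ominus> x) \<otimes> a"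
      using * a cR by (simp add: P.minus_eq P.l_distr P.l_minus P.m_assoc)
    then have "c \<otimes> (r \<otimes> a) \<ominus> (x \<otimes> a) \<in> P" using P.I_r_closed[OF *(3) a] by simp
    then show "x \<otimes> a \<in> ?I" using * a by blast
  qed auto
  have "P \<subseteq> ?I"
  proof
    fix x assume x: "x \<in> P"
    have "c \<otimes> \<zero> \<ominus> x = \<ominus> x" using cR P.Icarr[OF x] by (simp add: P.minus_eq)
    then have "c \<otimes> \<zero> \<ominus> x \<in> P"
      using additive_subgroup.a_inv_closed[OF P.is_additive_subgroup x] by simp
    then show "x \<in> ?I" using P.Icarr[OF x] by blast
  qed
  moreover have "c \<in> ?I"
  proof -
    have "c \<otimes> \<one> \<ominus> c \<in> P" using cR by (simp add: P.minus_eq P.r_neg)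
    then show ?thesis using cR by blast
  qed
  ultimately have "?I = carrier R" using P.I_maximal[OF I] c(2) by blast
  then have "\<one> \<in> ?I" by simp
  then show ?thesis by blast
qed

lemma maximalidealI_inverse_mod:
  fixes Z (structure)
  assumes "cring Z" and p: "ideal p Z" "p \<noteq> carrier Z"
    and inv: "\<And>c. c \<in> carrier Z \<Longrightarrow> c \<notin> p \<Longrightarrow> \<exists>z\<in>carrier Z. c \<otimes> z \<ominus> \<one> \<in> p"
  shows "maximalideal p Z"
proof (rule maximalidealI[OF p(1)])
  interpret cring Z by fact
  show "carrier Z \<noteq> p" using p(2) by blast
  fix J assume J: "ideal J Z" "p \<subseteq> J" "J \<subseteq> carrier Z"
  interpret J: ideal J Z by fact
  show "J = p \<or> J = carrier Z"
  proof (rule disjCI)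
    assume "J \<noteq> carrier Z"
    have False if c: "c \<in> J" "c \<notin> p" for c
    proof -
      obtain z where z: "z \<in> carrier Z" "c \<otimes> z \<ominus> \<one> \<in> p" using inv[of c] c J(3) by blast
      have cc: "c \<in> carrier Z" using c J(3) by blast
      \<comment> \<open>\<open>\<one>\<close> is the difference of \<open>c \<otimes> z\<close>,
        which lies in \<open>J\<close> through \<open>c\<close>, and
        \<open>c \<otimes> z \<ominus> \<one>\<close>, which lies in \<open>p\<close>.\<close>
      have "c \<otimes> z \<oplus> (\<ominus> (c \<otimes> z \<ominus> \<one>)) \<in> J"
        by (intro additive_subgroup.a_closed additive_subgroup.a_inv_closed
          J.is_additive_subgroup J.I_r_closed[OF c(1) z(1)] subsetD[OF J(2) z(2)])
      moreover have "c \<otimes> z \<oplus> (\<ominus> (c \<otimes> z \<ominus> \<one>)) = \<one>"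
        using cc z(1) by (simp add: minus_eq minus_add a_assoc[symmetric] r_neg)
      ultimately show False using ideal_eq_carrier[OF J(1)] \<open>J \<noteq> carrier Z\<close> by simp
    qed
    then show "J = p" using J(2) by blast
  qed
qed

lemma extended_ideal_subset:
  fixes R (structure)
  assumes "ideal P R" "p \<subseteq> P"
  shows "extended_ideal R p \<subseteq> P"
proof
  interpret P: ideal P R by fact
  show "x \<in> P" if "x \<in> extended_ideal R p" for x
    using that unfolding extended_ideal_def
  proof (induction rule: ideal_prod.induct)
    case (prod i j)
    then show ?case using assms(2) P.I_l_closed[of j i] by blast
  qed (rule additive_subgroup.a_closed[OF P.is_additive_subgroup])
qed

section \<open>Central localizations\<close>

text \<open>\<open>T\<close> is the localization of \<open>R/Rp\<close> at the nonzero elements of \<open>Z(R)/p\<close>.\<close>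

locale central_localization =
  fixes R :: "('a, 'k) ring_scheme" (structure) and p :: "'a set" and T :: "('b, 'l) ring_scheme"
    and \<phi> :: "'a \<Rightarrow> 'b"
  assumes ring_R: "ring R" and ring_T: "ring T" and prime: "primeideal p (centre_ring R)"
    and hom: "\<phi> \<in> ring_hom R T"
    and unit: "s \<in> centre R \<Longrightarrow> s \<notin> p \<Longrightarrow> \<phi> s \<in> Units T"
    and fraction: "t \<in> carrier T \<Longrightarrow> \<exists>s\<in>centre R - p. \<exists>r\<in>carrier R. \<phi> s \<otimes>\<^bsub>T\<^esub> t = \<phi> r"
    and zero_iff: "r \<in> carrier R \<Longrightarrow> \<phi> r = \<zero>\<^bsub>T\<^esub> \<longleftrightarrow> r \<in> extended_ideal R p"
begin

sublocale R: ring R by (rule ring_R)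
sublocale T: ring T by (rule ring_T)

lemma ideal_p: "ideal p (centre_ring R)" using prime by (rule primeideal.axioms)

sublocale Rp: ideal "extended_ideal R p" R by (rule ideal_extended_ideal[OF ring_R ideal_p])

lemmas hom_simps = ring_hom_closed[OF hom] ring_hom_mult[OF hom] ring_hom_add[OF hom]
  ring_hom_one[OF hom] ring_hom_minus[OF ring_R ring_T hom]

lemma eq_iff:
  assumes "r \<in> carrier R" "r' \<in> carrier R"
  shows "\<phi> r = \<phi> r' \<longleftrightarrow> r \<ominus> r' \<in> extended_ideal R p"
  using zero_iff[of "r \<ominus> r'"] assms by (simp add: hom_simps)

lemma denominators:
  "s \<in> centre R - p \<Longrightarrow> s' \<in> centre R - p \<Longrightarrow> s \<otimes> s' \<in> centre R - p"
  "\<one> \<in> centre R - p"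
proof -
  interpret p: primeideal p "centre_ring R" by (rule prime)
  show "s \<in> centre R - p \<Longrightarrow> s' \<in> centre R - p \<Longrightarrow> s \<otimes> s' \<in> centre R - p"
    using p.I_prime[of s s'] p.m_closed[of s s'] by auto
  show "\<one> \<in> centre R - p"
    using p.one_imp_carrier p.I_notcarr p.one_closed by auto
qed

text \<open>Up to the unit \<open>\<phi> u\<close>, \<open>t\<close> is the image of an element
  \<open>r\<close> of \<open>R\<close>, and \<open>s\<close> commutes with both \<open>u\<close> and
  \<open>r\<close>; cancelling \<open>\<phi> u\<close> gives the claim.\<close>

lemma denominator_central:
  assumes s: "s \<in> centre R" and t: "t \<in> carrier T"
  shows "\<phi> s \<otimes>\<^bsub>T\<^esub> t = t \<otimes>\<^bsub>T\<^esub> \<phi> s"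
proof -
  obtain u r where u: "u \<in> centre R - p" and r: "r \<in> carrier R" "\<phi> u \<otimes>\<^bsub>T\<^esub> t = \<phi> r"
    using fraction[OF t] by blast
  have c: "s \<in> carrier R" "u \<in> carrier R" using s u by (auto simp: centreD(1))
  have "\<phi> u \<otimes>\<^bsub>T\<^esub> (\<phi> s \<otimes>\<^bsub>T\<^esub> t) = \<phi> (u \<otimes> s) \<otimes>\<^bsub>T\<^esub> t"
    using c t by (simp add: hom_simps T.m_assoc)
  also have "\<dots> = \<phi> (s \<otimes> u) \<otimes>\<^bsub>T\<^esub> t" using centreD(2)[OF s c(2)] by simp
  also have "\<dots> = \<phi> (s \<otimes> r)" using c t r by (simp add: hom_simps T.m_assoc)
  also have "\<dots> = \<phi> u \<otimes>\<^bsub>T\<^esub> t \<otimes>\<^bsub>T\<^esub> \<phi> s" using c r centreD(2)[OF s r(1)] by (simp add: hom_simps)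
  also have "\<dots> = \<phi> u \<otimes>\<^bsub>T\<^esub> (t \<otimes>\<^bsub>T\<^esub> \<phi> s)" using c t by (simp add: hom_simps T.m_assoc)
  finally show ?thesis
    using T.Units_l_cancel[OF unit] u c t by (simp add: hom_simps)
qed

text \<open>For a left ideal \<open>I\<close> this is the left ideal of \<open>T\<close> generated
  by its image, given explicitly as the fractions with numerator in \<open>I\<close>.\<close>

definition extension :: "'a set \<Rightarrow> 'b set" where
  "extension I = {t \<in> carrier T. \<exists>s\<in>centre R - p. \<exists>r\<in>I. \<phi> s \<otimes>\<^bsub>T\<^esub> t = \<phi> r}"

lemma left_ideal_extension:
  assumes I: "left_ideal I R"
  shows "left_ideal (extension I) T"
proof (rule T.left_idealI)
  note D = R.left_idealD[OF I]
  have "\<phi> \<one> \<otimes>\<^bsub>T\<^esub> \<zero>\<^bsub>T\<^esub> = \<phi> \<zero>" using ring_hom_zero[OF hom ring_R ring_T] by (simp add: hom_simps)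
  then show "extension I \<noteq> {}" using denominators(2) D(2) by (auto simp: extension_def)
  fix t assume "t \<in> extension I"
  then obtain s r where s: "s \<in> centre R - p" "s \<in> carrier R" and r: "r \<in> I" "r \<in> carrier R"
    and t: "t \<in> carrier T" "\<phi> s \<otimes>\<^bsub>T\<^esub> t = \<phi> r"
    using D(1) by (auto simp: extension_def centreD(1))
  show "t \<oplus>\<^bsub>T\<^esub> t' \<in> extension I" if "t' \<in> extension I" for t'
  proof -
    from that obtain s' r' where s': "s' \<in> centre R - p" "s' \<in> carrier R" and r': "r' \<in> I" "r' \<in> carrier R"
      and t': "t' \<in> carrier T" "\<phi> s' \<otimes>\<^bsub>T\<^esub> t' = \<phi> r'"
      using D(1) by (auto simp: extension_def centreD(1))
    have "\<phi> (s \<otimes> s') \<otimes>\<^bsub>T\<^esub> (t \<oplus>\<^bsub>T\<^esub> t') = \<phi> (s' \<otimes> s) \<otimes>\<^bsub>T\<^esub> t \<oplus>\<^bsub>T\<^esub> \<phi> (s \<otimes> s') \<otimes>\<^bsub>T\<^esub> t'"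
      using s s' t t' centreD(2)[of s R s'] by (simp add: T.r_distr hom_simps)
    also have "\<dots> = \<phi> (s' \<otimes> r \<oplus> s \<otimes> r')"
      using s s' r r' t t' by (simp add: hom_simps T.m_assoc)
    finally show ?thesis
      using denominators(1)[OF s(1) s'(1)] D(3)[OF D(4)[OF s'(2) r(1)] D(4)[OF s(2) r'(1)]] t t'
      unfolding extension_def by blast
  qed
  show "a \<otimes>\<^bsub>T\<^esub> t \<in> extension I" if a: "a \<in> carrier T" for a
  proof -
    obtain s' r' where s': "s' \<in> centre R - p" and r': "r' \<in> carrier R" "\<phi> s' \<otimes>\<^bsub>T\<^esub> a = \<phi> r'"
      using fraction[OF a] by blast
    have c: "s' \<in> carrier R" using s' by (auto simp: centreD(1))
    have "\<phi> (s' \<otimes> s) \<otimes>\<^bsub>T\<^esub> (a \<otimes>\<^bsub>T\<^esub> t) = \<phi> s' \<otimes>\<^bsub>T\<^esub> (\<phi> s \<otimes>\<^bsub>T\<^esub> a) \<otimes>\<^bsub>T\<^esub> t"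
      using c s t a by (simp add: hom_simps T.m_assoc)
    \<comment> \<open>\<open>\<phi> s\<close> is moved past \<open>a\<close>, which is where
      centrality of denominators in \<open>T\<close> enters.\<close>
    also have "\<dots> = \<phi> s' \<otimes>\<^bsub>T\<^esub> a \<otimes>\<^bsub>T\<^esub> (\<phi> s \<otimes>\<^bsub>T\<^esub> t)"
      using c s t(1) a denominator_central[of s a] by (simp add: hom_simps T.m_assoc)
    also have "\<dots> = \<phi> (r' \<otimes> r)" using r' r t by (simp add: hom_simps)
    finally show ?thesis
      using denominators(1)[OF s' s(1)] D(4)[OF r'(1) r(1)] t a unfolding extension_def by blast
  qed
qed (auto simp: extension_def)

lemma ideal_extension:
  assumes I: "ideal I R"
  shows "ideal (extension I) T"
proof -
  interpret I: ideal I R by fact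
  note D = T.left_idealD[OF left_ideal_extension[OF R.ideal_imp_left_ideal[OF I]]]
  show ?thesis
  proof (rule T.idealI')
    fix a t assume a: "a \<in> carrier T" and "t \<in> extension I"
    then obtain s r where s: "s \<in> centre R - p" "s \<in> carrier R" and r: "r \<in> I" "r \<in> carrier R"
      and t: "t \<in> carrier T" "\<phi> s \<otimes>\<^bsub>T\<^esub> t = \<phi> r"
      using I.Icarr by (auto simp: extension_def centreD(1))
    obtain s' r' where s': "s' \<in> centre R - p" and r': "r' \<in> carrier R" "\<phi> s' \<otimes>\<^bsub>T\<^esub> a = \<phi> r'"
      using fraction[OF a] by blast
    have c: "s' \<in> carrier R" using s' by (auto simp: centreD(1))
    have "\<phi> (s \<otimes> s') \<otimes>\<^bsub>T\<^esub> (t \<otimes>\<^bsub>T\<^esub> a) = \<phi> s \<otimes>\<^bsub>T\<^esub> (\<phi> s' \<otimes>\<^bsub>T\<^esub> t) \<otimes>\<^bsub>T\<^esub> a"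
      using c s t a by (simp add: hom_simps T.m_assoc)
    also have "\<dots> = \<phi> s \<otimes>\<^bsub>T\<^esub> t \<otimes>\<^bsub>T\<^esub> (\<phi> s' \<otimes>\<^bsub>T\<^esub> a)"
      using c s s' t(1) a denominator_central[of s' t] by (simp add: hom_simps T.m_assoc)
    also have "\<dots> = \<phi> (r \<otimes> r')" using r' r t by (simp add: hom_simps)
    finally show "t \<otimes>\<^bsub>T\<^esub> a \<in> extension I"
      using denominators(1)[OF s(1) s'] I.I_r_closed[OF r(1) r'(1)] t a unfolding extension_def by blast
  qed (use D in auto)
qed

lemma extension_contains:
  assumes "r \<in> I" "r \<in> carrier R" shows "\<phi> r \<in> extension I"
proof -
  have "\<phi> \<one> \<otimes>\<^bsub>T\<^esub> \<phi> r = \<phi> r" using assms by (simp add: hom_simps)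
  then show ?thesis using assms denominators(2) hom_simps(1) unfolding extension_def by blast
qed

text \<open>If the extension of \<open>P\<close> contained the identity, some denominator
  \<open>s\<close> would be congruent modulo \<open>Rp\<close> to an element of \<open>P\<close>,
  hence lie in \<open>P\<close> and so in \<open>p\<close>. Simplicity of \<open>T\<close> makes the
  extension zero, that is, \<open>P\<close> maps to zero in \<open>T\<close>.\<close>

lemma Spec_eq_extended_ideal:
  assumes T: "simple_ring T" and P: "P \<in> Spec R" "P \<inter> centre R = p"
  shows "P = extended_ideal R p"
proof -
  interpret P: ideal P R using P by (simp add: Spec_def)
  have Rp: "extended_ideal R p \<subseteq> P" by (rule extended_ideal_subset[OF P.is_ideal]) (use P(2) in blast)
  have "extension P \<noteq> carrier T"
  proof
    assume "extension P = carrier T"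
    then have "\<one>\<^bsub>T\<^esub> \<in> extension P" by simp
    then obtain s r where s: "s \<in> centre R - p" and r: "r \<in> P" "\<phi> s \<otimes>\<^bsub>T\<^esub> \<one>\<^bsub>T\<^esub> = \<phi> r"
      by (auto simp: extension_def)
    have c: "s \<in> carrier R" "r \<in> carrier R" using s r P.Icarr by (auto simp: centreD(1))
    have "s \<ominus> r \<in> P" using eq_iff[OF c] r c Rp by (auto simp: hom_simps)
    then have "(s \<ominus> r) \<oplus> r \<in> P"
      using r(1) by (rule additive_subgroup.a_closed[OF P.is_additive_subgroup])
    then have "s \<in> P" using c by (simp add: R.minus_eq R.a_assoc R.l_neg)
    then show False using s P(2) by blast
  qed
  then have e: "extension P = {\<zero>\<^bsub>T\<^esub>}"
    using T ideal_extension[OF P.is_ideal] by (auto simp: simple_ring_def)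
  have "P \<subseteq> extended_ideal R p"
  proof
    fix r assume r: "r \<in> P"
    then show "r \<in> extended_ideal R p"
      using extension_contains[OF r P.Icarr[OF r]] e zero_iff P.Icarr by auto
  qed
  with Rp show ?thesis by blast
qed

text \<open>A nonzero vector \<open>y\<close> killed by \<open>s\<close> would generate
  \<open>M\<close>, and \<open>s a y = a s y = 0\<close> would put \<open>s\<close> into the
  annihilator.\<close>

lemma central_injective:
  assumes M: "simple_left_module R M" and s: "s \<in> centre R" "s \<notin> annihilator R M"
    and y: "y \<in> carrier M" "s \<odot>\<^bsub>M\<^esub> y = \<zero>\<^bsub>M\<^esub>"
  shows "y = \<zero>\<^bsub>M\<^esub>"
proof (rule ccontr)
  assume y0: "y \<noteq> \<zero>\<^bsub>M\<^esub>"
  interpret M: left_module R M using M by (simp add: simple_left_module_def)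
  have sR: "s \<in> carrier R" using s(1) by (rule centreD)
  have "s \<odot>\<^bsub>M\<^esub> x = \<zero>\<^bsub>M\<^esub>" if x: "x \<in> carrier M" for x
  proof -
    obtain a where a: "a \<in> carrier R" "a \<odot>\<^bsub>M\<^esub> y = x"
      using simple_left_module_generated[OF M y(1) y0 x] .
    have "s \<odot>\<^bsub>M\<^esub> x = (a \<otimes> s) \<odot>\<^bsub>M\<^esub> y"
      using a sR y(1) centreD(2)[OF s(1) a(1)] M.smult_assoc1[of s a y] by simp
    also have "\<dots> = \<zero>\<^bsub>M\<^esub>" using a sR y by (simp add: M.smult_assoc1)
    finally show ?thesis .
  qed
  then show False using s(2) sR by (simp add: annihilator_def)
qed

text \<open>Among the extensions of annihilators of finite sets there is a minimal one, from
  \<open>F\<close>. Adding a vector \<open>x\<close> to \<open>F\<close> does not change it, so for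
  each \<open>r\<close> killing \<open>F\<close> there is a denominator \<open>s\<close> such that
  \<open>s \<otimes> r\<close> is congruent modulo \<open>Rp\<close> to some \<open>r'\<close> that
  kills \<open>x\<close>. Hence \<open>s\<close> kills \<open>r x\<close>, and injectivity of
  \<open>s\<close> on \<open>M\<close> gives \<open>r x = 0\<close>.\<close>

lemma finite_annihilator:
  assumes T: "artinian_ring T" and M: "simple_left_module R M" and p: "annihilator R M \<inter> centre R = p"
  obtains F where "finite F" "F \<subseteq> carrier M" "annihilator_of R M F = annihilator R M"
proof -
  interpret M: left_module R M using M by (simp add: simple_left_module_def)
  interpret P: ideal "annihilator R M" R by (rule ideal_annihilator[OF M.left_module_axioms])
  have Rp: "extended_ideal R p \<subseteq> annihilator R M"
    by (rule extended_ideal_subset[OF P.is_ideal]) (use p in blast)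
  let ?E = "\<lambda>F. extension (annihilator_of R M F)"
  obtain E where E: "E \<in> ?E ` {F. finite F \<and> F \<subseteq> carrier M}"
    and min: "\<And>J. J \<in> ?E ` {F. finite F \<and> F \<subseteq> carrier M} \<Longrightarrow> J \<subseteq> E \<Longrightarrow> J = E"
  proof (rule artinian_ring_minimal[OF T])
    show "?E {} \<in> ?E ` {F. finite F \<and> F \<subseteq> carrier M}" by blast
    show "left_ideal I T" if "I \<in> ?E ` {F. finite F \<and> F \<subseteq> carrier M}" for I
      using that left_ideal_extension M.left_ideal_annihilator_of by blast
  qed auto
  then obtain F where F: "finite F" "F \<subseteq> carrier M" "E = ?E F" by blast
  have kill: "r \<odot>\<^bsub>M\<^esub> x = \<zero>\<^bsub>M\<^esub>" if r: "r \<in> annihilator_of R M F" and x: "x \<in> carrier M" for r x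
  proof -
    have "annihilator_of R M (insert x F) \<subseteq> annihilator_of R M F" by (auto simp: annihilator_of_def)
    then have "?E (insert x F) \<subseteq> E" unfolding F(3) extension_def by blast
    moreover have "?E (insert x F) \<in> ?E ` {F. finite F \<and> F \<subseteq> carrier M}" using F x by blast
    ultimately have e: "?E (insert x F) = ?E F" using min F(3) by blast
    have rR: "r \<in> carrier R" using r by (simp add: annihilator_of_def)
    have "\<phi> r \<in> ?E (insert x F)" unfolding e by (rule extension_contains[OF r rR])
    then obtain s r' where s: "s \<in> centre R - p" and r': "r' \<in> annihilator_of R M (insert x F)"
      and eq: "\<phi> s \<otimes>\<^bsub>T\<^esub> \<phi> r = \<phi> r'" by (auto simp: extension_def)
    have c: "s \<in> carrier R" "r' \<in> carrier R" using s r' by (auto simp: centreD(1) annihilator_of_def)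
    have "\<phi> (s \<otimes> r) = \<phi> r'" using eq c rR by (simp add: hom_simps)
    then have "s \<otimes> r \<ominus> r' \<in> annihilator R M"
      using eq_iff[of "s \<otimes> r" r'] c rR subsetD[OF Rp] by simp
    then have "(s \<otimes> r \<ominus> r') \<odot>\<^bsub>M\<^esub> x = \<zero>\<^bsub>M\<^esub>" using x unfolding annihilator_def by blast
    then have "(s \<otimes> r) \<odot>\<^bsub>M\<^esub> x = r' \<odot>\<^bsub>M\<^esub> x"
      by (rule iffD1[OF M.smult_l_diff_eq_zero[OF R.m_closed[OF c(1) rR] c(2) x]])
    then have "s \<odot>\<^bsub>M\<^esub> (r \<odot>\<^bsub>M\<^esub> x) = \<zero>\<^bsub>M\<^esub>"
      using r' c rR x by (simp add: M.smult_assoc1 annihilator_of_def)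
    then show ?thesis
      using central_injective[OF M, of s "r \<odot>\<^bsub>M\<^esub> x"] s p rR x by auto
  qed
  have "annihilator_of R M F = annihilator R M"
  proof (intro equalityI subsetI)
    fix r assume r: "r \<in> annihilator_of R M F"
    then have "r \<in> carrier R" by (simp add: annihilator_of_def)
    then show "r \<in> annihilator R M" unfolding annihilator_def using kill[OF r] by blast
  next
    fix r assume "r \<in> annihilator R M"
    then show "r \<in> annihilator_of R M F"
      using F(2) unfolding annihilator_def annihilator_of_def by blast
  qed
  with F(1,2) show ?thesis by (rule that)
qed

text \<open>Interpolation yields \<open>r\<close> with \<open>c r x = x\<close> on a finite set that determines the annihilator,
  so \<open>c\<close> is invertible modulo \<open>Rp\<close>.\<close>

lemma central_inverse_mod_annihilator:
  assumes T: "artinian_ring T" and M: "simple_left_module R M" and p: "annihilator R M \<inter> centre R = p"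
    and c: "c \<in> centre R - p"
  obtains r where "r \<in> carrier R" "c \<otimes> r \<ominus> \<one> \<in> annihilator R M"
proof -
  interpret M: left_module R M using M by (simp add: simple_left_module_def)
  have cR: "c \<in> carrier R" using c by (auto simp: centreD(1))
  obtain G where G: "finite G" "G \<subseteq> carrier M" "annihilator_of R M G = annihilator R M"
    using finite_annihilator[OF T M p] .
  obtain F where F: "finite F" "F \<subseteq> carrier M" "annihilator_of R M F = annihilator R M"
    and interp: "\<And>y. y \<in> F \<rightarrow> carrier M \<Longrightarrow> \<exists>r\<in>carrier R. \<forall>x\<in>F. r \<odot>\<^bsub>M\<^esub> x = y x"
    by (rule simple_left_module_interpolation[OF M G], rule that)
  \<comment> \<open>\<open>c\<close> maps \<open>M\<close> onto itself: \<open>c y\<close> is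
    nonzero for some \<open>y\<close> and so generates \<open>M\<close>, and scalars can be moved
    past the central \<open>c\<close>.\<close>
  have "\<exists>y\<in>carrier M. c \<odot>\<^bsub>M\<^esub> y = x" if x: "x \<in> carrier M" for x
  proof -
    obtain y where y: "y \<in> carrier M" "c \<odot>\<^bsub>M\<^esub> y \<noteq> \<zero>\<^bsub>M\<^esub>"
      using c p cR by (auto simp: annihilator_def)
    obtain a where a: "a \<in> carrier R" "a \<odot>\<^bsub>M\<^esub> (c \<odot>\<^bsub>M\<^esub> y) = x"
      using simple_left_module_generated[OF M M.smult_closed[OF cR y(1)] y(2) x] .
    have "c \<odot>\<^bsub>M\<^esub> (a \<odot>\<^bsub>M\<^esub> y) = x"
      using a cR y(1) c centreD(2)[of c R a] by (simp add: M.smult_assoc1[symmetric])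
    then show ?thesis using a(1) y(1) by blast
  qed
  then obtain y where y: "\<And>x. x \<in> carrier M \<Longrightarrow> y x \<in> carrier M \<and> c \<odot>\<^bsub>M\<^esub> y x = x" by metis
  obtain r where r: "r \<in> carrier R" "\<forall>x\<in>F. r \<odot>\<^bsub>M\<^esub> x = y x"
    using interp[of y] y F(2) by blast
  have "c \<otimes> r \<ominus> \<one> \<in> annihilator_of R M F"
    unfolding annihilator_of_def
  proof (intro CollectI conjI ballI)
    fix x assume x: "x \<in> F"
    then have xM: "x \<in> carrier M" using F(2) by blast
    have "(c \<otimes> r) \<odot>\<^bsub>M\<^esub> x = \<one> \<odot>\<^bsub>M\<^esub> x" using x xM r cR y[OF xM] by (simp add: M.smult_assoc1)
    then show "(c \<otimes> r \<ominus> \<one>) \<odot>\<^bsub>M\<^esub> x = \<zero>\<^bsub>M\<^esub>"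
      using M.smult_l_diff_eq_zero[OF _ _ xM, of "c \<otimes> r" "\<one>"] cR r(1) by simp
  qed (use cR r(1) in auto)
  then show ?thesis using that r(1) F(3) by blast
qed

text \<open>Modulo a maximal \<open>p\<close> the denominators are invertible in the centre already,
  so no new elements arise: \<open>t\<close> equals \<open>\<phi> (z \<otimes> r)\<close>, with
  \<open>z\<close> inverse to the denominator modulo \<open>p\<close>.\<close>

lemma surjective_if_maximal:
  assumes "maximalideal p (centre_ring R)"
  shows "\<phi> ` carrier R = carrier T"
proof
  show "\<phi> ` carrier R \<subseteq> carrier T" using hom_simps(1) by blast
  show "carrier T \<subseteq> \<phi> ` carrier R"
  proof
    fix t assume t: "t \<in> carrier T"
    obtain s r where s: "s \<in> centre R - p" and r: "r \<in> carrier R" "\<phi> s \<otimes>\<^bsub>T\<^esub> t = \<phi> r"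
      using fraction[OF t] by blast
    \<comment> \<open>The inverse modulo a maximal ideal is stated for central elements of an
      arbitrary ring; here that ring is the centre, where every element is central.\<close>
    have "s \<in> centre (centre_ring R)"
      using s cring.cring_simprules(14)[OF cring_centre_ring[OF ring_R]] by (auto simp: centre_def[of "centre_ring R"])
    then have "\<exists>z\<in>centre R. s \<otimes> z \<ominus>\<^bsub>centre_ring R\<^esub> \<one> \<in> p"
      using maximalideal_central_inverse_mod[OF assms, of s] s by simp
    then obtain z where z: "z \<in> centre R" "s \<otimes> z \<ominus>\<^bsub>centre_ring R\<^esub> \<one> \<in> p"
      by blast
    have "s \<otimes> z \<in> centre R"
      using ring.ring_simprules(5)[OF cring.axioms(1)[OF cring_centre_ring[OF ring_R]], of s z] s z(1) by simp
    then have z': "s \<otimes> z \<ominus> \<one> \<in> p"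
      using z(2) R.centre_ring_minus[OF _ one_in_centre[OF ring_R]] by simp
    have c: "s \<in> carrier R" "z \<in> carrier R" using s z by (auto simp: centreD(1))
    have "\<one> \<otimes> (s \<otimes> z \<ominus> \<one>) \<in> extended_ideal R p"
      unfolding extended_ideal_def using z' by (intro ideal_prod.prod) auto
    then have "\<phi> (s \<otimes> z) = \<phi> \<one>" using eq_iff[of "s \<otimes> z" "\<one>"] c by simp
    moreover have "\<phi> (s \<otimes> z) = \<phi> (z \<otimes> s)" using s c centreD(2)[of s R z] by simp
    ultimately have "\<phi> z \<otimes>\<^bsub>T\<^esub> \<phi> s = \<one>\<^bsub>T\<^esub>" using c by (simp add: hom_simps)
    then have "t = \<phi> z \<otimes>\<^bsub>T\<^esub> \<phi> s \<otimes>\<^bsub>T\<^esub> t" using t by simp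
    also have "\<dots> = \<phi> (z \<otimes> r)" using c r t by (simp add: hom_simps T.m_assoc)
    finally show "t \<in> \<phi> ` carrier R" using c r by blast
  qed
qed

end

section \<open>Endomorphism rings and matrix rings\<close>

text \<open>For an idempotent \<open>e = \<psi> 1\<close> with corner \<open>eAe = \<psi> D\<close>, an element \<open>u = e u\<close> of a simple module
  satisfies \<open>Au \<cong> Ae\<close>, and \<open>d\<close> acts on the right by \<open>a u \<mapsto> a \<psi>(d) u\<close>.\<close>

lemma endomorphism_ring_iso_corner:
  fixes A :: "('a, 'k) ring_scheme" (structure) and D :: "('d, 'l) ring_scheme"
  assumes U: "simple_left_module A U" and D: "ring D"
    and psi_closed: "\<And>d. d \<in> carrier D \<Longrightarrow> \<psi> d \<in> carrier A"
    and psi_add: "\<And>d d'. d \<in> carrier D \<Longrightarrow> d' \<in> carrier D \<Longrightarrow> \<psi> (d \<oplus>\<^bsub>D\<^esub> d') = \<psi> d \<oplus> \<psi> d'"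
    and psi_mult: "\<And>d d'. d \<in> carrier D \<Longrightarrow> d' \<in> carrier D \<Longrightarrow> \<psi> (d \<otimes>\<^bsub>D\<^esub> d') = \<psi> d \<otimes> \<psi> d'"
    and psi_inj: "inj_on \<psi> (carrier D)"
    and e: "e = \<psi> \<one>\<^bsub>D\<^esub>"
    and corner: "\<And>a. a \<in> carrier A \<Longrightarrow> \<exists>d\<in>carrier D. e \<otimes> a \<otimes> e = \<psi> d"
    and simple: "\<And>a. a \<in> carrier A \<Longrightarrow> a \<otimes> e \<noteq> \<zero> \<Longrightarrow> \<exists>b\<in>carrier A. b \<otimes> (a \<otimes> e) = e"
    and e_nonzero: "e \<notin> annihilator A U"
  shows "endomorphism_ring A U \<simeq> D"
proof -
  interpret U: left_module A U using U by (simp add: simple_left_module_def)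
  interpret D: ring D by fact
  have eA: "e \<in> carrier A" using e psi_closed by simp
  have ee: "\<psi> d \<otimes> e = \<psi> d" "e \<otimes> \<psi> d = \<psi> d" if "d \<in> carrier D" for d
    using psi_mult[OF that D.one_closed] psi_mult[OF D.one_closed that] that e by simp_all
  obtain v where v: "v \<in> carrier U" "e \<odot>\<^bsub>U\<^esub> v \<noteq> \<zero>\<^bsub>U\<^esub>"
    using e_nonzero eA by (auto simp: annihilator_def)
  \<comment> \<open>\<open>u\<close> is a nonzero vector fixed by \<open>e\<close>; it generates
    \<open>U\<close>, so an endomorphism is determined by its value at \<open>u\<close>.\<close>
  define u where "u = e \<odot>\<^bsub>U\<^esub> v"
  have u: "u \<in> carrier U" "u \<noteq> \<zero>\<^bsub>U\<^esub>" using v eA by (auto simp: u_def)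
  have eu: "e \<odot>\<^bsub>U\<^esub> u = u"
    using ee(1)[OF D.one_closed] v eA unfolding u_def e[symmetric] by (simp add: U.smult_assoc1[symmetric])
  have psi_u: "a \<odot>\<^bsub>U\<^esub> (\<psi> d \<odot>\<^bsub>U\<^esub> u) = (a \<otimes> \<psi> d) \<odot>\<^bsub>U\<^esub> u" if "a \<in> carrier A" "d \<in> carrier D" for a d
    using that psi_closed u by (simp add: U.smult_assoc1)
  \<comment> \<open>This is the injectivity of the map from \<open>A e\<close> to
    \<open>A u\<close>: if \<open>a \<otimes> e\<close> were nonzero, a multiple of it would be
    \<open>e\<close>, which fixes \<open>u\<close>.\<close>
  have kill: "a \<otimes> e = \<zero>" if a: "a \<in> carrier A" "a \<odot>\<^bsub>U\<^esub> u = \<zero>\<^bsub>U\<^esub>" for a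
  proof (rule ccontr)
    assume "a \<otimes> e \<noteq> \<zero>"
    then obtain b where b: "b \<in> carrier A" "b \<otimes> (a \<otimes> e) = e" using simple[OF a(1)] by blast
    have "e \<odot>\<^bsub>U\<^esub> u = b \<odot>\<^bsub>U\<^esub> (a \<odot>\<^bsub>U\<^esub> (e \<odot>\<^bsub>U\<^esub> u))"
      using a(1) b(1) eA u(1) b(2)[symmetric] by (metis U.R.m_closed U.smult_assoc1 U.smult_closed)
    then show False using eu a b u by simp
  qed
  have wd: "a \<odot>\<^bsub>U\<^esub> (\<psi> d \<odot>\<^bsub>U\<^esub> u) = a' \<odot>\<^bsub>U\<^esub> (\<psi> d \<odot>\<^bsub>U\<^esub> u)"
    if a: "a \<in> carrier A" "a' \<in> carrier A" "a \<odot>\<^bsub>U\<^esub> u = a' \<odot>\<^bsub>U\<^esub> u" and d: "d \<in> carrier D" for a a' d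
  proof -
    have "(a \<ominus> a') \<odot>\<^bsub>U\<^esub> u = \<zero>\<^bsub>U\<^esub>" using U.smult_l_diff_eq_zero[OF a(1,2) u(1)] a(3) by simp
    then have "(a \<ominus> a') \<otimes> e = \<zero>" using kill a by simp
    then have "(a \<ominus> a') \<otimes> \<psi> d = \<zero>"
      using ee(2)[OF d] a eA psi_closed[OF d] by (metis U.R.l_null U.R.m_assoc U.R.minus_closed)
    then have "((a \<ominus> a') \<otimes> \<psi> d) \<odot>\<^bsub>U\<^esub> u = \<zero>\<^bsub>U\<^esub>" using u by simp
    then have "(a \<ominus> a') \<odot>\<^bsub>U\<^esub> (\<psi> d \<odot>\<^bsub>U\<^esub> u) = \<zero>\<^bsub>U\<^esub>" using a d u psi_closed[OF d] by (simp add: U.smult_assoc1)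
    then show ?thesis
      using U.smult_l_diff_eq_zero[OF a(1,2), of "\<psi> d \<odot>\<^bsub>U\<^esub> u"] psi_closed[OF d] u by simp
  qed
  have gen: "\<exists>a\<in>carrier A. a \<odot>\<^bsub>U\<^esub> u = y" if "y \<in> carrier U" for y
    using simple_left_module_generated[OF U u that] by auto
  \<comment> \<open>The coefficient \<open>a\<close> of a vector \<open>a u\<close> is not unique;
    \<open>wd\<close> removes the dependence on the choice made here.\<close>
  define f where "f d = (\<lambda>y\<in>carrier U. (SOME a. a \<in> carrier A \<and> a \<odot>\<^bsub>U\<^esub> u = y) \<odot>\<^bsub>U\<^esub> (\<psi> d \<odot>\<^bsub>U\<^esub> u))" for d
  have f: "f d (a \<odot>\<^bsub>U\<^esub> u) = a \<odot>\<^bsub>U\<^esub> (\<psi> d \<odot>\<^bsub>U\<^esub> u)" if a: "a \<in> carrier A" and d: "d \<in> carrier D" for a d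
  proof -
    let ?b = "SOME b. b \<in> carrier A \<and> b \<odot>\<^bsub>U\<^esub> u = a \<odot>\<^bsub>U\<^esub> u"
    have b: "?b \<in> carrier A \<and> ?b \<odot>\<^bsub>U\<^esub> u = a \<odot>\<^bsub>U\<^esub> u"
      by (rule someI[of "\<lambda>b. b \<in> carrier A \<and> b \<odot>\<^bsub>U\<^esub> u = a \<odot>\<^bsub>U\<^esub> u" a]) (simp add: a)
    have "f d (a \<odot>\<^bsub>U\<^esub> u) = ?b \<odot>\<^bsub>U\<^esub> (\<psi> d \<odot>\<^bsub>U\<^esub> u)" using a u by (simp add: f_def)
    also have "\<dots> = a \<odot>\<^bsub>U\<^esub> (\<psi> d \<odot>\<^bsub>U\<^esub> u)" using b by (intro wd a d) auto
    finally show ?thesis .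
  qed
  have fu: "f d u = \<psi> d \<odot>\<^bsub>U\<^esub> u" if d: "d \<in> carrier D" for d
    using f[OF U.R.one_closed d] u psi_closed[OF d] by simp
  have ext: "g = h" if "g \<in> extensional (carrier U)" "h \<in> extensional (carrier U)"
    "\<And>a. a \<in> carrier A \<Longrightarrow> g (a \<odot>\<^bsub>U\<^esub> u) = h (a \<odot>\<^bsub>U\<^esub> u)" for g h :: "_ \<Rightarrow> _"
    using that(1,2)
  proof (rule extensionalityI)
    fix y assume "y \<in> carrier U"
    then obtain a where "a \<in> carrier A" "a \<odot>\<^bsub>U\<^esub> u = y" using gen by blast
    with that(3)[of a] show "g y = h y" by simp
  qed
  have f_end: "f d \<in> carrier (endomorphism_ring A U)" if d: "d \<in> carrier D" for d
  proof -
    have pu: "\<psi> d \<odot>\<^bsub>U\<^esub> u \<in> carrier U" using psi_closed[OF d] u by simp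
    have "f d \<in> left_module_hom A U U"
      unfolding left_module_hom_def
    proof (intro CollectI conjI ballI)
      show "f d \<in> carrier U \<rightarrow> carrier U"
      proof
        fix y assume "y \<in> carrier U"
        then obtain a where "a \<in> carrier A" "a \<odot>\<^bsub>U\<^esub> u = y" using gen by blast
        then show "f d y \<in> carrier U" using f[of a d] d pu by auto
      qed
      fix y assume "y \<in> carrier U"
      then obtain a where a: "a \<in> carrier A" "a \<odot>\<^bsub>U\<^esub> u = y" using gen by blast
      show "f d (y \<oplus>\<^bsub>U\<^esub> z) = f d y \<oplus>\<^bsub>U\<^esub> f d z" if z: "z \<in> carrier U" for z
      proof -
        obtain b where b: "b \<in> carrier A" "b \<odot>\<^bsub>U\<^esub> u = z" using gen z by blast
        have "y \<oplus>\<^bsub>U\<^esub> z = (a \<oplus> b) \<odot>\<^bsub>U\<^esub> u" using a b u by (auto simp: U.smult_l_distr)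
        then have "f d (y \<oplus>\<^bsub>U\<^esub> z) = (a \<oplus> b) \<odot>\<^bsub>U\<^esub> (\<psi> d \<odot>\<^bsub>U\<^esub> u)" using f[of "a \<oplus> b" d] a b d by simp
        also have "\<dots> = f d y \<oplus>\<^bsub>U\<^esub> f d z"
          using f[OF a(1) d] f[OF b(1) d] a b pu by (simp add: U.smult_l_distr)
        finally show ?thesis .
      qed
    next
      fix c y assume c: "c \<in> carrier A" and "y \<in> carrier U"
      then obtain a where a: "a \<in> carrier A" "a \<odot>\<^bsub>U\<^esub> u = y" using gen by blast
      have "c \<odot>\<^bsub>U\<^esub> y = (c \<otimes> a) \<odot>\<^bsub>U\<^esub> u" using a c u by (auto simp: U.smult_assoc1)
      then have "f d (c \<odot>\<^bsub>U\<^esub> y) = (c \<otimes> a) \<odot>\<^bsub>U\<^esub> (\<psi> d \<odot>\<^bsub>U\<^esub> u)" using f[of "c \<otimes> a" d] a c d by simp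
      also have "\<dots> = c \<odot>\<^bsub>U\<^esub> f d y" using f[OF a(1) d] a c pu by (simp add: U.smult_assoc1)
      finally show "f d (c \<odot>\<^bsub>U\<^esub> y) = c \<odot>\<^bsub>U\<^esub> f d y" .
    qed
    then show ?thesis by (simp add: endomorphism_ring_def f_def)
  qed
  have endD: "g \<in> extensional (carrier U)" "g (a \<odot>\<^bsub>U\<^esub> y) = a \<odot>\<^bsub>U\<^esub> g y" "g y \<in> carrier U"
    if "g \<in> carrier (endomorphism_ring A U)" "a \<in> carrier A" "y \<in> carrier U" for g a y
    using that by (auto simp: endomorphism_ring_def left_module_hom_def)
  have end_ext: "g = h"
    if g: "g \<in> carrier (endomorphism_ring A U)" and h: "h \<in> carrier (endomorphism_ring A U)" and eq: "g u = h u" for g h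
  proof (rule ext)
    show "g \<in> extensional (carrier U)" "h \<in> extensional (carrier U)"
      using endD(1)[OF g U.R.one_closed u(1)] endD(1)[OF h U.R.one_closed u(1)] .
    show "g (a \<odot>\<^bsub>U\<^esub> u) = h (a \<odot>\<^bsub>U\<^esub> u)" if "a \<in> carrier A" for a
      using endD(2)[OF g that u(1)] endD(2)[OF h that u(1)] eq by simp
  qed
  have f_ring: "f \<in> ring_hom D (endomorphism_ring A U)"
  proof (rule ring_hom_memI)
    fix d d' assume d: "d \<in> carrier D" and d': "d' \<in> carrier D"
    show "f d \<in> carrier (endomorphism_ring A U)" by (rule f_end[OF d])
    have pu: "\<psi> d \<odot>\<^bsub>U\<^esub> u \<in> carrier U" "\<psi> d' \<odot>\<^bsub>U\<^esub> u \<in> carrier U" using psi_closed d d' u by auto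
    \<comment> \<open>Endomorphisms are composed from left to right, so multiplying on the right by
      \<open>\<psi> d\<close> and then by \<open>\<psi> d'\<close> corresponds to the product of
      \<open>d\<close> and \<open>d'\<close> in this order; no opposite ring appears.\<close>
    show "f (d \<otimes>\<^bsub>D\<^esub> d') = f d \<otimes>\<^bsub>endomorphism_ring A U\<^esub> f d'"
    proof (rule ext)
      fix a assume a: "a \<in> carrier A"
      have "f d' (f d (a \<odot>\<^bsub>U\<^esub> u)) = f d' ((a \<otimes> \<psi> d) \<odot>\<^bsub>U\<^esub> u)"
        using f[OF a d] psi_u[OF a d] by simp
      also have "\<dots> = a \<odot>\<^bsub>U\<^esub> ((\<psi> d \<otimes> \<psi> d') \<odot>\<^bsub>U\<^esub> u)"
        using f[OF _ d', of "a \<otimes> \<psi> d"] a psi_closed d d' u by (simp add: U.smult_assoc1)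
      also have "\<dots> = f (d \<otimes>\<^bsub>D\<^esub> d') (a \<odot>\<^bsub>U\<^esub> u)"
        using f[OF a D.m_closed[OF d d']] psi_mult[OF d d'] by simp
      finally show "f (d \<otimes>\<^bsub>D\<^esub> d') (a \<odot>\<^bsub>U\<^esub> u) = (f d \<otimes>\<^bsub>endomorphism_ring A U\<^esub> f d') (a \<odot>\<^bsub>U\<^esub> u)"
        using a u by (simp add: endomorphism_ring_def)
    qed (simp_all add: f_def endomorphism_ring_def)
    show "f (d \<oplus>\<^bsub>D\<^esub> d') = f d \<oplus>\<^bsub>endomorphism_ring A U\<^esub> f d'"
    proof (rule ext)
      fix a assume a: "a \<in> carrier A"
      have "f (d \<oplus>\<^bsub>D\<^esub> d') (a \<odot>\<^bsub>U\<^esub> u) = a \<odot>\<^bsub>U\<^esub> (\<psi> d \<odot>\<^bsub>U\<^esub> u \<oplus>\<^bsub>U\<^esub> \<psi> d' \<odot>\<^bsub>U\<^esub> u)"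
        using f[OF a D.a_closed[OF d d']] psi_add[OF d d'] psi_closed d d' u by (simp add: U.smult_l_distr)
      also have "\<dots> = f d (a \<odot>\<^bsub>U\<^esub> u) \<oplus>\<^bsub>U\<^esub> f d' (a \<odot>\<^bsub>U\<^esub> u)"
        using f[OF a d] f[OF a d'] a pu by (simp add: U.smult_r_distr)
      finally show "f (d \<oplus>\<^bsub>D\<^esub> d') (a \<odot>\<^bsub>U\<^esub> u) = (f d \<oplus>\<^bsub>endomorphism_ring A U\<^esub> f d') (a \<odot>\<^bsub>U\<^esub> u)"
        using a u by (simp add: endomorphism_ring_def)
    qed (simp_all add: f_def endomorphism_ring_def)
  next
    show "f \<one>\<^bsub>D\<^esub> = \<one>\<^bsub>endomorphism_ring A U\<^esub>"
    proof (rule ext)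
      fix a assume a: "a \<in> carrier A"
      show "f \<one>\<^bsub>D\<^esub> (a \<odot>\<^bsub>U\<^esub> u) = \<one>\<^bsub>endomorphism_ring A U\<^esub> (a \<odot>\<^bsub>U\<^esub> u)"
        using f[OF a D.one_closed] eu a u by (simp add: endomorphism_ring_def e[symmetric])
    qed (simp_all add: f_def endomorphism_ring_def)
  qed
  have "inj_on f (carrier D)"
  proof (rule inj_onI)
    fix d d' assume d: "d \<in> carrier D" and d': "d' \<in> carrier D" and eq: "f d = f d'"
    have "\<psi> d \<odot>\<^bsub>U\<^esub> u = \<psi> d' \<odot>\<^bsub>U\<^esub> u" using eq fu[OF d] fu[OF d'] by simp
    then have "(\<psi> d \<ominus> \<psi> d') \<odot>\<^bsub>U\<^esub> u = \<zero>\<^bsub>U\<^esub>"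
      using U.smult_l_diff_eq_zero[OF psi_closed[OF d] psi_closed[OF d'] u(1)] by simp
    then have "(\<psi> d \<ominus> \<psi> d') \<otimes> e = \<zero>" using kill psi_closed d d' by simp
    then have "\<psi> d \<otimes> e \<ominus> \<psi> d' \<otimes> e = \<zero>"
      using psi_closed[OF d] psi_closed[OF d'] eA by (simp add: U.R.minus_eq U.R.l_distr U.R.l_minus)
    then have "\<psi> d = \<psi> d'"
      using ee(1)[OF d] ee(1)[OF d'] psi_closed[OF d] psi_closed[OF d'] U.R.r_right_minus_eq by simp
    then show "d = d'" using psi_inj d d' by (simp add: inj_on_eq_iff)
  qed
  moreover have "f ` carrier D = carrier (endomorphism_ring A U)"
  proof (intro equalityI subsetI)
    fix g assume g: "g \<in> carrier (endomorphism_ring A U)"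
    have gu: "g u \<in> carrier U" by (rule endD(3)[OF g U.R.one_closed u(1)])
    \<comment> \<open>Since \<open>e\<close> fixes \<open>u\<close>, it also fixes
      \<open>g u\<close>; the coefficient \<open>a\<close> may thus be replaced by
      \<open>e \<otimes> a \<otimes> e\<close>, which lies in the corner.\<close>
    obtain a where a: "a \<in> carrier A" "a \<odot>\<^bsub>U\<^esub> u = g u" using gen[OF gu] by blast
    obtain d where d: "d \<in> carrier D" "e \<otimes> a \<otimes> e = \<psi> d" using corner[OF a(1)] by blast
    have "g u = g (e \<odot>\<^bsub>U\<^esub> u)" using eu by simp
    also have "\<dots> = e \<odot>\<^bsub>U\<^esub> (a \<odot>\<^bsub>U\<^esub> (e \<odot>\<^bsub>U\<^esub> u))" using endD(2)[OF g eA u(1)] a(2) eu by simp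
    also have "\<dots> = (e \<otimes> a \<otimes> e) \<odot>\<^bsub>U\<^esub> u" using a(1) eA u(1) by (simp add: U.smult_assoc1)
    also have "\<dots> = f d u" using d fu by simp
    finally have "g = f d" by (rule end_ext[OF g f_end[OF d(1)]])
    then show "g \<in> f ` carrier D" using d(1) by blast
  next
    fix g assume "g \<in> f ` carrier D"
    then show "g \<in> carrier (endomorphism_ring A U)" using f_end by blast
  qed
  ultimately have "f \<in> ring_iso D (endomorphism_ring A U)"
    using f_ring by (simp add: ring_iso_def bij_betw_def)
  then have "D \<simeq> endomorphism_ring A U" unfolding is_ring_iso_def by blast
  then show ?thesis by (rule ring_iso_sym[OF D])
qed

text \<open>The entry \<open>d\<close> is an argument, so that \<open>matrix_unit n D 0 0\<close> is
  the embedding of \<open>D\<close> into a corner of the matrix ring.\<close>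

definition matrix_unit :: "nat \<Rightarrow> ('d, 'l) ring_scheme \<Rightarrow> nat \<Rightarrow> nat \<Rightarrow> 'd \<Rightarrow> nat \<times> nat \<Rightarrow> 'd" where
  "matrix_unit n D i j d = (\<lambda>(k, l)\<in>{..<n} \<times> {..<n}. if k = i \<and> l = j then d else \<zero>\<^bsub>D\<^esub>)"

lemma matrix_unit_entry:
  "k < n \<Longrightarrow> l < n \<Longrightarrow> matrix_unit n D i j d (k, l) = (if k = i \<and> l = j then d else \<zero>\<^bsub>D\<^esub>)"
  by (simp add: matrix_unit_def)

lemma matrix_eqI:
  assumes "P \<in> extensional ({..<n} \<times> {..<n})" "Q \<in> extensional ({..<n} \<times> {..<n})"
    and "\<And>k l. k < n \<Longrightarrow> l < n \<Longrightarrow> P (k, l) = Q (k, l)"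
  shows "P = Q"
  using assms by (intro extensionalityI[of P "{..<n} \<times> {..<n}"]) auto

lemma matrix_ring_entries:
  "k < n \<Longrightarrow> l < n \<Longrightarrow> (P \<otimes>\<^bsub>matrix_ring n D\<^esub> Q) (k, l) = (\<Oplus>\<^bsub>D\<^esub>m\<in>{..<n}. P (k, m) \<otimes>\<^bsub>D\<^esub> Q (m, l))"
  "k < n \<Longrightarrow> l < n \<Longrightarrow> (P \<oplus>\<^bsub>matrix_ring n D\<^esub> Q) (k, l) = P (k, l) \<oplus>\<^bsub>D\<^esub> Q (k, l)"
  "k < n \<Longrightarrow> l < n \<Longrightarrow> \<one>\<^bsub>matrix_ring n D\<^esub> (k, l) = (if k = l then \<one>\<^bsub>D\<^esub> else \<zero>\<^bsub>D\<^esub>)"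
  "k < n \<Longrightarrow> l < n \<Longrightarrow> \<zero>\<^bsub>matrix_ring n D\<^esub> (k, l) = \<zero>\<^bsub>D\<^esub>"
  by (simp_all add: matrix_ring_def)

lemma matrix_ring_extensional:
  "P \<otimes>\<^bsub>matrix_ring n D\<^esub> Q \<in> extensional ({..<n} \<times> {..<n})"
  "P \<oplus>\<^bsub>matrix_ring n D\<^esub> Q \<in> extensional ({..<n} \<times> {..<n})"
  "\<one>\<^bsub>matrix_ring n D\<^esub> \<in> extensional ({..<n} \<times> {..<n})"
  "\<zero>\<^bsub>matrix_ring n D\<^esub> \<in> extensional ({..<n} \<times> {..<n})"
  "P \<in> carrier (matrix_ring n D) \<Longrightarrow> P \<in> extensional ({..<n} \<times> {..<n})"
  "matrix_unit n D i j d \<in> extensional ({..<n} \<times> {..<n})"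
  by (auto simp: matrix_ring_def matrix_unit_def PiE_def)

lemma matrix_entry_closed:
  "P \<in> carrier (matrix_ring n D) \<Longrightarrow> k < n \<Longrightarrow> l < n \<Longrightarrow> P (k, l) \<in> carrier D"
  by (auto simp: matrix_ring_def)

context ring
begin

lemma matrix_unit_closed: "d \<in> carrier R \<Longrightarrow> matrix_unit n R i j d \<in> carrier (matrix_ring n R)"
  by (auto simp: matrix_ring_def matrix_unit_def)

lemma matrix_unit_mult_left:
  assumes "P \<in> carrier (matrix_ring n R)" "d \<in> carrier R" "j < n" "k < n" "l < n"
  shows "(matrix_unit n R i j d \<otimes>\<^bsub>matrix_ring n R\<^esub> P) (k, l) = (if k = i then d \<otimes> P (j, l) else \<zero>)"
proof -
  have c: "P (m, l) \<in> carrier R" if "m < n" for m using matrix_entry_closed[OF assms(1) that assms(5)] .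
  have "(matrix_unit n R i j d \<otimes>\<^bsub>matrix_ring n R\<^esub> P) (k, l) =
      (\<Oplus>m\<in>{..<n}. if j = m then (if k = i then d \<otimes> P (m, l) else \<zero>) else \<zero>)"
    unfolding matrix_ring_entries(1)[OF assms(4,5)]
    by (rule finsum_cong') (use assms c in \<open>auto simp: matrix_unit_def\<close>)
  also have "\<dots> = (if k = i then d \<otimes> P (j, l) else \<zero>)"
    by (rule finsum_singleton) (use assms c in auto)
  finally show ?thesis .
qed

lemma matrix_unit_mult_right:
  assumes "P \<in> carrier (matrix_ring n R)" "d \<in> carrier R" "i < n" "k < n" "l < n"
  shows "(P \<otimes>\<^bsub>matrix_ring n R\<^esub> matrix_unit n R i j d) (k, l) = (if l = j then P (k, i) \<otimes> d else \<zero>)"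
proof -
  have c: "P (k, m) \<in> carrier R" if "m < n" for m using matrix_entry_closed[OF assms(1,4) that] .
  have "(P \<otimes>\<^bsub>matrix_ring n R\<^esub> matrix_unit n R i j d) (k, l) =
      (\<Oplus>m\<in>{..<n}. if i = m then (if l = j then P (k, m) \<otimes> d else \<zero>) else \<zero>)"
    unfolding matrix_ring_entries(1)[OF assms(4,5)]
    by (rule finsum_cong') (use assms c in \<open>auto simp: matrix_unit_def\<close>)
  also have "\<dots> = (if l = j then P (k, i) \<otimes> d else \<zero>)"
    by (rule finsum_singleton) (use assms c in auto)
  finally show ?thesis .
qed

lemma matrix_mult_closed:
  assumes "P \<in> carrier (matrix_ring n R)" "Q \<in> carrier (matrix_ring n R)"
  shows "P \<otimes>\<^bsub>matrix_ring n R\<^esub> Q \<in> carrier (matrix_ring n R)"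
proof -
  have "(\<Oplus>m\<in>{..<n}. P (k, m) \<otimes> Q (m, l)) \<in> carrier R" if "k < n" "l < n" for k l
    by (rule finsum_closed) (use matrix_entry_closed[OF assms(1)] matrix_entry_closed[OF assms(2)] that in auto)
  then show ?thesis by (auto simp: matrix_ring_def)
qed

end

text \<open>The corner is that of the matrix unit at position \<open>(0, 0)\<close>, carried to
  \<open>A\<close> by an isomorphism \<open>h\<close>. If \<open>a e\<close> is nonzero, the first
  column of the matrix of \<open>a\<close> has an invertible entry, and a matrix unit with its
  inverse as entry takes \<open>a e\<close> back to \<open>e\<close>. Faithfulness keeps
  \<open>e\<close> from annihilating \<open>U\<close>.\<close>

lemma endomorphism_ring_iso_matrix:
  fixes D :: "'d ring"
  assumes A: "ring A" and U: "simple_left_module A U" and faithful: "annihilator A U = {\<zero>\<^bsub>A\<^esub>}"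
    and D: "division_ring D" and iso: "A \<simeq> matrix_ring n D"
  shows "endomorphism_ring A U \<simeq> D"
proof -
  interpret A: ring A by fact
  interpret D: ring D using D by (simp add: division_ring_def)
  let ?M = "matrix_ring n D" and ?E = "matrix_unit n D"
  have one_nz: "\<one>\<^bsub>A\<^esub> \<noteq> \<zero>\<^bsub>A\<^esub>"
  proof
    assume "\<one>\<^bsub>A\<^esub> = \<zero>\<^bsub>A\<^esub>"
    then have "\<one>\<^bsub>A\<^esub> \<in> annihilator A U" using faithful by simp
    then have "annihilator A U = carrier A"
      by (rule ideal_eq_carrier[OF SpecD(1)[OF annihilator_simple_in_Spec[OF U]]])
    then show False using SpecD(2)[OF annihilator_simple_in_Spec[OF U]] by simp
  qed
  have "?M \<simeq> A" by (rule ring_iso_sym[OF A iso])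
  then obtain h where "h \<in> ring_iso ?M A" unfolding is_ring_iso_def by blast
  then have h: "h \<in> ring_hom ?M A" "inj_on h (carrier ?M)" "h ` carrier ?M = carrier A"
    by (auto simp: ring_iso_def bij_betw_def)
  \<comment> \<open>A matrix ring of size 0 has a single element, whereas \<open>\<one>\<close> and
    \<open>\<zero>\<close> differ in \<open>A\<close> because a simple module has a proper
    annihilator.\<close>
  have n: "0 < n"
  proof (rule ccontr)
    assume "\<not> 0 < n"
    then have "carrier ?M = {\<lambda>_. undefined}" by (simp add: matrix_ring_def)
    then have "carrier A = {h (\<lambda>_. undefined)}" using h(3) by simp
    then show False using one_nz A.one_closed A.zero_closed by auto
  qed
  note E = D.matrix_unit_closed[of _ n]
  have zM: "\<zero>\<^bsub>?M\<^esub> \<in> carrier ?M" by (auto simp: matrix_ring_def)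
  \<comment> \<open>The zero matrix is its own double, so its image is too, and cancellation in
    \<open>A\<close> makes that image zero.\<close>
  have h0: "h \<zero>\<^bsub>?M\<^esub> = \<zero>\<^bsub>A\<^esub>"
  proof -
    have "\<zero>\<^bsub>?M\<^esub> \<oplus>\<^bsub>?M\<^esub> \<zero>\<^bsub>?M\<^esub> = \<zero>\<^bsub>?M\<^esub>"
      by (rule matrix_eqI[where n = n]) (simp_all add: matrix_ring_extensional matrix_ring_entries)
    then have "h \<zero>\<^bsub>?M\<^esub> \<oplus>\<^bsub>A\<^esub> h \<zero>\<^bsub>?M\<^esub> = h \<zero>\<^bsub>?M\<^esub>" using ring_hom_add[OF h(1) zM zM] by simp
    then show ?thesis using ring_hom_closed[OF h(1) zM] by (simp add: A.add.l_cancel_one)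
  qed
  define \<psi> where "\<psi> d = h (?E 0 0 d)" for d
  define e where "e = \<psi> \<one>\<^bsub>D\<^esub>"
  have psi_closed: "\<psi> d \<in> carrier A" if "d \<in> carrier D" for d
    using ring_hom_closed[OF h(1) E[OF that]] by (simp add: \<psi>_def)
  have psi_inj: "inj_on \<psi> (carrier D)"
  proof (rule inj_onI)
    fix d d' assume *: "d \<in> carrier D" "d' \<in> carrier D" "\<psi> d = \<psi> d'"
    then have "?E 0 0 d = ?E 0 0 d'" using inj_onD[OF h(2)] E by (simp add: \<psi>_def)
    then have "?E 0 0 d (0, 0) = ?E 0 0 d' (0, 0)" by simp
    then show "d = d'" using n by (simp add: matrix_unit_entry)
  qed
  have psi0: "\<psi> \<zero>\<^bsub>D\<^esub> = \<zero>\<^bsub>A\<^esub>"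
  proof -
    have "?E 0 0 \<zero>\<^bsub>D\<^esub> = \<zero>\<^bsub>?M\<^esub>"
      by (rule matrix_eqI[where n = n]) (simp_all add: matrix_ring_extensional matrix_ring_entries matrix_unit_entry)
    then show ?thesis by (simp add: \<psi>_def h0)
  qed
  have surj: "\<exists>P\<in>carrier ?M. a = h P" if "a \<in> carrier A" for a using that h(3) by auto
  show ?thesis
  proof (rule endomorphism_ring_iso_corner[OF U D.ring_axioms psi_closed _ _ psi_inj e_def])
    fix d d' assume d: "d \<in> carrier D" and d': "d' \<in> carrier D"
    have "?E 0 0 (d \<oplus>\<^bsub>D\<^esub> d') = ?E 0 0 d \<oplus>\<^bsub>?M\<^esub> ?E 0 0 d'"
      by (rule matrix_eqI[where n = n])
        (simp_all add: matrix_ring_extensional matrix_ring_entries, simp add: matrix_unit_entry)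
    then show "\<psi> (d \<oplus>\<^bsub>D\<^esub> d') = \<psi> d \<oplus>\<^bsub>A\<^esub> \<psi> d'"
      using ring_hom_add[OF h(1) E[OF d] E[OF d']] by (simp add: \<psi>_def)
    have "?E 0 0 (d \<otimes>\<^bsub>D\<^esub> d') = ?E 0 0 d \<otimes>\<^bsub>?M\<^esub> ?E 0 0 d'"
    proof (rule matrix_eqI[where n = n])
      fix k l assume "k < n" "l < n"
      then show "?E 0 0 (d \<otimes>\<^bsub>D\<^esub> d') (k, l) = (?E 0 0 d \<otimes>\<^bsub>?M\<^esub> ?E 0 0 d') (k, l)"
        using D.matrix_unit_mult_left[OF E[OF d'] d n] d n by (simp add: matrix_unit_entry)
    qed (simp_all add: matrix_ring_extensional)
    then show "\<psi> (d \<otimes>\<^bsub>D\<^esub> d') = \<psi> d \<otimes>\<^bsub>A\<^esub> \<psi> d'"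
      using ring_hom_mult[OF h(1) E[OF d] E[OF d']] by (simp add: \<psi>_def)
  next
    fix a assume "a \<in> carrier A"
    then obtain P where P: "P \<in> carrier ?M" "a = h P" using surj by blast
    note E1 = E[OF D.one_closed]
    have "?E 0 0 \<one>\<^bsub>D\<^esub> \<otimes>\<^bsub>?M\<^esub> P \<otimes>\<^bsub>?M\<^esub> ?E 0 0 \<one>\<^bsub>D\<^esub> = ?E 0 0 (P (0, 0))"
    proof (rule matrix_eqI[where n = n])
      fix k l assume "k < n" "l < n"
      then show "(?E 0 0 \<one>\<^bsub>D\<^esub> \<otimes>\<^bsub>?M\<^esub> P \<otimes>\<^bsub>?M\<^esub> ?E 0 0 \<one>\<^bsub>D\<^esub>) (k, l) = ?E 0 0 (P (0, 0)) (k, l)"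
        using D.matrix_unit_mult_right[OF D.matrix_mult_closed[OF E1 P(1)] D.one_closed n]
          D.matrix_unit_mult_left[OF P(1) D.one_closed n] matrix_entry_closed[OF P(1)] n
        by (simp add: matrix_unit_entry)
    qed (simp_all add: matrix_ring_extensional)
    then have "e \<otimes>\<^bsub>A\<^esub> a \<otimes>\<^bsub>A\<^esub> e = \<psi> (P (0, 0))"
      by (simp add: e_def \<psi>_def P(2) ring_hom_mult[OF h(1) E1 P(1), symmetric]
        ring_hom_mult[OF h(1) D.matrix_mult_closed[OF E1 P(1)] E1, symmetric])
    then show "\<exists>d\<in>carrier D. e \<otimes>\<^bsub>A\<^esub> a \<otimes>\<^bsub>A\<^esub> e = \<psi> d" using matrix_entry_closed[OF P(1) n n] by blast
    assume nz: "a \<otimes>\<^bsub>A\<^esub> e \<noteq> \<zero>\<^bsub>A\<^esub>"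
    let ?Q = "P \<otimes>\<^bsub>?M\<^esub> ?E 0 0 \<one>\<^bsub>D\<^esub>"
    have Q: "?Q \<in> carrier ?M" by (rule D.matrix_mult_closed[OF P(1) E1])
    have ae: "a \<otimes>\<^bsub>A\<^esub> e = h ?Q" using ring_hom_mult[OF h(1) P(1) E1] P(2) by (simp add: e_def \<psi>_def)
    have Qe: "?Q (k, l) = (if l = 0 then P (k, 0) else \<zero>\<^bsub>D\<^esub>)" if "k < n" "l < n" for k l
      using D.matrix_unit_mult_right[OF P(1) D.one_closed n that] matrix_entry_closed[OF P(1) that(1) n] by simp
    have "\<exists>i<n. P (i, 0) \<noteq> \<zero>\<^bsub>D\<^esub>"
    proof (rule ccontr)
      assume "\<not> ?thesis"
      then have "?Q = \<zero>\<^bsub>?M\<^esub>"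
        by (intro matrix_eqI[where n = n]) (auto simp: matrix_ring_extensional matrix_ring_entries(4) Qe)
      then show False using nz ae h0 by simp
    qed
    then obtain i where i: "i < n" "P (i, 0) \<noteq> \<zero>\<^bsub>D\<^esub>" by blast
    then have "P (i, 0) \<in> Units D"
      using D matrix_entry_closed[OF P(1) i(1) n] by (simp add: division_ring_def)
    then obtain c where c: "c \<in> carrier D" "c \<otimes>\<^bsub>D\<^esub> P (i, 0) = \<one>\<^bsub>D\<^esub>" by (auto simp: Units_def)
    have "?E 0 i c \<otimes>\<^bsub>?M\<^esub> ?Q = ?E 0 0 \<one>\<^bsub>D\<^esub>"
    proof (rule matrix_eqI[where n = n])
      fix k l assume "k < n" "l < n"
      then show "(?E 0 i c \<otimes>\<^bsub>?M\<^esub> ?Q) (k, l) = ?E 0 0 \<one>\<^bsub>D\<^esub> (k, l)"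
        using D.matrix_unit_mult_left[OF Q c(1) i(1)] c i(1) by (simp add: matrix_unit_entry Qe)
    qed (simp_all add: matrix_ring_extensional)
    then have "h (?E 0 i c) \<otimes>\<^bsub>A\<^esub> (a \<otimes>\<^bsub>A\<^esub> e) = e"
      unfolding ae by (simp add: e_def \<psi>_def ring_hom_mult[OF h(1) E[OF c(1)] Q, symmetric])
    then show "\<exists>b\<in>carrier A. b \<otimes>\<^bsub>A\<^esub> (a \<otimes>\<^bsub>A\<^esub> e) = e" using ring_hom_closed[OF h(1) E[OF c(1)]] by blast
  next
    show "e \<notin> annihilator A U"
    proof
      assume "e \<in> annihilator A U"
      then have "\<psi> \<one>\<^bsub>D\<^esub> = \<psi> \<zero>\<^bsub>D\<^esub>" using faithful psi0 by (simp add: e_def)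
      then have "\<one>\<^bsub>D\<^esub> = \<zero>\<^bsub>D\<^esub>" using psi_inj by (simp add: inj_on_eq_iff)
      then show False using D by (simp add: division_ring_def)
    qed
  qed
qed

text \<open>For idempotent \<open>e\<close> the carrier is \<open>eAe\<close>; describing it by
  fixed elements allows membership to be checked without a factorization.\<close>

definition corner_ring :: "('a, 'k) ring_scheme \<Rightarrow> 'a \<Rightarrow> 'a ring" where
  "corner_ring A e = \<lparr>carrier = {a \<in> carrier A. e \<otimes>\<^bsub>A\<^esub> a = a \<and> a \<otimes>\<^bsub>A\<^esub> e = a},
     monoid.mult = monoid.mult A, one = e, ring.zero = \<zero>\<^bsub>A\<^esub>, add = add A\<rparr>"

lemma corner_ring_simps [simp]:
  "a \<in> carrier (corner_ring A e) \<longleftrightarrow> a \<in> carrier A \<and> e \<otimes>\<^bsub>A\<^esub> a = a \<and> a \<otimes>\<^bsub>A\<^esub> e = a"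
  "a \<otimes>\<^bsub>corner_ring A e\<^esub> b = a \<otimes>\<^bsub>A\<^esub> b" "\<one>\<^bsub>corner_ring A e\<^esub> = e" "\<zero>\<^bsub>corner_ring A e\<^esub> = \<zero>\<^bsub>A\<^esub>"
  "a \<oplus>\<^bsub>corner_ring A e\<^esub> b = a \<oplus>\<^bsub>A\<^esub> b"
  by (simp_all add: corner_ring_def)

lemma (in ring) ring_corner_ring:
  assumes e: "e \<in> carrier R" "e \<otimes> e = e"
  shows "ring (corner_ring R e)"
proof (rule ringI)
  show "abelian_group (corner_ring R e)"
  proof (rule abelian_groupI)
    fix x assume "x \<in> carrier (corner_ring R e)"
    then show "\<exists>y\<in>carrier (corner_ring R e). y \<oplus>\<^bsub>corner_ring R e\<^esub> x = \<zero>\<^bsub>corner_ring R e\<^esub>"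
      using e by (intro bexI[of _ "\<ominus> x"]) (auto simp: l_neg r_minus l_minus)
  qed (use e in \<open>auto simp: a_ac l_distr r_distr\<close>)
  show "monoid (corner_ring R e)"
  proof (rule monoidI)
    fix x y assume x: "x \<in> carrier (corner_ring R e)" and y: "y \<in> carrier (corner_ring R e)"
    then have "e \<otimes> (x \<otimes> y) = x \<otimes> y" "x \<otimes> y \<otimes> e = x \<otimes> y"
      using e by (simp_all add: m_assoc[symmetric]) (simp add: m_assoc)
    then show "x \<otimes>\<^bsub>corner_ring R e\<^esub> y \<in> carrier (corner_ring R e)" using x y by simp
  qed (use e in \<open>auto simp: m_assoc\<close>)
qed (auto simp: l_distr r_distr)

text \<open>Left inverses are two-sided here: if \<open>b a = 1\<close> and \<open>c b = 1\<close>,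
  then \<open>c = c (b a) = a\<close>.\<close>

lemma division_ringI:
  assumes "ring D" "\<one>\<^bsub>D\<^esub> \<noteq> \<zero>\<^bsub>D\<^esub>"
    and inv: "\<And>a. a \<in> carrier D \<Longrightarrow> a \<noteq> \<zero>\<^bsub>D\<^esub> \<Longrightarrow> \<exists>b\<in>carrier D. b \<otimes>\<^bsub>D\<^esub> a = \<one>\<^bsub>D\<^esub>"
  shows "division_ring D"
proof -
  interpret D: ring D by fact
  have "a \<in> Units D" if a: "a \<in> carrier D" "a \<noteq> \<zero>\<^bsub>D\<^esub>" for a
  proof -
    obtain b where b: "b \<in> carrier D" "b \<otimes>\<^bsub>D\<^esub> a = \<one>\<^bsub>D\<^esub>" using inv a by blast
    then have "b \<noteq> \<zero>\<^bsub>D\<^esub>" using assms(2) a by auto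
    then obtain c where c: "c \<in> carrier D" "c \<otimes>\<^bsub>D\<^esub> b = \<one>\<^bsub>D\<^esub>" using inv b by blast
    have "c = c \<otimes>\<^bsub>D\<^esub> (b \<otimes>\<^bsub>D\<^esub> a)" using b(2) c(1) by simp
    also have "\<dots> = a" using D.m_assoc[OF c(1) b(1) a(1)] c(2) a(1) by simp
    finally have "c = a" .
    then show ?thesis using a b c by (auto simp: Units_def)
  qed
  moreover have "a \<noteq> \<zero>\<^bsub>D\<^esub>" if "a \<in> Units D" for a
    using that assms(2) by (auto simp: Units_def)
  ultimately show ?thesis
    using assms(1,2) by (auto simp: division_ring_def Units_def)
qed

text \<open>The identification \<open>A \<cong> U\<^sup>n\<close> furnishes matrix units \<open>E i j\<close> with \<open>E i j x\<^sub>k = \<delta>\<^sub>j\<^sub>k x\<^sub>i\<close>;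
  then \<open>A\<close> is the matrix ring over the corner \<open>E 0 0 A E 0 0\<close>.\<close>

lemma faithful_simple_imp_matrix_ring:
  fixes A :: "('a, 'k) ring_scheme" (structure) and U :: "('a, 'm) module"
  assumes U: "simple_left_module A U" and F: "finite F" "F \<subseteq> carrier U" "annihilator_of A U F = {\<zero>}"
    and interp: "\<And>y. y \<in> F \<rightarrow> carrier U \<Longrightarrow> \<exists>a\<in>carrier A. \<forall>x\<in>F. a \<odot>\<^bsub>U\<^esub> x = y x"
  obtains n and D :: "'a ring" where "n > 0" "division_ring D" "A \<simeq> matrix_ring n D"
proof -
  interpret U: left_module A U using U by (simp add: simple_left_module_def)
  obtain x where x: "bij_betw x {..<card F} F"
    using ex_bij_betw_nat_finite[OF F(1)] by (auto simp: lessThan_atLeast0)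
  define n where "n = card F"
  have xF: "x i \<in> F" "x i \<in> carrier U" if "i < n" for i
    using x that F(2) by (auto simp: bij_betw_def n_def)
  have Fx: "\<exists>i<n. v = x i" if "v \<in> F" for v
    using x that by (auto simp: bij_betw_def n_def)
  \<comment> \<open>An element of \<open>A\<close> is determined by its values on the vectors
    \<open>x i\<close>, and \<open>solve\<close> below prescribes these values freely. Identities in
    \<open>A\<close> are checked on these vectors.\<close>
  have faith: "a = b"
    if a: "a \<in> carrier A" and b: "b \<in> carrier A" and eq: "\<And>i. i < n \<Longrightarrow> a \<odot>\<^bsub>U\<^esub> x i = b \<odot>\<^bsub>U\<^esub> x i" for a b
  proof -
    have "a \<ominus> b \<in> annihilator_of A U F"
      unfolding annihilator_of_def
    proof (intro CollectI conjI ballI)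
      fix v assume "v \<in> F"
      then obtain i where i: "i < n" "v = x i" using Fx by blast
      then show "(a \<ominus> b) \<odot>\<^bsub>U\<^esub> v = \<zero>\<^bsub>U\<^esub>"
        using U.smult_l_diff_eq_zero[OF a b xF(2)[OF i(1)]] eq[OF i(1)] by simp
    qed (use a b in simp)
    then have "a \<ominus> b = \<zero>" using F(3) by simp
    then show ?thesis using a b U.R.r_right_minus_eq by simp
  qed
  have solve: "\<exists>a\<in>carrier A. \<forall>i<n. a \<odot>\<^bsub>U\<^esub> x i = y i" if y: "\<And>i. i < n \<Longrightarrow> y i \<in> carrier U" for y
  proof -
    have xi: "inv_into {..<n} x (x i) = i" if "i < n" for i
      using x that by (auto simp: bij_betw_def n_def)
    have "(\<lambda>v. y (inv_into {..<n} x v)) \<in> F \<rightarrow> carrier U"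
    proof
      fix v assume "v \<in> F"
      then obtain i where "i < n" "v = x i" using Fx by blast
      then show "y (inv_into {..<n} x v) \<in> carrier U" using xi y by simp
    qed
    from interp[OF this] obtain a where a: "a \<in> carrier A" "\<forall>v\<in>F. a \<odot>\<^bsub>U\<^esub> v = y (inv_into {..<n} x v)" by blast
    have "\<forall>i<n. a \<odot>\<^bsub>U\<^esub> x i = y i" using a(2) xF(1) xi by simp
    then show ?thesis using a(1) by blast
  qed
  obtain w where w: "w \<in> carrier U" "w \<noteq> \<zero>\<^bsub>U\<^esub>" using simple_left_module_obtain_nonzero[OF U] .
  have n: "0 < n"
  proof (rule ccontr)
    assume n0: "\<not> 0 < n"
    have "\<one> = \<zero>" by (rule faith) (use n0 in auto)
    then have "\<one> \<odot>\<^bsub>U\<^esub> w = \<zero>\<^bsub>U\<^esub>" using U.smult_l_null[OF w(1)] by (simp only:)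
    then show False using w by simp
  qed
  have "\<exists>a\<in>carrier A. \<forall>k<n. a \<odot>\<^bsub>U\<^esub> x k = (if k = j then x i else \<zero>\<^bsub>U\<^esub>)" if "i < n" for i j
    by (rule solve) (use xF that in auto)
  \<comment> \<open>The guard \<open>i < n\<close> is there because \<open>x i\<close> is known to
    be a vector of \<open>U\<close> only in this range; for \<open>j\<close> outside the range the
    element acts as zero on all \<open>x k\<close>.\<close>
  then have "\<forall>i j. \<exists>a. i < n \<longrightarrow> a \<in> carrier A \<and> (\<forall>k<n. a \<odot>\<^bsub>U\<^esub> x k = (if k = j then x i else \<zero>\<^bsub>U\<^esub>))"
    by blast
  then obtain E where E: "\<forall>i j. i < n \<longrightarrow> E i j \<in> carrier A \<and>
      (\<forall>k<n. E i j \<odot>\<^bsub>U\<^esub> x k = (if k = j then x i else \<zero>\<^bsub>U\<^esub>))"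
    by metis
  have Ec: "E i j \<in> carrier A" if "i < n" for i j using E that by simp
  have Ex: "E i j \<odot>\<^bsub>U\<^esub> x k = (if k = j then x i else \<zero>\<^bsub>U\<^esub>)" if "i < n" "k < n" for i j k using E that by simp
  have EE: "E i j \<otimes> E j l = E i l" if "i < n" "j < n" "l < n" for i j l
  proof (rule faith)
    show "(E i j \<otimes> E j l) \<odot>\<^bsub>U\<^esub> x k = E i l \<odot>\<^bsub>U\<^esub> x k" if "k < n" for k
      using that \<open>i < n\<close> \<open>j < n\<close> by (simp add: U.smult_assoc1 Ec xF Ex)
  qed (use that Ec in auto)
  have E1: "(\<Oplus>i\<in>{..<n}. E i i) = \<one>"
  proof (rule faith)
    have Ep: "(\<lambda>i. E i i) \<in> {..<n} \<rightarrow> carrier A" using Ec by auto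
    show "(\<Oplus>i\<in>{..<n}. E i i) \<in> carrier A" by (rule U.R.finsum_closed[OF Ep])
    fix k assume k: "k < n"
    have "(\<Oplus>i\<in>{..<n}. E i i) \<odot>\<^bsub>U\<^esub> x k = (\<Oplus>\<^bsub>U\<^esub>i\<in>{..<n}. E i i \<odot>\<^bsub>U\<^esub> x k)"
      by (rule U.finsum_smult_left) (use Ep k xF in auto)
    also have "\<dots> = (\<Oplus>\<^bsub>U\<^esub>i\<in>{..<n}. if k = i then x i else \<zero>\<^bsub>U\<^esub>)"
      by (rule U.M.finsum_cong') (use Ex xF k in auto)
    also have "\<dots> = x k" by (rule U.M.finsum_singleton) (use xF k in auto)
    finally show "(\<Oplus>i\<in>{..<n}. E i i) \<odot>\<^bsub>U\<^esub> x k = \<one> \<odot>\<^bsub>U\<^esub> x k" using xF[OF k] by simp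
  qed simp
  define e where "e = E 0 0"
  define D where "D = corner_ring A e"
  have e: "e \<in> carrier A" "e \<otimes> e = e" using Ec EE n by (auto simp: e_def)
  interpret D: ring D unfolding D_def by (rule U.R.ring_corner_ring[OF e])
  have Dc: "d \<in> carrier A" "e \<otimes> d = d" "d \<otimes> e = d" if "d \<in> carrier D" for d
    using that by (auto simp: D_def)
  have Dx: "d \<odot>\<^bsub>U\<^esub> x k = \<zero>\<^bsub>U\<^esub>" if d: "d \<in> carrier D" and k: "k < n" "k \<noteq> 0" for d k
  proof -
    have "d \<odot>\<^bsub>U\<^esub> x k = d \<odot>\<^bsub>U\<^esub> (e \<odot>\<^bsub>U\<^esub> x k)"
      using Dc[OF d] e xF(2)[OF k(1)] by (metis U.smult_assoc1)
    then show ?thesis using Ex[OF n k(1), of 0] k Dc[OF d] by (simp add: e_def)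
  qed
  \<comment> \<open>Elements of the corner kill every \<open>x k\<close> with \<open>k\<close>
    nonzero, so their value at \<open>x 0\<close> determines them.\<close>
  have D_faith: "d = d'" if d: "d \<in> carrier D" and d': "d' \<in> carrier D" and eq: "d \<odot>\<^bsub>U\<^esub> x 0 = d' \<odot>\<^bsub>U\<^esub> x 0" for d d'
  proof (rule faith[OF Dc(1)[OF d] Dc(1)[OF d']])
    show "d \<odot>\<^bsub>U\<^esub> x i = d' \<odot>\<^bsub>U\<^esub> x i" if "i < n" for i
      using eq Dx[OF d that] Dx[OF d' that] by (cases "i = 0") simp_all
  qed
  \<comment> \<open>\<open>D\<close> and \<open>A\<close> share addition and zero, but finite sums
    are defined relative to the carrier, so their agreement takes an induction.\<close>
  have D_finsum: "(\<Oplus>\<^bsub>D\<^esub>i\<in>I. g i) = (\<Oplus>i\<in>I. g i)" if "finite I" "g \<in> I \<rightarrow> carrier D" for I and g :: "nat \<Rightarrow> 'a"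
    using that
  proof (induction I rule: finite_induct)
    case (insert i I)
    have g: "g \<in> I \<rightarrow> carrier D" "g i \<in> carrier D" using insert.prems by auto
    have g': "g \<in> I \<rightarrow> carrier A" "g i \<in> carrier A" using g Dc(1) by auto
    show ?case
      unfolding D.finsum_insert[OF insert.hyps g] U.R.finsum_insert[OF insert.hyps g'] insert.IH[OF g(1)]
      by (simp add: D_def)
  next
    case empty
    show ?case unfolding D.finsum_empty U.R.finsum_empty by (simp add: D_def)
  qed
  have x0: "x 0 \<noteq> \<zero>\<^bsub>U\<^esub>"
  proof
    assume x0: "x 0 = \<zero>\<^bsub>U\<^esub>"
    obtain a where a: "a \<in> carrier A" "\<forall>i<n. a \<odot>\<^bsub>U\<^esub> x i = w" using solve[of "\<lambda>_. w"] w(1) by blast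
    then have "a \<odot>\<^bsub>U\<^esub> x 0 = w" using n by simp
    then show False using x0 w(2) a(1) by simp
  qed
  have "division_ring D"
  proof (rule division_ringI[OF D.ring_axioms])
    have "e \<odot>\<^bsub>U\<^esub> x 0 = x 0" using Ex[OF n n, of 0] by (simp add: e_def)
    then have "e \<noteq> \<zero>" using x0 U.smult_l_null[OF xF(2)[OF n]] by auto
    then show "\<one>\<^bsub>D\<^esub> \<noteq> \<zero>\<^bsub>D\<^esub>" by (simp add: D_def)
    fix d assume d: "d \<in> carrier D" "d \<noteq> \<zero>\<^bsub>D\<^esub>"
    have dx: "d \<odot>\<^bsub>U\<^esub> x 0 \<in> carrier U" using Dc(1)[OF d(1)] xF(2)[OF n] by simp
    have "d \<odot>\<^bsub>U\<^esub> x 0 \<noteq> \<zero>\<^bsub>U\<^esub>"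
    proof
      assume "d \<odot>\<^bsub>U\<^esub> x 0 = \<zero>\<^bsub>U\<^esub>"
      then have "d = \<zero>\<^bsub>D\<^esub>"
        using U.smult_l_null[OF xF(2)[OF n]] by (intro D_faith d D.zero_closed) (simp add: D_def)
      with d(2) show False by simp
    qed
    then obtain b where b: "b \<in> carrier A" "b \<odot>\<^bsub>U\<^esub> (d \<odot>\<^bsub>U\<^esub> x 0) = x 0"
      using simple_left_module_generated[OF U dx _ xF(2)[OF n]] by metis
    \<comment> \<open>\<open>b\<close> inverts \<open>d\<close> only at the vector
      \<open>x 0\<close>; compressing it by \<open>e\<close> on both sides brings it into the corner
      without changing that.\<close>
    let ?c = "e \<otimes> b \<otimes> e"
    have c: "?c \<in> carrier D"
      using e b(1) by (simp add: D_def) (simp add: U.R.m_assoc U.R.m_assoc[symmetric, of e e])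
    have "?c \<otimes>\<^bsub>D\<^esub> d = \<one>\<^bsub>D\<^esub>"
    proof (rule D_faith[OF D.m_closed[OF c d(1)] D.one_closed])
      have "(?c \<otimes>\<^bsub>D\<^esub> d) \<odot>\<^bsub>U\<^esub> x 0 = e \<odot>\<^bsub>U\<^esub> (b \<odot>\<^bsub>U\<^esub> ((e \<otimes> d) \<odot>\<^bsub>U\<^esub> x 0))"
        using e b(1) Dc(1)[OF d(1)] xF(2)[OF n] by (simp add: D_def U.smult_assoc1)
      then show "(?c \<otimes>\<^bsub>D\<^esub> d) \<odot>\<^bsub>U\<^esub> x 0 = \<one>\<^bsub>D\<^esub> \<odot>\<^bsub>U\<^esub> x 0"
        using Dc(2)[OF d(1)] b(2) by (simp add: D_def)
    qed
    then show "\<exists>b\<in>carrier D. b \<otimes>\<^bsub>D\<^esub> d = \<one>\<^bsub>D\<^esub>" using c by blast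
  qed
  moreover have "A \<simeq> matrix_ring n D"
  proof -
    let ?M = "matrix_ring n D"
    \<comment> \<open>The component of \<open>a\<close> between positions \<open>i\<close> and
      \<open>j\<close> is \<open>E i i \<otimes> a \<otimes> E j j\<close>; the units
      \<open>E 0 i\<close> and \<open>E j 0\<close> carry it into the corner at position 0.\<close>
    define \<Phi> where "\<Phi> a = (\<lambda>(i, j)\<in>{..<n} \<times> {..<n}. E 0 i \<otimes> a \<otimes> E j 0)" for a
    have \<Phi>: "\<Phi> a (i, j) = E 0 i \<otimes> a \<otimes> E j 0" if "i < n" "j < n" for a i j
      using that by (simp add: \<Phi>_def)
    have \<Phi>_ext: "\<Phi> a \<in> extensional ({..<n} \<times> {..<n})" for a by (simp add: \<Phi>_def)
    have \<Phi>_D: "E 0 i \<otimes> a \<otimes> E j 0 \<in> carrier D" if a: "a \<in> carrier A" and ij: "i < n" "j < n" for a i j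
    proof -
      have "e \<otimes> (E 0 i \<otimes> a \<otimes> E j 0) = (e \<otimes> E 0 i) \<otimes> a \<otimes> E j 0"
        using a ij e Ec n by (simp add: U.R.m_assoc)
      moreover have "(E 0 i \<otimes> a \<otimes> E j 0) \<otimes> e = E 0 i \<otimes> a \<otimes> (E j 0 \<otimes> e)"
        using a ij e Ec n by (simp add: U.R.m_assoc)
      ultimately show ?thesis
        using a ij Ec n EE[OF n n ij(1)] EE[OF ij(2) n n] by (simp add: D_def e_def)
    qed
    have \<Phi>_closed: "\<Phi> a \<in> carrier ?M" if "a \<in> carrier A" for a
      using \<Phi>_D[OF that] by (auto simp: matrix_ring_def \<Phi>_def)
    have \<Phi>_x: "(E 0 i \<otimes> a \<otimes> E j 0) \<odot>\<^bsub>U\<^esub> x 0 = E 0 i \<odot>\<^bsub>U\<^esub> (a \<odot>\<^bsub>U\<^esub> x j)"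
      if "a \<in> carrier A" "i < n" "j < n" for a i j
      using that n by (simp add: U.smult_assoc1 Ec xF Ex)
    \<comment> \<open>The sum of the \<open>E i 0 \<otimes> E 0 i\<close> is the identity, so a
      vector \<open>y\<close> is recovered from the vectors \<open>E 0 i y\<close>.\<close>
    have row: "y = y'"
      if y: "y \<in> carrier U" and y': "y' \<in> carrier U" and eq: "\<And>i. i < n \<Longrightarrow> E 0 i \<odot>\<^bsub>U\<^esub> y = E 0 i \<odot>\<^bsub>U\<^esub> y'" for y y'
    proof -
      have exp: "v = (\<Oplus>\<^bsub>U\<^esub>i\<in>{..<n}. E i 0 \<odot>\<^bsub>U\<^esub> (E 0 i \<odot>\<^bsub>U\<^esub> v))" if v: "v \<in> carrier U" for v
      proof -
        have "v = (\<Oplus>i\<in>{..<n}. E i i) \<odot>\<^bsub>U\<^esub> v" using v E1 by simp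
        also have "\<dots> = (\<Oplus>\<^bsub>U\<^esub>i\<in>{..<n}. E i i \<odot>\<^bsub>U\<^esub> v)"
          by (rule U.finsum_smult_left) (use v Ec in auto)
        also have "\<dots> = (\<Oplus>\<^bsub>U\<^esub>i\<in>{..<n}. E i 0 \<odot>\<^bsub>U\<^esub> (E 0 i \<odot>\<^bsub>U\<^esub> v))"
        proof (rule U.M.finsum_cong')
          show "E i i \<odot>\<^bsub>U\<^esub> v = E i 0 \<odot>\<^bsub>U\<^esub> (E 0 i \<odot>\<^bsub>U\<^esub> v)" if "i \<in> {..<n}" for i
            using EE[of i 0 i] that n Ec v by (simp add: U.smult_assoc1[symmetric])
        qed (use v Ec n in auto)
        finally show ?thesis .
      qed
      have "(\<Oplus>\<^bsub>U\<^esub>i\<in>{..<n}. E i 0 \<odot>\<^bsub>U\<^esub> (E 0 i \<odot>\<^bsub>U\<^esub> y)) = (\<Oplus>\<^bsub>U\<^esub>i\<in>{..<n}. E i 0 \<odot>\<^bsub>U\<^esub> (E 0 i \<odot>\<^bsub>U\<^esub> y'))"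
        by (rule U.M.finsum_cong') (use eq Ec n y' in auto)
      with exp[OF y] exp[OF y'] show ?thesis by (simp only:)
    qed
    have "\<Phi> \<in> ring_hom A ?M"
    proof (rule ring_hom_memI)
      fix a b assume a: "a \<in> carrier A" and b: "b \<in> carrier A"
      show "\<Phi> a \<in> carrier ?M" by (rule \<Phi>_closed[OF a])
      show "\<Phi> (a \<oplus> b) = \<Phi> a \<oplus>\<^bsub>?M\<^esub> \<Phi> b"
      proof (rule matrix_eqI[where n = n])
        fix i j assume "i < n" "j < n"
        then show "\<Phi> (a \<oplus> b) (i, j) = (\<Phi> a \<oplus>\<^bsub>?M\<^esub> \<Phi> b) (i, j)"
          using a b Ec n by (simp add: matrix_ring_entries \<Phi> D_def U.R.l_distr U.R.r_distr)
      qed (simp_all add: \<Phi>_ext matrix_ring_extensional)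
      show "\<Phi> (a \<otimes> b) = \<Phi> a \<otimes>\<^bsub>?M\<^esub> \<Phi> b"
      proof (rule matrix_eqI[where n = n])
        fix i j assume ij: "i < n" "j < n"
        let ?P = "E 0 i \<otimes> a" and ?Q = "b \<otimes> E j 0"
        have PQ: "?P \<in> carrier A" "?Q \<in> carrier A" using a b ij n Ec by auto
        have Ep: "(\<lambda>k. E k k) \<in> {..<n} \<rightarrow> carrier A" using Ec by auto
        have "(\<Phi> a \<otimes>\<^bsub>?M\<^esub> \<Phi> b) (i, j) =
            (\<Oplus>\<^bsub>D\<^esub>k\<in>{..<n}. \<Phi> a (i, k) \<otimes>\<^bsub>D\<^esub> \<Phi> b (k, j))"
          by (rule matrix_ring_entries(1)[OF ij])
        also have "\<dots> = (\<Oplus>k\<in>{..<n}. \<Phi> a (i, k) \<otimes>\<^bsub>D\<^esub> \<Phi> b (k, j))"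
          by (rule D_finsum) (use \<Phi>_D[OF a] \<Phi>_D[OF b] ij in \<open>auto simp: \<Phi> simp del: corner_ring_simps\<close>)
        \<comment> \<open>The middle factors \<open>E k 0 \<otimes> E 0 k\<close> combine to
          \<open>E k k\<close>, whose sum over \<open>k\<close> is the identity: this turns the
          matrix product into the product of \<open>a\<close> and \<open>b\<close>.\<close>
        also have "\<dots> = (\<Oplus>k\<in>{..<n}. ?P \<otimes> E k k \<otimes> ?Q)"
        proof (rule U.R.finsum_cong')
          fix k assume "k \<in> {..<n}"
          then have k: "k < n" by simp
          have "\<Phi> a (i, k) \<otimes>\<^bsub>D\<^esub> \<Phi> b (k, j) = ?P \<otimes> (E k 0 \<otimes> E 0 k) \<otimes> ?Q"
            using a b Ec n k ij by (simp add: \<Phi> D_def U.R.m_assoc)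
          then show "\<Phi> a (i, k) \<otimes>\<^bsub>D\<^esub> \<Phi> b (k, j) = ?P \<otimes> E k k \<otimes> ?Q" using EE[OF k n k] by simp
        qed (use PQ Ec in auto)
        also have "\<dots> = (\<Oplus>k\<in>{..<n}. ?P \<otimes> E k k) \<otimes> ?Q"
          by (rule U.R.finsum_ldistr[symmetric]) (use PQ Ec in auto)
        also have "(\<Oplus>k\<in>{..<n}. ?P \<otimes> E k k) = ?P \<otimes> (\<Oplus>k\<in>{..<n}. E k k)"
          by (rule U.R.finsum_rdistr[symmetric]) (use PQ Ec in auto)
        also have "?P \<otimes> (\<Oplus>k\<in>{..<n}. E k k) \<otimes> ?Q = \<Phi> (a \<otimes> b) (i, j)"
          using a b ij n Ec by (simp add: E1 \<Phi> U.R.m_assoc)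
        finally show "\<Phi> (a \<otimes> b) (i, j) = (\<Phi> a \<otimes>\<^bsub>?M\<^esub> \<Phi> b) (i, j)" by (rule sym)
      qed (simp_all add: \<Phi>_ext matrix_ring_extensional)
    next
      show "\<Phi> \<one> = \<one>\<^bsub>?M\<^esub>"
      proof (rule matrix_eqI[where n = n])
        fix i j assume ij: "i < n" "j < n"
        have c: "E 0 i \<otimes> \<one> \<otimes> E j 0 \<in> carrier D" by (rule \<Phi>_D) (use ij in auto)
        have "E 0 i \<otimes> \<one> \<otimes> E j 0 = (if i = j then \<one>\<^bsub>D\<^esub> else \<zero>\<^bsub>D\<^esub>)"
        proof (rule D_faith[OF c])
          show "(if i = j then \<one>\<^bsub>D\<^esub> else \<zero>\<^bsub>D\<^esub>) \<in> carrier D" by (simp del: corner_ring_simps)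
          have "(E 0 i \<otimes> \<one> \<otimes> E j 0) \<odot>\<^bsub>U\<^esub> x 0 = (if i = j then x 0 else \<zero>\<^bsub>U\<^esub>)"
            using \<Phi>_x[OF U.R.one_closed ij] Ex[OF n ij(2)] xF[OF ij(2)] by auto
          then show "(E 0 i \<otimes> \<one> \<otimes> E j 0) \<odot>\<^bsub>U\<^esub> x 0 = (if i = j then \<one>\<^bsub>D\<^esub> else \<zero>\<^bsub>D\<^esub>) \<odot>\<^bsub>U\<^esub> x 0"
            using Ex[OF n n, of 0] xF[OF n] by (simp add: D_def e_def)
        qed
        then show "\<Phi> \<one> (i, j) = \<one>\<^bsub>?M\<^esub> (i, j)" using ij by (simp add: \<Phi> matrix_ring_entries)
      qed (simp_all add: \<Phi>_ext matrix_ring_extensional)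
    qed
    moreover have "inj_on \<Phi> (carrier A)"
    proof (rule inj_onI)
      fix a b assume a: "a \<in> carrier A" and b: "b \<in> carrier A" and eq: "\<Phi> a = \<Phi> b"
      show "a = b"
      proof (rule faith[OF a b])
        fix j assume j: "j < n"
        show "a \<odot>\<^bsub>U\<^esub> x j = b \<odot>\<^bsub>U\<^esub> x j"
        proof (rule row)
          fix i assume i: "i < n"
          have "\<Phi> a (i, j) = \<Phi> b (i, j)" using eq by simp
          then have "E 0 i \<otimes> a \<otimes> E j 0 = E 0 i \<otimes> b \<otimes> E j 0" using \<Phi>[OF i j] by simp
          then show "E 0 i \<odot>\<^bsub>U\<^esub> (a \<odot>\<^bsub>U\<^esub> x j) = E 0 i \<odot>\<^bsub>U\<^esub> (b \<odot>\<^bsub>U\<^esub> x j)"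
            using \<Phi>_x[OF a i j] \<Phi>_x[OF b i j] by simp
        qed (use a b xF[OF j] in auto)
      qed
    qed
    moreover have "\<Phi> ` carrier A = carrier ?M"
    proof (intro equalityI subsetI)
      fix P assume P: "P \<in> carrier ?M"
      have Pc: "P (i, j) \<in> carrier D" if "i < n" "j < n" for i j using matrix_entry_closed[OF P that] .
      have PU: "P (i, j) \<odot>\<^bsub>U\<^esub> x 0 \<in> carrier U" if "i < n" "j < n" for i j
        using Dc(1)[OF Pc[OF that]] xF[OF n] by simp
      \<comment> \<open>Column \<open>j\<close> of \<open>P\<close> read as a vector: its entries
        act on \<open>x 0\<close>, and \<open>E l 0\<close> moves the result to position
        \<open>l\<close>. This is the image of \<open>x j\<close> under the element of
        \<open>A\<close> that is sought.\<close>
      define y where "y j = (\<Oplus>\<^bsub>U\<^esub>l\<in>{..<n}. E l 0 \<odot>\<^bsub>U\<^esub> (P (l, j) \<odot>\<^bsub>U\<^esub> x 0))" for j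
      have yc: "y j \<in> carrier U" if "j < n" for j
        unfolding y_def by (rule U.M.finsum_closed) (use that PU Ec in auto)
      obtain a where a: "a \<in> carrier A" "\<forall>j<n. a \<odot>\<^bsub>U\<^esub> x j = y j" using solve[of y] yc by blast
      have "\<Phi> a = P"
      proof (rule matrix_eqI[where n = n])
        fix i j assume ij: "i < n" "j < n"
        have "E 0 i \<otimes> a \<otimes> E j 0 = P (i, j)"
        proof (rule D_faith[OF \<Phi>_D[OF a(1) ij] Pc[OF ij]])
          have z: "E 0 i \<odot>\<^bsub>U\<^esub> (E l 0 \<odot>\<^bsub>U\<^esub> v) = (if i = l then e \<odot>\<^bsub>U\<^esub> v else \<zero>\<^bsub>U\<^esub>)"
            if l: "l < n" and v: "v \<in> carrier U" for l v
          proof -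
            have "E 0 i \<otimes> E l 0 = \<zero>" if "i \<noteq> l"
            proof (rule faith)
              show "(E 0 i \<otimes> E l 0) \<odot>\<^bsub>U\<^esub> x k = \<zero> \<odot>\<^bsub>U\<^esub> x k" if "k < n" for k
                using that \<open>i \<noteq> l\<close> l n by (simp add: U.smult_assoc1 Ec xF Ex)
            qed (use Ec n l in auto)
            then show ?thesis
              using EE[OF n ij(1) n] Ec n l v U.smult_assoc1[of "E 0 i" "E l 0" v] by (auto simp: e_def)
          qed
          have "E 0 i \<odot>\<^bsub>U\<^esub> y j = (\<Oplus>\<^bsub>U\<^esub>l\<in>{..<n}. E 0 i \<odot>\<^bsub>U\<^esub> (E l 0 \<odot>\<^bsub>U\<^esub> (P (l, j) \<odot>\<^bsub>U\<^esub> x 0)))"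
            unfolding y_def by (rule U.smult_finsum_right) (use Ec n PU ij in auto)
          also have "\<dots> = (\<Oplus>\<^bsub>U\<^esub>l\<in>{..<n}. if i = l then e \<odot>\<^bsub>U\<^esub> (P (l, j) \<odot>\<^bsub>U\<^esub> x 0) else \<zero>\<^bsub>U\<^esub>)"
            by (rule U.M.finsum_cong') (use z PU ij e in auto)
          also have "\<dots> = e \<odot>\<^bsub>U\<^esub> (P (i, j) \<odot>\<^bsub>U\<^esub> x 0)"
            by (rule U.M.finsum_singleton) (use PU ij e in auto)
          also have "\<dots> = P (i, j) \<odot>\<^bsub>U\<^esub> x 0"
            using Dc(1,2)[OF Pc[OF ij]] e xF[OF n] by (simp add: U.smult_assoc1[symmetric])
          finally show "(E 0 i \<otimes> a \<otimes> E j 0) \<odot>\<^bsub>U\<^esub> x 0 = P (i, j) \<odot>\<^bsub>U\<^esub> x 0"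
            using \<Phi>_x[OF a(1) ij] a(2) ij by simp
        qed
        then show "\<Phi> a (i, j) = P (i, j)" using \<Phi>[OF ij] by simp
      qed (simp_all add: \<Phi>_ext matrix_ring_extensional(5)[OF P])
      then show "P \<in> \<Phi> ` carrier A" using a(1) by blast
    next
      fix P assume "P \<in> \<Phi> ` carrier A"
      then show "P \<in> carrier ?M" using \<Phi>_closed by blast
    qed
    ultimately have "\<Phi> \<in> ring_iso A ?M" by (simp add: ring_iso_def bij_betw_def)
    then show ?thesis unfolding is_ring_iso_def by blast
  qed
  ultimately show ?thesis using that n by blast
qed

section \<open>Rings with simple artinian fibres\<close>

locale simple_artinian_fibres =
  fixes R :: "('a, 'k) ring_scheme" (structure)
  assumes ring_R: "ring R"
    and free: "free_left_module (centre_ring R) (regular_module R)"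
    and fibre: "p \<in> ZL R \<Longrightarrow> simple_artinian_ring (fibre_ring R p)"
begin

sublocale R: ring R by (rule ring_R)

text \<open>From here on the tensor product is seen only through these localization properties and
  the fibre hypothesis. Freeness enters through the kernel of the map from \<open>R\<close>.\<close>

lemma central_localization_fibre:
  assumes "primeideal p (centre_ring R)"
  shows "central_localization R p (fibre_ring R p) (to_fibre_ring R p)"
proof -
  interpret central_prime R p by (intro central_prime.intro ring_R assms)
  obtain B co where B: "free_over_centre R B co"
    using free_left_module_obtain_coordinates[OF ring_R free] .
  show ?thesis
    unfolding fibre_ring_eq
  proof (rule central_localization.intro)
    show "\<phi> r = \<zero>\<^bsub>T\<^esub> \<longleftrightarrow> r \<in> extended_ideal R p" if "r \<in> carrier R" for r
      using phi_zero_imp[OF B that] phi_extended_ideal[of r] by blast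
    show "\<exists>s\<in>centre R - p. \<exists>r\<in>carrier R. \<phi> s \<otimes>\<^bsub>T\<^esub> t = \<phi> r" if "t \<in> carrier T" for t
      by (rule phi_fraction[OF that])
    show "\<phi> s \<in> Units T" if "s \<in> centre R" "s \<notin> p" for s by (rule phi_unit[OF that])
  qed (rule ring_R T.ring_axioms assms phi_hom)+
qed

section \<open>Prime and maximal ideals of \<open>R\<close> and of its centre\<close>

lemma Spec_contraction:
  assumes "P \<in> Spec R"
  shows "P \<inter> centre R \<in> ZL R" "primeideal (P \<inter> centre R) (centre_ring R)"
  using assms primeideal_centre_contraction[OF ring_R assms] by (auto simp: ZL_def)

lemma Spec_eq:
  assumes P: "P \<in> Spec R" shows "P = extended_ideal R (P \<inter> centre R)"
proof -
  let ?p = "P \<inter> centre R"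
  interpret central_localization R ?p "fibre_ring R ?p" "to_fibre_ring R ?p"
    by (rule central_localization_fibre[OF Spec_contraction(2)[OF P]])
  show ?thesis
    by (rule Spec_eq_extended_ideal[OF _ P refl])
      (use fibre[OF Spec_contraction(1)[OF P]] in \<open>simp add: simple_artinian_ring_def\<close>)
qed

lemma nontrivial:
  assumes "ideal p (centre_ring R)" "p \<noteq> centre R"
  shows "carrier R \<noteq> {\<zero>}"
proof
  assume "carrier R = {\<zero>}"
  then have "centre R \<subseteq> {\<zero>}" by (auto simp: centre_def)
  moreover have "\<zero> \<in> p"
    using additive_subgroup.zero_closed[OF ideal.axioms(1)[OF assms(1)]] by simp
  moreover have "p \<subseteq> centre R" using ideal.Icarr[OF assms(1)] by auto
  ultimately show False using assms(2) by blast
qed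

lemma contraction:
  assumes "ideal p (centre_ring R)" "p \<noteq> centre R"
  shows "extended_ideal R p \<inter> centre R = p"
proof -
  obtain B co where "free_over_centre R B co"
    using free_left_module_obtain_coordinates[OF ring_R free] .
  then interpret free_over_centre R B co .
  show ?thesis by (rule extended_ideal_contraction[OF nontrivial[OF assms] assms(1)])
qed

lemma MaxSpec_centre:
  assumes "m \<in> MaxSpec (centre_ring R)"
  shows "maximalideal m (centre_ring R)" "ideal m (centre_ring R)" "m \<noteq> centre R"
proof -
  show max: "maximalideal m (centre_ring R)" using assms by (simp add: MaxSpec_def)
  show "ideal m (centre_ring R)" by (rule maximalideal.axioms(1)[OF max])
  show "m \<noteq> centre R" using maximalideal.I_notcarr[OF max] by auto
qed

lemma contraction_MaxSpec:
  "m \<in> MaxSpec (centre_ring R) \<Longrightarrow> extended_ideal R m \<inter> centre R = m"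
  by (rule contraction) (rule MaxSpec_centre, assumption)+

lemma proper_contraction_eq:
  assumes m: "m \<in> MaxSpec (centre_ring R)" and P: "ideal P R" "P \<noteq> carrier R" "m \<subseteq> P"
  shows "P \<inter> centre R = m"
proof -
  have id: "ideal (P \<inter> centre R) (centre_ring R)" by (rule ideal_centre_contraction[OF ring_R P(1)])
  have sub: "m \<subseteq> P \<inter> centre R" using ideal.Icarr[OF MaxSpec_centre(2)[OF m]] P(3) by auto
  have "P \<inter> centre R \<noteq> centre R"
    using one_in_centre[OF ring_R] ideal_eq_carrier[OF P(1)] P(2) by blast
  then show ?thesis
    using maximalideal.I_maximal[OF MaxSpec_centre(1)[OF m] id sub] by auto
qed

lemma subset_extended_ideal:
  assumes "m \<in> MaxSpec (centre_ring R)" shows "m \<subseteq> extended_ideal R m"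
  using contraction_MaxSpec[OF assms] by blast

text \<open>A maximal ideal \<open>P\<close> of \<open>R\<close> above \<open>Rm\<close> is prime
  and contracts to \<open>m\<close> by maximality of \<open>m\<close>, which puts \<open>m\<close>
  within reach of the fibre hypothesis; uniqueness of the prime ideal over \<open>m\<close> then
  gives \<open>P = Rm\<close>.\<close>

lemma extended_ideal_MaxSpec:
  assumes m: "m \<in> MaxSpec (centre_ring R)"
  shows "extended_ideal R m \<in> MaxSpec R" "m \<in> ZL R"
proof -
  have id: "ideal (extended_ideal R m) R" by (rule ideal_extended_ideal[OF ring_R MaxSpec_centre(2)[OF m]])
  have proper: "extended_ideal R m \<noteq> carrier R"
  proof
    assume "extended_ideal R m = carrier R"
    then have "carrier R \<inter> centre R = m" using contraction_MaxSpec[OF m] by simp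
    then show False using MaxSpec_centre(3)[OF m] by (auto simp: centre_def)
  qed
  obtain P where P: "P \<in> MaxSpec R" "extended_ideal R m \<subseteq> P" using MaxSpec_over[OF ring_R id proper] .
  have S: "P \<in> Spec R" by (rule MaxSpec_in_Spec[OF P(1)])
  have c: "P \<inter> centre R = m"
    by (rule proper_contraction_eq[OF m SpecD(1,2)[OF S]]) (use subset_extended_ideal[OF m] P(2) in blast)
  have "P = extended_ideal R m" using Spec_eq[OF S] unfolding c .
  then show "extended_ideal R m \<in> MaxSpec R" using P(1) by simp
  show "m \<in> ZL R" using Spec_contraction(1)[OF S] unfolding c .
qed

text \<open>Inverses modulo \<open>P\<close> of central elements are found in \<open>R\<close>;
  since \<open>P\<close> is the extension of its contraction, freeness brings them into the centre.
  This serves annihilators of simple modules and maximal ideals alike.\<close>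

lemma contraction_in_MaxSpec:
  assumes P: "P \<in> Spec R"
    and inv: "\<And>c. c \<in> centre R \<Longrightarrow> c \<notin> P \<Longrightarrow> \<exists>r\<in>carrier R. c \<otimes> r \<ominus> \<one> \<in> P"
  shows "P \<inter> centre R \<in> MaxSpec (centre_ring R)"
proof -
  obtain B co where "free_over_centre R B co"
    using free_left_module_obtain_coordinates[OF ring_R free] .
  then interpret F: free_over_centre R B co .
  let ?p = "P \<inter> centre R"
  interpret Z: cring "centre_ring R" by (rule cring_centre_ring[OF ring_R])
  have id: "ideal ?p (centre_ring R)" by (rule ideal_centre_contraction[OF ring_R SpecD(1)[OF P]])
  have proper: "?p \<noteq> centre R"
    using one_in_centre[OF ring_R] ideal_eq_carrier[OF SpecD(1)[OF P]] SpecD(2)[OF P] by blast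
  have "maximalideal ?p (centre_ring R)"
  proof (rule maximalidealI_inverse_mod[OF Z.cring_axioms id])
    show "?p \<noteq> carrier (centre_ring R)" using proper by simp
    fix c assume "c \<in> carrier (centre_ring R)" "c \<notin> ?p"
    then have c: "c \<in> centre R" "c \<notin> P" by auto
    then obtain r where r: "r \<in> carrier R" "c \<otimes> r \<ominus> \<one> \<in> P" using inv by blast
    then have "c \<otimes> r \<ominus> \<one> \<in> extended_ideal R ?p" using Spec_eq[OF P] by simp
    from F.central_inverse_mod[OF nontrivial[OF id proper] id c(1) r(1) this]
    obtain z where z: "z \<in> centre R" "c \<otimes> z \<ominus> \<one> \<in> ?p" .
    have "c \<otimes> z \<in> centre R" using Z.m_closed[of c z] c(1) z(1) by simp
    then have "c \<otimes>\<^bsub>centre_ring R\<^esub> z \<ominus>\<^bsub>centre_ring R\<^esub> \<one>\<^bsub>centre_ring R\<^esub> \<in> ?p"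
      using z(2) R.centre_ring_minus[OF _ one_in_centre[OF ring_R]] by simp
    then show "\<exists>z\<in>carrier (centre_ring R).
        c \<otimes>\<^bsub>centre_ring R\<^esub> z \<ominus>\<^bsub>centre_ring R\<^esub> \<one>\<^bsub>centre_ring R\<^esub> \<in> ?p" using z(1) by auto
  qed
  then show ?thesis by (simp add: MaxSpec_def)
qed

lemma annihilator_contraction:
  assumes M: "simple_left_module R M"
  shows "annihilator R M \<inter> centre R \<in> MaxSpec (centre_ring R)"
proof (rule contraction_in_MaxSpec)
  show S: "annihilator R M \<in> Spec R" by (rule annihilator_simple_in_Spec[OF M])
  let ?p = "annihilator R M \<inter> centre R"
  interpret central_localization R ?p "fibre_ring R ?p" "to_fibre_ring R ?p"
    by (rule central_localization_fibre[OF Spec_contraction(2)[OF S]])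
  have art: "artinian_ring (fibre_ring R ?p)"
    using fibre[OF Spec_contraction(1)[OF S]] by (simp add: simple_artinian_ring_def)
  fix c assume "c \<in> centre R" "c \<notin> annihilator R M"
  then have c: "c \<in> centre R - ?p" by blast
  obtain r where "r \<in> carrier R" "c \<otimes> r \<ominus> \<one> \<in> annihilator R M"
    by (rule central_inverse_mod_annihilator[OF art M refl c])
  then show "\<exists>r\<in>carrier R. c \<otimes> r \<ominus> \<one> \<in> annihilator R M" by blast
qed

lemma annihilator_eq_extended_ideal:
  assumes "simple_left_module R M"
  shows "annihilator R M = extended_ideal R (annihilator R M \<inter> centre R)"
  by (rule Spec_eq[OF annihilator_simple_in_Spec[OF assms]])

lemma MaxSpec_eq: "MaxSpec R = {extended_ideal R m | m. m \<in> MaxSpec (centre_ring R)}"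
proof (intro equalityI subsetI)
  fix P assume P: "P \<in> MaxSpec R"
  have "P \<inter> centre R \<in> MaxSpec (centre_ring R)"
    by (rule contraction_in_MaxSpec[OF MaxSpec_in_Spec[OF P]])
      (use P in \<open>auto simp: MaxSpec_def intro: maximalideal_central_inverse_mod\<close>)
  then show "P \<in> {extended_ideal R m | m. m \<in> MaxSpec (centre_ring R)}"
    using Spec_eq[OF MaxSpec_in_Spec[OF P]] by blast
next
  fix P assume "P \<in> {extended_ideal R m | m. m \<in> MaxSpec (centre_ring R)}"
  then show "P \<in> MaxSpec R" using extended_ideal_MaxSpec(1) by blast
qed

text \<open>Over a maximal \<open>m\<close> the fibre ring is \<open>R/Rm\<close> up to isomorphism,
  expressed here as a surjection from \<open>R\<close> with kernel \<open>Rm\<close>.\<close>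

lemma surjective_ring_hom_fibre:
  assumes m: "m \<in> MaxSpec (centre_ring R)"
  shows "surjective_ring_hom R (fibre_ring R m) (to_fibre_ring R m)"
    "a \<in> carrier R \<Longrightarrow> to_fibre_ring R m a = \<zero>\<^bsub>fibre_ring R m\<^esub> \<longleftrightarrow> a \<in> extended_ideal R m"
proof -
  have prime: "primeideal m (centre_ring R)"
    by (rule cring.maximalideal_prime[OF cring_centre_ring[OF ring_R] MaxSpec_centre(1)[OF m]])
  interpret central_localization R m "fibre_ring R m" "to_fibre_ring R m"
    by (rule central_localization_fibre[OF prime])
  show "surjective_ring_hom R (fibre_ring R m) (to_fibre_ring R m)"
    by (intro surjective_ring_hom.intro ring_R ring_T hom surjective_if_maximal MaxSpec_centre(1)[OF m])
  show "a \<in> carrier R \<Longrightarrow> to_fibre_ring R m a = \<zero>\<^bsub>fibre_ring R m\<^esub> \<longleftrightarrow> a \<in> extended_ideal R m"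
    by (rule zero_iff)
qed

section \<open>The simple module \<open>U(m)\<close>\<close>

lemma simple_artinian_fibre:
  assumes "m \<in> MaxSpec (centre_ring R)" shows "simple_artinian_ring (fibre_ring R m)"
  by (rule fibre[OF extended_ideal_MaxSpec(2)[OF assms]])

lemma simple_fibre_simple_module:
  assumes m: "m \<in> MaxSpec (centre_ring R)"
  shows "simple_left_module (fibre_ring R m) (fibre_simple_module R m)"
proof -
  obtain V :: "('a fibre, 'a fibre set) module" where "simple_left_module (fibre_ring R m) V"
    using simple_artinian_ring_obtain_simple_left_module[OF simple_artinian_fibre[OF m]] .
  then show ?thesis unfolding fibre_simple_module_def by (rule someI)
qed

lemma scalars_along_U_mod: "scalars_along R (to_fibre_ring R m) (U_mod R m) (fibre_simple_module R m)"
  unfolding U_mod_def by (rule scalars_along_restrict_scalars)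

lemma simple_U_mod:
  assumes m: "m \<in> MaxSpec (centre_ring R)"
  shows "simple_left_module R (U_mod R m)"
  using surjective_ring_hom.simple_left_module_along[OF surjective_ring_hom_fibre(1)[OF m] scalars_along_U_mod]
    simple_fibre_simple_module[OF m] by simp

lemma simple_left_module_contraction_eq:
  assumes m: "m \<in> MaxSpec (centre_ring R)" and M: "simple_left_module R M"
    and sub: "extended_ideal R m \<subseteq> annihilator R M"
  shows "annihilator R M = extended_ideal R m"
proof -
  have S: "annihilator R M \<in> Spec R" by (rule annihilator_simple_in_Spec[OF M])
  have "annihilator R M \<inter> centre R = m"
    by (rule proper_contraction_eq[OF m SpecD(1,2)[OF S]]) (use subset_extended_ideal[OF m] sub in blast)
  then show ?thesis using Spec_eq[OF S] by simp
qed

text \<open>\<open>Rm\<close> acts as zero because it maps to zero in the fibre ring; equality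
  follows since the annihilator is a prime ideal over \<open>m\<close>, and \<open>Rm\<close> is the
  only one.\<close>

lemma annihilator_U_mod:
  assumes m: "m \<in> MaxSpec (centre_ring R)"
  shows "annihilator R (U_mod R m) = extended_ideal R m"
proof (rule simple_left_module_contraction_eq[OF m simple_U_mod[OF m]])
  interpret S: surjective_ring_hom R "fibre_ring R m" "to_fibre_ring R m"
    by (rule surjective_ring_hom_fibre(1)[OF m])
  have V: "left_module (fibre_ring R m) (fibre_simple_module R m)"
    using simple_fibre_simple_module[OF m] by (simp add: simple_left_module_def)
  have z: "\<zero>\<^bsub>fibre_ring R m\<^esub> \<in> annihilator (fibre_ring R m) (fibre_simple_module R m)"
    using additive_subgroup.zero_closed[OF ideal.axioms(1)[OF ideal_annihilator[OF V]]] .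
  show "extended_ideal R m \<subseteq> annihilator R (U_mod R m)"
  proof
    fix a assume a: "a \<in> extended_ideal R m"
    then have aR: "a \<in> carrier R"
      using ideal.Icarr[OF ideal_extended_ideal[OF ring_R MaxSpec_centre(2)[OF m]]] by blast
    then show "a \<in> annihilator R (U_mod R m)"
      unfolding S.annihilator_along[OF scalars_along_U_mod V]
      using surjective_ring_hom_fibre(2)[OF m aR] a z by simp
  qed
qed

text \<open>The annihilator of \<open>M\<close> is \<open>Rm\<close>, the kernel of the map to the
  fibre ring, so \<open>M\<close> is a simple module over that ring, where simple modules are unique
  up to isomorphism.\<close>

lemma iso_U_mod:
  fixes M :: "('a, 'm) module"
  assumes M: "simple_left_module R M" and m: "m = annihilator R M \<inter> centre R"
  shows "left_module_iso R (U_mod R m) M"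
proof -
  have max: "m \<in> MaxSpec (centre_ring R)" unfolding m by (rule annihilator_contraction[OF M])
  interpret S: surjective_ring_hom R "fibre_ring R m" "to_fibre_ring R m"
    by (rule surjective_ring_hom_fibre(1)[OF max])
  have lM: "left_module R M" using M by (simp add: simple_left_module_def)
  obtain V :: "('a fibre, 'm) module" where V: "scalars_along R (to_fibre_ring R m) M V"
  proof (rule S.obtain_along[OF lM])
    show "a \<in> annihilator R M" if "a \<in> carrier R" "to_fibre_ring R m a = \<zero>\<^bsub>fibre_ring R m\<^esub>" for a
      using surjective_ring_hom_fibre(2)[OF max that(1)] that(2) annihilator_eq_extended_ideal[OF M]
      unfolding m[symmetric] by simp
  qed
  have "simple_left_module (fibre_ring R m) V" using S.simple_left_module_along[OF V] M by simp
  then have "left_module_iso (fibre_ring R m) (fibre_simple_module R m) V"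
    by (rule simple_left_module_unique[OF simple_artinian_fibre[OF max] simple_fibre_simple_module[OF max]])
  then show ?thesis using S.left_module_iso_along[OF scalars_along_U_mod V] by simp
qed

section \<open>Primitive ideals and isomorphism classes of simple modules\<close>

text \<open>Annihilators of simple modules have the form \<open>Rm\<close> because they are prime
  ideals over maximal ideals of the centre. Conversely, a copy of \<open>U(m)\<close> on a set of
  subsets of \<open>R\<close>, the kind of module that \<open>Prim\<close> admits, has annihilator
  \<open>Rm\<close>.\<close>

lemma Prim_eq: "Prim R = {extended_ideal R m | m. m \<in> MaxSpec (centre_ring R)}"
proof (intro equalityI subsetI)
  fix P assume "P \<in> Prim R"
  then obtain M :: "('a, 'a set) module" where "simple_left_module R M" "P = annihilator R M"
    by (auto simp: Prim_def)
  then show "P \<in> {extended_ideal R m | m. m \<in> MaxSpec (centre_ring R)}"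
    using annihilator_contraction annihilator_eq_extended_ideal by blast
next
  fix P assume "P \<in> {extended_ideal R m | m. m \<in> MaxSpec (centre_ring R)}"
  then obtain m where m: "m \<in> MaxSpec (centre_ring R)" "P = extended_ideal R m" by blast
  obtain N :: "('a, 'a set) module" where N: "simple_left_module R N" "left_module_iso R (U_mod R m) N"
    using simple_left_module_representative[OF simple_U_mod[OF m(1)]] by (elim exE conjE)
  have "annihilator R (U_mod R m) = annihilator R N"
    by (rule annihilator_iso) (use N simple_U_mod[OF m(1)] in \<open>simp_all add: simple_left_module_def\<close>)
  then have "P = annihilator R N" using annihilator_U_mod[OF m(1)] m(2) by simp
  then show "P \<in> Prim R" using N(1) unfolding Prim_def by blast
qed

lemma PL_eq: "PL R = MaxSpec (centre_ring R)"
proof (intro equalityI subsetI)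
  fix p assume "p \<in> PL R"
  then obtain m where "m \<in> MaxSpec (centre_ring R)" "p = extended_ideal R m \<inter> centre R"
    unfolding PL_def Prim_eq by blast
  then show "p \<in> MaxSpec (centre_ring R)" using contraction_MaxSpec by simp
next
  fix m assume m: "m \<in> MaxSpec (centre_ring R)"
  then have "extended_ideal R m \<in> Prim R" "m = extended_ideal R m \<inter> centre R"
    using contraction_MaxSpec unfolding Prim_eq by auto
  then show "m \<in> PL R" unfolding PL_def by blast
qed

lemma Prim_over_eq:
  assumes m: "m \<in> MaxSpec (centre_ring R)"
  shows "Prim_over R m = {extended_ideal R m}"
  using m contraction_MaxSpec unfolding Prim_over_def Prim_eq by auto

lemma iso_U_mod_iff:
  assumes m: "m \<in> MaxSpec (centre_ring R)" and M: "simple_left_module R M"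
  shows "left_module_iso R (U_mod R m) M \<longleftrightarrow> annihilator R M = extended_ideal R m"
proof
  assume "left_module_iso R (U_mod R m) M"
  then have "annihilator R (U_mod R m) = annihilator R M"
    by (intro annihilator_iso) (use M simple_U_mod[OF m] in \<open>simp_all add: simple_left_module_def\<close>)
  then show "annihilator R M = extended_ideal R m" using annihilator_U_mod[OF m] by simp
next
  assume "annihilator R M = extended_ideal R m"
  then show "left_module_iso R (U_mod R m) M"
    using contraction_MaxSpec[OF m] by (intro iso_U_mod[OF M]) simp
qed

lemma simple_module_class_U_mod:
  assumes m: "m \<in> MaxSpec (centre_ring R)"
  shows "simple_module_class R (U_mod R m) =
    {N. simple_left_module R N \<and> annihilator R N = extended_ideal R m}"
  using iso_U_mod_iff[OF m] unfolding simple_module_class_def by blast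

lemma simple_module_class_nonempty:
  assumes m: "m \<in> MaxSpec (centre_ring R)"
  shows "simple_module_class R (U_mod R m) \<noteq> {}"
proof -
  obtain N :: "('a, 'a set) module" where "simple_left_module R N" "left_module_iso R (U_mod R m) N"
    using simple_left_module_representative[OF simple_U_mod[OF m]] by (elim exE conjE)
  then show ?thesis unfolding simple_module_class_def by blast
qed

text \<open>Modules with equal annihilators are both isomorphic to \<open>U(m)\<close> for the
  common contraction \<open>m\<close>.\<close>

lemma iso_iff_annihilator_eq:
  assumes M: "simple_left_module R M" and N: "simple_left_module R N"
  shows "left_module_iso R M N \<longleftrightarrow> annihilator R M = annihilator R N"
proof
  show "annihilator R M = annihilator R N" if "left_module_iso R M N"
    by (rule annihilator_iso) (use that M N in \<open>simp_all add: simple_left_module_def\<close>)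
  assume eq: "annihilator R M = annihilator R N"
  let ?U = "U_mod R (annihilator R M \<inter> centre R)"
  have "left_module_iso R ?U M" "left_module_iso R ?U N"
    using iso_U_mod[OF M refl] iso_U_mod[OF N] eq by simp_all
  moreover have "left_module R ?U"
    using simple_U_mod[OF annihilator_contraction[OF M]] by (simp add: simple_left_module_def)
  ultimately show "left_module_iso R M N"
    using left_module_iso_sym left_module_iso_trans by metis
qed

text \<open>Isomorphism of simple modules is equality of annihilators, and every annihilator is some
  \<open>Rm\<close>; so a class consists of all simple modules with annihilator \<open>Rm\<close>
  for one \<open>m\<close>.\<close>

lemma simple_module_classes_eq:
  "simple_module_classes R = {simple_module_class R (U_mod R m) | m. m \<in> MaxSpec (centre_ring R)}"
proof -
  define r where "r = {(M :: ('a, 'a set) module, N :: ('a, 'a set) module).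
    simple_left_module R M \<and> simple_left_module R N \<and> left_module_iso R M N}"
  have classes: "simple_module_classes R = {M. simple_left_module R M} // r"
    unfolding simple_module_classes_def r_def ..
  have cls: "r `` {M} = simple_module_class R (U_mod R m)"
    if M: "simple_left_module R M" and m: "m \<in> MaxSpec (centre_ring R)" "annihilator R M = extended_ideal R m" for M m
    unfolding simple_module_class_U_mod[OF m(1)]
    using iso_iff_annihilator_eq[OF M] M m(2) by (auto simp: r_def)
  show ?thesis
  proof (intro equalityI subsetI)
    fix C assume "C \<in> simple_module_classes R"
    then obtain M where M: "simple_left_module R M" "C = r `` {M}"
      unfolding classes by (auto elim!: quotientE)
    have "C = simple_module_class R (U_mod R (annihilator R M \<inter> centre R))"
      unfolding M(2)
      by (rule cls[OF M(1) annihilator_contraction[OF M(1)] annihilator_eq_extended_ideal[OF M(1)]])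
    then show "C \<in> {simple_module_class R (U_mod R m) | m. m \<in> MaxSpec (centre_ring R)}"
      using annihilator_contraction[OF M(1)] by blast
  next
    fix C assume "C \<in> {simple_module_class R (U_mod R m) | m. m \<in> MaxSpec (centre_ring R)}"
    then obtain m where m: "m \<in> MaxSpec (centre_ring R)" "C = simple_module_class R (U_mod R m)" by blast
    obtain M where "M \<in> C" using simple_module_class_nonempty[OF m(1)] m(2) by blast
    then have M: "simple_left_module R M" "annihilator R M = extended_ideal R m"
      unfolding m(2) simple_module_class_U_mod[OF m(1)] by auto
    have "C = r `` {M}" unfolding m(2) by (rule cls[OF M(1) m(1) M(2), symmetric])
    then show "C \<in> simple_module_classes R"
      using M(1) unfolding classes by (auto intro!: quotientI)
  qed
qed

lemma class_annihilator_U_mod: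
  assumes m: "m \<in> MaxSpec (centre_ring R)"
  shows "class_annihilator R (simple_module_class R (U_mod R m)) = extended_ideal R m"
proof -
  have "annihilator R ` simple_module_class R (U_mod R m) = {extended_ideal R m}"
    using simple_module_class_nonempty[OF m] unfolding simple_module_class_U_mod[OF m] by auto
  then show ?thesis by (simp add: class_annihilator_def)
qed

lemma bij_betw_class_annihilator:
  "bij_betw (class_annihilator R) (simple_module_classes R) (Prim R)"
  unfolding bij_betw_def
proof
  show "inj_on (class_annihilator R) (simple_module_classes R)"
  proof (rule inj_onI)
    fix C C' assume "C \<in> simple_module_classes R" "C' \<in> simple_module_classes R"
      and eq: "class_annihilator R C = class_annihilator R C'"
    then obtain m m' where m: "m \<in> MaxSpec (centre_ring R)" "C = simple_module_class R (U_mod R m)"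
      and m': "m' \<in> MaxSpec (centre_ring R)" "C' = simple_module_class R (U_mod R m')"
      unfolding simple_module_classes_eq by blast
    have "extended_ideal R m = extended_ideal R m'"
      using eq class_annihilator_U_mod[OF m(1)] class_annihilator_U_mod[OF m'(1)] m(2) m'(2) by simp
    then have "extended_ideal R m \<inter> centre R = extended_ideal R m' \<inter> centre R" by (rule arg_cong)
    then have "m = m'" unfolding contraction_MaxSpec[OF m(1)] contraction_MaxSpec[OF m'(1)] .
    then show "C = C'" using m(2) m'(2) by simp
  qed
  show "class_annihilator R ` simple_module_classes R = Prim R"
  proof (intro equalityI subsetI)
    fix P assume "P \<in> class_annihilator R ` simple_module_classes R"
    then obtain m where m: "m \<in> MaxSpec (centre_ring R)"
      "P = class_annihilator R (simple_module_class R (U_mod R m))"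
      unfolding simple_module_classes_eq by blast
    then show "P \<in> Prim R" using class_annihilator_U_mod[OF m(1)] unfolding Prim_eq by auto
  next
    fix P assume "P \<in> Prim R"
    then obtain m where m: "m \<in> MaxSpec (centre_ring R)" "P = extended_ideal R m" unfolding Prim_eq by blast
    have "simple_module_class R (U_mod R m) \<in> simple_module_classes R"
      unfolding simple_module_classes_eq using m(1) by blast
    moreover have "P = class_annihilator R (simple_module_class R (U_mod R m))"
      using class_annihilator_U_mod[OF m(1)] m(2) by simp
    ultimately show "P \<in> class_annihilator R ` simple_module_classes R" by blast
  qed
qed

lemma inv_into_class_annihilator:
  assumes m: "m \<in> MaxSpec (centre_ring R)"
  shows "inv_into (simple_module_classes R) (class_annihilator R) (extended_ideal R m) =
    simple_module_class R (U_mod R m)"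
proof -
  have "simple_module_class R (U_mod R m) \<in> simple_module_classes R"
    unfolding simple_module_classes_eq using m by blast
  from inv_into_f_f[OF bij_betw_imp_inj_on[OF bij_betw_class_annihilator] this]
  show ?thesis unfolding class_annihilator_U_mod[OF m] .
qed

section \<open>Matrix form of the quotients \<open>R/Rm\<close>\<close>

text \<open>\<open>U(m)\<close> comes from the fibre ring, but the matrix decomposition concerns
  \<open>R/Rm\<close>; the \<open>R\<close>-action descends to this quotient because
  \<open>Rm\<close> is the annihilator, and the resulting module is faithful.\<close>

lemma obtain_quotient_module:
  assumes m: "m \<in> MaxSpec (centre_ring R)"
  obtains V :: "('a set, 'a fibre set) module" where
    "simple_left_module (R Quot extended_ideal R m) V"
    "scalars_along R (\<lambda>a. extended_ideal R m +> a) (U_mod R m) V"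
    "annihilator (R Quot extended_ideal R m) V = {\<zero>\<^bsub>R Quot extended_ideal R m\<^esub>}"
proof -
  let ?I = "extended_ideal R m"
  let ?A = "R Quot ?I" and ?q = "\<lambda>a. ?I +> a"
  have id: "ideal ?I R" by (rule ideal_extended_ideal[OF ring_R MaxSpec_centre(2)[OF m]])
  interpret I: ideal ?I R by (rule id)
  interpret q: surjective_ring_hom R ?A ?q by (rule surjective_ring_hom_quotient[OF ring_R id])
  have zero: "?q a = \<zero>\<^bsub>?A\<^esub> \<longleftrightarrow> a \<in> ?I" if "a \<in> carrier R" for a
  proof
    assume "?q a = \<zero>\<^bsub>?A\<^esub>"
    then have "?q a = ?I" by (simp add: FactRing_def)
    then show "a \<in> ?I" using I.rcos_const_imp_mem[OF that] by simp
  next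
    assume "a \<in> ?I"
    then have "?q a = ?I" by (rule R.a_rcos_zero[OF id])
    then show "?q a = \<zero>\<^bsub>?A\<^esub>" by (simp add: FactRing_def)
  qed
  have lU: "left_module R (U_mod R m)" using simple_U_mod[OF m] by (simp add: simple_left_module_def)
  obtain V :: "('a set, 'a fibre set) module" where V: "scalars_along R ?q (U_mod R m) V"
    by (rule q.obtain_along[OF lU]) (use zero annihilator_U_mod[OF m] in auto)
  have sV: "simple_left_module ?A V" using q.simple_left_module_along[OF V] simple_U_mod[OF m] by simp
  then have lV: "left_module ?A V" by (simp add: simple_left_module_def)
  have "annihilator ?A V = {\<zero>\<^bsub>?A\<^esub>}"
  proof (intro equalityI subsetI)
    fix t assume t: "t \<in> annihilator ?A V"
    then have "t \<in> carrier ?A" by (simp add: annihilator_def)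
    then obtain a where a: "a \<in> carrier R" "t = ?q a" using q.surj by auto
    then have "a \<in> annihilator R (U_mod R m)" using t q.annihilator_along[OF V lV] by simp
    then show "t \<in> {\<zero>\<^bsub>?A\<^esub>}" using a zero annihilator_U_mod[OF m] by simp
  next
    fix t assume "t \<in> {\<zero>\<^bsub>?A\<^esub>}"
    then show "t \<in> annihilator ?A V"
      using additive_subgroup.zero_closed[OF ideal.axioms(1)[OF ideal_annihilator[OF lV]]] by simp
  qed
  with sV V show ?thesis by (rule that)
qed

lemma endomorphism_ring_U_mod_iso:
  fixes D :: "'d ring"
  assumes m: "m \<in> MaxSpec (centre_ring R)" and D: "division_ring D"
    and iso: "R Quot extended_ideal R m \<simeq> matrix_ring n D"
  shows "endomorphism_ring R (U_mod R m) \<simeq> D"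
proof -
  have id: "ideal (extended_ideal R m) R" by (rule ideal_extended_ideal[OF ring_R MaxSpec_centre(2)[OF m]])
  obtain V :: "('a set, 'a fibre set) module" where V: "simple_left_module (R Quot extended_ideal R m) V"
    "scalars_along R (\<lambda>a. extended_ideal R m +> a) (U_mod R m) V"
    "annihilator (R Quot extended_ideal R m) V = {\<zero>\<^bsub>R Quot extended_ideal R m\<^esub>}"
    by (rule obtain_quotient_module[OF m])
  have "endomorphism_ring (R Quot extended_ideal R m) V \<simeq> D"
    by (rule endomorphism_ring_iso_matrix[OF ideal.quotient_is_ring[OF id] V(1,3) D iso])
  then show ?thesis
    using surjective_ring_hom.endomorphism_ring_along[OF surjective_ring_hom_quotient[OF ring_R id] V(2)] by simp
qed

text \<open>The finite set with annihilator \<open>Rm\<close> is found over \<open>R\<close>, where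
  the artinian fibre is available, and then read in the module over \<open>R/Rm\<close>, which has
  the same carrier. \<open>D\<close> arises as a corner of \<open>R/Rm\<close>, hence as a ring of
  cosets.\<close>

lemma quotient_iso_matrix_ring:
  assumes m: "m \<in> MaxSpec (centre_ring R)"
  obtains n and D :: "'a set ring" where "n > 0" "division_ring D"
    "R Quot extended_ideal R m \<simeq> matrix_ring n D"
proof -
  let ?A = "R Quot extended_ideal R m"
  obtain V :: "('a set, 'a fibre set) module" where V: "simple_left_module ?A V"
    "scalars_along R (\<lambda>a. extended_ideal R m +> a) (U_mod R m) V" "annihilator ?A V = {\<zero>\<^bsub>?A\<^esub>}"
    by (rule obtain_quotient_module[OF m])
  have id: "ideal (extended_ideal R m) R" by (rule ideal_extended_ideal[OF ring_R MaxSpec_centre(2)[OF m]])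
  interpret q: surjective_ring_hom R ?A "\<lambda>a. extended_ideal R m +> a"
    by (rule surjective_ring_hom_quotient[OF ring_R id])
  have prime: "primeideal m (centre_ring R)"
    by (rule cring.maximalideal_prime[OF cring_centre_ring[OF ring_R] MaxSpec_centre(1)[OF m]])
  have ann: "annihilator R (U_mod R m) \<inter> centre R = m"
    using annihilator_U_mod[OF m] contraction_MaxSpec[OF m] by simp
  have art: "artinian_ring (fibre_ring R m)"
    using simple_artinian_fibre[OF m] by (simp add: simple_artinian_ring_def)
  obtain G where G: "finite G" "G \<subseteq> carrier (U_mod R m)"
    "annihilator_of R (U_mod R m) G = annihilator R (U_mod R m)"
    by (rule central_localization.finite_annihilator[OF central_localization_fibre[OF prime] art simple_U_mod[OF m] ann])
  note s = q.along_simps[OF V(2)]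
  have GV: "G \<subseteq> carrier V" using G(2) s(1) by simp
  have "annihilator_of ?A V G = annihilator ?A V"
  proof (intro equalityI subsetI)
    fix t assume t: "t \<in> annihilator_of ?A V G"
    then have "t \<in> carrier ?A" by (simp add: annihilator_of_def)
    then obtain a where a: "a \<in> carrier R" "t = extended_ideal R m +> a" using q.surj by auto
    have "a \<in> annihilator_of R (U_mod R m) G"
      unfolding annihilator_of_def
    proof (intro CollectI conjI ballI)
      fix x assume x: "x \<in> G"
      then show "a \<odot>\<^bsub>U_mod R m\<^esub> x = \<zero>\<^bsub>U_mod R m\<^esub>"
        using t a s(4)[OF a(1), of x] s(3) GV by (auto simp: annihilator_of_def)
    qed (rule a(1))
    then have "a \<in> annihilator R (U_mod R m)" using G(3) by simp
    moreover have "left_module ?A V" using V(1) by (simp add: simple_left_module_def)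
    ultimately show "t \<in> annihilator ?A V" using q.annihilator_along[OF V(2)] a(2) by simp
  next
    fix t assume "t \<in> annihilator ?A V"
    then show "t \<in> annihilator_of ?A V G" using GV by (auto simp: annihilator_def annihilator_of_def)
  qed
  note GA = this
  obtain F where F: "finite F" "F \<subseteq> carrier V" "annihilator_of ?A V F = annihilator ?A V"
    and interp: "\<And>y. y \<in> F \<rightarrow> carrier V \<Longrightarrow> \<exists>r\<in>carrier ?A. \<forall>x\<in>F. r \<odot>\<^bsub>V\<^esub> x = y x"
    by (rule simple_left_module_interpolation[OF V(1) G(1) GV GA], rule that)
  show ?thesis
    by (rule faithful_simple_imp_matrix_ring[OF V(1) F(1,2) F(3)[unfolded V(3)] interp]) (assumption, rule that)
qed

end

theorem theorem1p4:
  fixes R :: "('a, 'k) ring_scheme"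
  assumes "ring R"
    and "free_left_module (centre_ring R) (regular_module R)"
    and "\<And>p. p \<in> ZL R \<Longrightarrow> simple_artinian_ring (fibre_ring R p)"
  shows
    "(PLM_ring R \<and> PL R = MaxSpec (centre_ring R))
   \<and> (\<forall>m \<in> MaxSpec (centre_ring R). Prim_over R m = {extended_ideal R m})
   \<and> (Prim R = MaxSpec R \<and> MaxSpec R = {extended_ideal R m | m. m \<in> MaxSpec (centre_ring R)})
   \<and> ((\<forall>m \<in> MaxSpec (centre_ring R).
          simple_artinian_ring (fibre_ring R m)
        \<and> simple_left_module (fibre_ring R m) (fibre_simple_module R m)
        \<and> (\<forall>M :: ('a fibre, 'v) module. simple_left_module (fibre_ring R m) M \<longrightarrow>
             left_module_iso (fibre_ring R m) M (fibre_simple_module R m))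
        \<and> simple_left_module R (U_mod R m))
      \<and> simple_module_classes R =
          {simple_module_class R (U_mod R m) | m. m \<in> MaxSpec (centre_ring R)})
   \<and> (bij_betw (class_annihilator R) (simple_module_classes R) (Prim R)
      \<and> (\<forall>m \<in> MaxSpec (centre_ring R).
          class_annihilator R (simple_module_class R (U_mod R m)) = annihilator R (U_mod R m)
        \<and> annihilator R (U_mod R m) = extended_ideal R m
        \<and> inv_into (simple_module_classes R) (class_annihilator R) (extended_ideal R m) =
            simple_module_class R (U_mod R m)))
   \<and> (\<forall>m \<in> MaxSpec (centre_ring R).
        (\<exists>n > 0. \<exists>D :: 'a set ring. division_ring D
           \<and> R Quot extended_ideal R m \<simeq> matrix_ring n D
           \<and> endomorphism_ring R (U_mod R m) \<simeq> D)
      \<and> (\<forall>n. \<forall>D :: 'd ring. division_ring D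
           \<and> R Quot extended_ideal R m \<simeq> matrix_ring n D
           \<longrightarrow> endomorphism_ring R (U_mod R m) \<simeq> D))"
proof -
  interpret simple_artinian_fibres R using assms by (rule simple_artinian_fibres.intro)
  let ?M = "MaxSpec (centre_ring R)"
  have 1: "PLM_ring R \<and> PL R = ?M" using ring_R PL_eq by (simp add: PLM_ring_def)
  have 2: "\<forall>m\<in>?M. Prim_over R m = {extended_ideal R m}" using Prim_over_eq by blast
  have 3: "Prim R = MaxSpec R \<and> MaxSpec R = {extended_ideal R m | m. m \<in> ?M}"
    using Prim_eq MaxSpec_eq by simp
  have 4: "left_module_iso (fibre_ring R m) M (fibre_simple_module R m)"
    if "m \<in> ?M" "simple_left_module (fibre_ring R m) M" for m and M :: "('a fibre, 'v) module"
    by (rule simple_left_module_unique[OF simple_artinian_fibre[OF that(1)] that(2) simple_fibre_simple_module[OF that(1)]])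
  have 6: "\<exists>n > 0. \<exists>D :: 'a set ring. division_ring D \<and> R Quot extended_ideal R m \<simeq> matrix_ring n D \<and>
      endomorphism_ring R (U_mod R m) \<simeq> D" if m: "m \<in> ?M" for m
  proof -
    obtain n and D :: "'a set ring" where D: "n > 0" "division_ring D" "R Quot extended_ideal R m \<simeq> matrix_ring n D"
      by (rule quotient_iso_matrix_ring[OF m])
    show ?thesis using D endomorphism_ring_U_mod_iso[OF m D(2,3)] by blast
  qed
  \<comment> \<open>The existence of one matrix description and the claim for every such
    description, with \<open>D\<close> on any type, both rest on
    \<open>endomorphism_ring_U_mod_iso\<close>.\<close>
  show ?thesis
    by (intro conjI 1 2 3 ballI allI impI 4 6 simple_artinian_fibre simple_fibre_simple_module simple_U_mod
        simple_module_classes_eq bij_betw_class_annihilator inv_into_class_annihilator annihilator_U_mod)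
      (simp_all add: class_annihilator_U_mod annihilator_U_mod, (erule conjE, rule endomorphism_ring_U_mod_iso, assumption+)+)
qed

end
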